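(* There is a diffeomorphism $f : \mathbb{T}^3 \to \mathbb{T}^3$ with a sink $z \in \mathbb{T}^3$ and a global dominated splitting into three subbundles $T\mathbb{T}^3 = E^u \oplus E^c \oplus E^s$ such that, if $B(z)$ denotes the basin of attraction of $z$, then the boundary of $B(z)$ is the union of two distinct intersecting tori tangent to $E^c \oplus E^s$, and the splitting is partially hyperbolic on all of $\mathbb{T}^3 \setminus B(z)$.
   Context: $\mathbb{T}^3 = \mathbb{R}^3/\mathbb{Z}^3$. A sink is an attracting fixed point of $f$, and its basin is $B(z) = \{x : \lim_{n\to\infty} f^n(x) = z\}$. A global dominated splitting here means that the three subbundles are non-zero (hence one-dimensional), continuous and $Df$-invariant over all of $\mathbb{T}^3$ and, for a suitable Riemannian metric, $\|Df v^s\| < \|Df v^c\| < \|Df v^u\|$ for all $x \in \mathbb{T}^3$ and unit vectors $v^s \in E^s(x)$, $v^c \in E^c(x)$, $v^u \in E^u(x)$. The splitting is partially hyperbolic on an invariant set $X$ if in addition $\|Df v^s\| < 1 < \|Df v^u\|$ for all $x \in X$ and unit vectors $v^s \in E^s(x)$, $v^u \in E^u(x)$. The tori are embedded $C^1$ 2-tori $T$ in $\mathbb{T}^3$, and tangent to $E^c\oplus E^s$ means $T_xT = E^c(x)\oplus E^s(x)$ for all $x \in T$. *)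

theory Defs
  imports "HOL-Analysis.Analysis"
begin

section \<open>The torus \<open>\<real>\<^sup>n / \<int>\<^sup>n\<close>\<close>

definition lattice_equiv :: "real ^ 'n \<Rightarrow> real ^ 'n \<Rightarrow> bool" where
  "lattice_equiv x y \<longleftrightarrow> (\<forall>i. x $ i - y $ i \<in> \<int>)"

lemma equivp_lattice_equiv: "equivp (lattice_equiv :: real ^ 'n \<Rightarrow> _)"
proof (rule equivpI)
  show "reflp (lattice_equiv :: real ^ 'n \<Rightarrow> _)"
    by (simp add: reflp_def lattice_equiv_def)
  show "symp (lattice_equiv :: real ^ 'n \<Rightarrow> _)"
  proof (rule sympI, unfold lattice_equiv_def, rule allI)
    fix x y :: "real ^ 'n" and i
    assume "\<forall>i. x $ i - y $ i \<in> \<int>"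
    hence "- (x $ i - y $ i) \<in> \<int>" by (intro Ints_minus) auto
    thus "y $ i - x $ i \<in> \<int>" by simp
  qed
  show "transp (lattice_equiv :: real ^ 'n \<Rightarrow> _)"
  proof (rule transpI, unfold lattice_equiv_def, rule allI)
    fix x y z :: "real ^ 'n" and i
    assume "\<forall>i. x $ i - y $ i \<in> \<int>" and "\<forall>i. y $ i - z $ i \<in> \<int>"
    hence "(x $ i - y $ i) + (y $ i - z $ i) \<in> \<int>"
      by (intro Ints_add) auto
    thus "x $ i - z $ i \<in> \<int>" by simp
  qed
qed

quotient_type 'n torus = "real ^ 'n::finite" / "lattice_equiv :: real ^ 'n::finite \<Rightarrow> _"
  morphisms torus_rep torus_proj
  by (rule equivp_lattice_equiv)

lemma torus_proj_eq_iff: "torus_proj x = torus_proj y \<longleftrightarrow> (\<forall>i. x $ i - y $ i \<in> \<int>)"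
  using torus.abs_eq_iff[of x y] by (simp add: lattice_equiv_def)

lemma torus_proj_surj: "\<exists>x. torus_proj x = p"
  using Quotient3_abs_rep[OF Quotient3_torus] by blast

text \<open>The quotient topology.\<close>

instantiation torus :: (finite) topological_space
begin

definition open_torus :: "'a torus set \<Rightarrow> bool" where
  "open_torus U \<longleftrightarrow> open (torus_proj -` U)"

instance
proof
  show "open (UNIV :: 'a torus set)"
    by (simp add: open_torus_def)
  show "open (S \<inter> T)" if "open S" "open T" for S T :: "'a torus set"
    using that by (simp add: open_torus_def open_Int)
  show "open (\<Union> K)" if "\<forall>S\<in>K. open S" for K :: "'a torus set set"
    using that by (auto simp: open_torus_def vimage_Union)
qed

end


section \<open>Differential calculus on tori\<close>

text \<open>
  The projection \<open>torus_proj\<close> is a local diffeomorphism whose deck transformations are translations,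
  so it identifies every tangent space of \<open>'n torus\<close> canonically with \<open>real ^ 'n\<close>.
  With this identification, the derivative of a map at \<open>p\<close> is the derivative of a local lift \<open>F\<close> at a
  point above \<open>p\<close>.
\<close>

definition has_torus_derivative ::
  "('n::finite torus \<Rightarrow> 'm::finite torus) \<Rightarrow> (real ^ 'n \<Rightarrow> real ^ 'm) \<Rightarrow> 'n torus \<Rightarrow> bool" where
  "has_torus_derivative f D p \<longleftrightarrow>
     (\<exists>F x. torus_proj x = p \<and> (\<forall>\<^sub>F y in nhds x. torus_proj (F y) = f (torus_proj y)) \<and>
            (F has_derivative D) (at x))"

lemma has_torus_derivative_unique:
  assumes "has_torus_derivative f D p" and "has_torus_derivative f D' p"
  shows "D = D'"
proof -
  obtain F x where x: "torus_proj x = p"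
    and F: "\<forall>\<^sub>F y in nhds x. torus_proj (F y) = f (torus_proj y)"
    and D: "(F has_derivative D) (at x)"
    using assms(1) unfolding has_torus_derivative_def by blast
  obtain F' x' where x': "torus_proj x' = p"
    and F': "\<forall>\<^sub>F y in nhds x'. torus_proj (F' y) = f (torus_proj y)"
    and D': "(F' has_derivative D') (at x')"
    using assms(2) unfolding has_torus_derivative_def by blast
  define a where "a = x' - x"
  define G where "G y = F' (y + a) - F y" for y
  have a_int: "\<forall>i. a $ i \<in> \<int>"
    using x x' by (metis a_def torus_proj_eq_iff vector_minus_component)
  have proj_a: "torus_proj (y + a) = torus_proj y" for y
    using a_int by (simp add: torus_proj_eq_iff)
  have "((\<lambda>y. y + a) has_derivative (\<lambda>v. v)) (at x)"
    by (auto intro!: derivative_eq_intros)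
  moreover have "(F' has_derivative D') (at (x + a))"
    using D' by (simp add: a_def)
  ultimately have D'a: "((\<lambda>y. F' (y + a)) has_derivative D') (at x)"
    using has_derivative_compose by fastforce
  have "filterlim (\<lambda>y. y + a) (nhds x') (nhds x)"
    using tendsto_add[OF filterlim_ident tendsto_const[of a], of x] by (simp add: a_def)
  hence "\<forall>\<^sub>F y in nhds x. torus_proj (F' (y + a)) = f (torus_proj (y + a))"
    by (rule eventually_compose_filterlim[OF F'])
  with F have G_int: "\<forall>\<^sub>F y in nhds x. \<forall>i. G y $ i \<in> \<int>"
    by eventually_elim (metis proj_a torus_proj_eq_iff G_def vector_minus_component)
  have "isCont G x"
    unfolding G_def
    by (intro continuous_diff has_derivative_continuous[OF D] has_derivative_continuous[OF D'a])
  hence "\<forall>\<^sub>F y in nhds x. dist (G y) (G x) < 1"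
    by (metis tendstoD isCont_def tendsto_at_iff_tendsto_nhds zero_less_one)
  with G_int have G_const: "\<forall>\<^sub>F y in nhds x. G y = G x"
  proof eventually_elim
    case (elim y)
    have "G y $ i = G x $ i" for i
    proof -
      have "G y $ i - G x $ i \<in> \<int>"
        using elim eventually_nhds_x_imp_x[OF G_int] by (metis Ints_diff)
      moreover have "\<bar>G y $ i - G x $ i\<bar> < 1"
        using elim(2) component_le_norm_cart[of "G y - G x" i] by (simp add: dist_norm)
      ultimately show ?thesis
        by (metis Ints_nonzero_abs_less1 right_minus_eq)
    qed
    thus ?case by (simp add: vec_eq_iff)
  qed
  have ev: "\<forall>\<^sub>F y in nhds x. F' (y + a) = F y + G x"
    using G_const by eventually_elim (metis G_def add.commute diff_add_cancel)
  have "((\<lambda>y. F y + G x) has_derivative D) (at x)"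
    using D by (auto intro!: derivative_eq_intros)
  hence "((\<lambda>y. F' (y + a)) has_derivative D) (at x)"
    using has_derivative_transform_eventually[of "\<lambda>y. F y + G x" D x UNIV "\<lambda>y. F' (y + a)"]
      ev eventually_nhds_x_imp_x[OF ev] by (simp add: eventually_at_filter eventually_mono)
  thus ?thesis
    using D'a by (rule has_derivative_unique)
qed

definition torus_deriv ::
  "('n::finite torus \<Rightarrow> 'm::finite torus) \<Rightarrow> 'n torus \<Rightarrow> real ^ 'n \<Rightarrow> real ^ 'm" where
  "torus_deriv f p = (THE D. has_torus_derivative f D p)"

lemma torus_deriv_eq: "has_torus_derivative f D p \<Longrightarrow> torus_deriv f p = D"
  unfolding torus_deriv_def by (blast intro: has_torus_derivative_unique)

text \<open>
  In finite dimension, continuity of \<open>p \<mapsto> Df(p)\<close> as a map into linear maps is pointwise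
  continuity.
\<close>

definition C1_torus_map :: "('n::finite torus \<Rightarrow> 'm::finite torus) \<Rightarrow> bool" where
  "C1_torus_map f \<longleftrightarrow>
     (\<forall>p. \<exists>D. has_torus_derivative f D p) \<and> (\<forall>v. continuous_on UNIV (\<lambda>p. torus_deriv f p v))"

text \<open>As usual for dominated splittings, diffeomorphisms are of class \<open>C\<^sup>1\<close>.\<close>

definition torus_diffeo :: "('n::finite torus \<Rightarrow> 'n torus) \<Rightarrow> bool" where
  "torus_diffeo f \<longleftrightarrow> bij f \<and> C1_torus_map f \<and> C1_torus_map (inv f)"

definition C1_torus_embedding :: "('n::finite torus \<Rightarrow> 'm::finite torus) \<Rightarrow> bool" where
  "C1_torus_embedding i \<longleftrightarrow>
     C1_torus_map i \<and> (\<forall>p. inj (torus_deriv i p)) \<and> (\<exists>j. homeomorphism UNIV (range i) i j)"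


section \<open>Riemannian metrics\<close>

primrec Ck :: "nat \<Rightarrow> (real ^ 'n \<Rightarrow> real) \<Rightarrow> bool" where
  "Ck 0 h \<longleftrightarrow> continuous_on UNIV h"
| "Ck (Suc k) h \<longleftrightarrow>
     (\<forall>x. h differentiable at x) \<and> (\<forall>v. Ck k (\<lambda>x. frechet_derivative h (at x) v))"

definition riemannian_metric ::
  "('n::finite torus \<Rightarrow> real ^ 'n \<Rightarrow> real ^ 'n \<Rightarrow> real) \<Rightarrow> bool" where
  "riemannian_metric g \<longleftrightarrow>
     (\<forall>p. bilinear (g p) \<and> (\<forall>u v. g p u v = g p v u) \<and> (\<forall>v. v \<noteq> 0 \<longrightarrow> g p v v > 0)) \<and>
     (\<forall>u v k. Ck k (\<lambda>x. g (torus_proj x) u v))"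

definition metric_norm ::
  "('n::finite torus \<Rightarrow> real ^ 'n \<Rightarrow> real ^ 'n \<Rightarrow> real) \<Rightarrow> 'n torus \<Rightarrow> real ^ 'n \<Rightarrow> real" where
  "metric_norm g p v = sqrt (g p v v)"


section \<open>Invariant splittings\<close>

text \<open>A continuous subbundle is one that is locally spanned by a continuous frame.\<close>

definition continuous_subbundle :: "('n::finite torus \<Rightarrow> (real ^ 'n) set) \<Rightarrow> bool" where
  "continuous_subbundle E \<longleftrightarrow>
     (\<forall>p. subspace (E p)) \<and>
     (\<forall>p. \<exists>U k \<sigma>. open U \<and> p \<in> U \<and> (\<forall>i<k. continuous_on U (\<sigma> i)) \<and>
        (\<forall>q\<in>U. E q = span ((\<lambda>i::nat. \<sigma> i q) ` {..<k}) \<and> dim (E q) = k))"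

definition nonzero_bundle :: "('n::finite torus \<Rightarrow> (real ^ 'n) set) \<Rightarrow> bool" where
  "nonzero_bundle E \<longleftrightarrow> (\<forall>p. E p \<noteq> {0})"

definition invariant_bundle ::
  "('n::finite torus \<Rightarrow> 'n torus) \<Rightarrow> ('n torus \<Rightarrow> (real ^ 'n) set) \<Rightarrow> bool" where
  "invariant_bundle f E \<longleftrightarrow> (\<forall>p. torus_deriv f p ` E p = E (f p))"

definition bundle_sum ::
  "('n::finite torus \<Rightarrow> (real ^ 'n) set) \<Rightarrow> ('n torus \<Rightarrow> (real ^ 'n) set) \<Rightarrow>
   'n torus \<Rightarrow> (real ^ 'n) set" where
  "bundle_sum E F p = {a + b |a b. a \<in> E p \<and> b \<in> F p}"

definition dominated_splitting ::
  "('n::finite torus \<Rightarrow> 'n torus) \<Rightarrow> ('n torus \<Rightarrow> real ^ 'n \<Rightarrow> real ^ 'n \<Rightarrow> real) \<Rightarrow>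
   ('n torus \<Rightarrow> (real ^ 'n) set) \<Rightarrow> ('n torus \<Rightarrow> (real ^ 'n) set) \<Rightarrow>
   ('n torus \<Rightarrow> (real ^ 'n) set) \<Rightarrow> bool" where
  "dominated_splitting f g Eu Ec Es \<longleftrightarrow>
     (\<forall>E\<in>{Eu, Ec, Es}. continuous_subbundle E \<and> nonzero_bundle E \<and> invariant_bundle f E) \<and>
     (\<forall>p v. \<exists>!(a, b, c). a \<in> Eu p \<and> b \<in> Ec p \<and> c \<in> Es p \<and> v = a + b + c) \<and>
     (\<forall>p. \<forall>vs\<in>Es p. \<forall>vc\<in>Ec p. \<forall>vu\<in>Eu p.
        metric_norm g p vs = 1 \<longrightarrow> metric_norm g p vc = 1 \<longrightarrow> metric_norm g p vu = 1 \<longrightarrow>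
        metric_norm g (f p) (torus_deriv f p vs) < metric_norm g (f p) (torus_deriv f p vc) \<and>
        metric_norm g (f p) (torus_deriv f p vc) < metric_norm g (f p) (torus_deriv f p vu))"

definition partially_hyperbolic_on ::
  "'n::finite torus set \<Rightarrow> ('n torus \<Rightarrow> 'n torus) \<Rightarrow>
   ('n torus \<Rightarrow> real ^ 'n \<Rightarrow> real ^ 'n \<Rightarrow> real) \<Rightarrow> ('n torus \<Rightarrow> (real ^ 'n) set) \<Rightarrow>
   ('n torus \<Rightarrow> (real ^ 'n) set) \<Rightarrow> ('n torus \<Rightarrow> (real ^ 'n) set) \<Rightarrow> bool" where
  "partially_hyperbolic_on X f g Eu Ec Es \<longleftrightarrow>
     f ` X = X \<and> dominated_splitting f g Eu Ec Es \<and>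
     (\<forall>p\<in>X. \<forall>vs\<in>Es p. \<forall>vu\<in>Eu p. metric_norm g p vs = 1 \<longrightarrow> metric_norm g p vu = 1 \<longrightarrow>
        metric_norm g (f p) (torus_deriv f p vs) < 1 \<and>
        1 < metric_norm g (f p) (torus_deriv f p vu))"


section \<open>Sinks and tangent tori\<close>

definition basin :: "('a::topological_space \<Rightarrow> 'a) \<Rightarrow> 'a \<Rightarrow> 'a set" where
  "basin f z = {x. (\<lambda>n. (f ^^ n) x) \<longlonglongrightarrow> z}"

text \<open>Attracting means asymptotically stable: Lyapunov stable, and the basin is a neighbourhood.\<close>

definition sink :: "('a::topological_space \<Rightarrow> 'a) \<Rightarrow> 'a \<Rightarrow> bool" where
  "sink f z \<longleftrightarrow>
     f z = z \<and>
     (\<forall>U. open U \<and> z \<in> U \<longrightarrow> (\<exists>V. open V \<and> z \<in> V \<and> (\<forall>x\<in>V. \<forall>n. (f ^^ n) x \<in> U))) \<and>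
     (\<exists>W. open W \<and> z \<in> W \<and> W \<subseteq> basin f z)"

text \<open>
  \<open>T\<close> is an embedded \<open>C\<^sup>1\<close> 2-torus whose tangent space at every point \<open>i p\<close>, which is the range of
  the derivative at \<open>p\<close> of a parametrisation \<open>i\<close>, is \<open>E (i p)\<close>.
\<close>

definition embedded_2torus_tangent_to ::
  "'n::finite torus set \<Rightarrow> ('n torus \<Rightarrow> (real ^ 'n) set) \<Rightarrow> bool" where
  "embedded_2torus_tangent_to T E \<longleftrightarrow>
     (\<exists>i :: 2 torus \<Rightarrow> 'n torus.
        C1_torus_embedding i \<and> range i = T \<and> (\<forall>p. range (torus_deriv i p) = E (i p)))"

end

theory Submission
  imports Defs
begin

text \<open>
  Let \<open>u\<close>, \<open>s\<close> be eigencoordinates of a hyperbolic automorphism of the 2-torus with eigenvalues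
  \<open>mu > 1 > lam\<close>, and let \<open>w\<close> in \<open>\<real>/117\<int>\<close> be the third coordinate. Vertically we use a circle
  map \<open>psi0\<close> with a source of slope 20 at \<open>w = 0\<close> and a sink of slope 1/2 at the antipode. Since
  \<open>1/2 < mu < 20\<close>, the unstable bundle is vertical near \<open>w = 0\<close> and horizontal far away. A shear
  between these two regions, whose sign is that of \<open>w\<close>, rotates the center and the unstable
  direction past each other without letting them meet; both are fixed points of graph transforms,
  as is the stable direction.

  Close to \<open>w = 0\<close> the map is modified over a small disc around the fixed point \<open>x = 0\<close>. The
  horizontal map becomes a derived-from-Anosov map \<open>G\<close> with a sink at 0, and the vertical map
  becomes \<open>20 w - r(x) H(20 w / (r(x) + Rc))\<close> with a bump \<open>r\<close>, where \<open>H\<close> is odd, \<open>H(1) = 1\<close>,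
  \<open>H'(1) = 0\<close> and \<open>y < H(y)\<close> on \<open>(0, 1)\<close>. This turns the origin into a sink while the points with
  \<open>\<bar>w\<bar> = (r(x) + Rc) / 20\<close> are still expanded by 20. The basin is the lens \<open>\<bar>w\<bar> < \<tau>(x)\<close>,
  where \<open>\<tau> \<ge> 0\<close> is the bounded solution of \<open>\<tau>(G x) = 20 \<tau>(x) - r(x)\<close>; it is \<open>C\<^sup>1\<close> because 20
  dominates the derivative of \<open>G\<close>. It is positive on a dense set and vanishes on the nonempty set
  of points whose \<open>G\<close>-orbit avoids the disc. Hence the boundary of the basin consists of the two
  graphs \<open>w = \<plusminus>\<tau>(x)\<close>, which meet where \<open>\<tau>\<close> vanishes. Their normal direction is expanded by 20,
  more than any vector of the center-stable plane, which forces tangency.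
\<close>

text \<open>The tangent planes of the tori are graphs over the horizontal plane, whereas far away
  the horizontal is the most expanded direction; so center and unstable line must trade places along
  the vertical circle. A shear function on the circle has a derivative of mean zero, which therefore
  changes sign; placing the change at \<open>w = 0\<close> gives unstable slopes the sign of
  \<open>w\<close> and center slopes the opposite sign, so their difference has no zero. The lens is
  explicit over the disc because the plateau of \<open>r\<close> has half the radius of its support
  and \<open>G\<close> at least halves coordinates there: one step leads to the plateau, where
  \<open>tau\<close> is the constant \<open>Rc\<close>, hence \<open>tau = (r + Rc) / 20\<close> on
  the support and the argument of \<open>H\<close> is \<open>w / tau\<close>. The numbers need
  margins: horizontal derivatives stay below 18 despite the overshoot of the derived-from-Anosov
  perturbation, to remain dominated by 20; at the sink the vertical derivative 20 - 19 * 200/199 =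
  180/199 lies below 1 and above the horizontal 1/3; and \<open>Rc\<close> is tiny compared with the
  radius \<open>nu\<close>, so that the slope of \<open>r\<close> is a harmless error term.\<close>

section \<open>Contraction principles and sections fixed by graph transforms\<close>

text \<open>Iterating the step bounds \<delta> by \<open>q ^ n * C\<close> for every
  \<open>n\<close>. This one principle serves for the periodicity of invariant sections, for the
  tangency of the sheets and for computing the height of the lens.\<close>

lemma vanishing_of_contraction:
  fixes \<delta> :: "'c \<Rightarrow> real"
  assumes bnd: "\<And>x. x \<in> N \<Longrightarrow> 0 \<le> \<delta> x \<and> \<delta> x \<le> C" and q: "0 \<le> q" "q < 1"
    and step: "\<And>x. x \<in> N \<Longrightarrow> \<delta> x = 0 \<or> (F x \<in> N \<and> \<delta> x \<le> q * \<delta> (F x))"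
    and x: "x \<in> N"
  shows "\<delta> x = 0"
proof -
  have *: "\<forall>x\<in>N. \<delta> x \<le> q ^ n * C" for n
  proof (induction n)
    case 0
    then show ?case using bnd by simp
  next
    case (Suc n)
    show ?case
    proof
      fix x assume x: "x \<in> N"
      have C: "0 \<le> q ^ Suc n * C"
        using bnd[OF x] q by (intro mult_nonneg_nonneg) auto
      show "\<delta> x \<le> q ^ Suc n * C"
        using step[OF x]
      proof
        assume "\<delta> x = 0" then show ?thesis using C by simp
      next
        assume A: "F x \<in> N \<and> \<delta> x \<le> q * \<delta> (F x)"
        then have "\<delta> x \<le> q * (q ^ n * C)"
          using Suc q mult_left_mono[of "\<delta> (F x)" "q ^ n * C" q] by fastforce
        then show ?thesis by (simp add: mult.assoc)
      qed
    qed
  qed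
  have "(\<lambda>n. q ^ n * C) \<longlonglongrightarrow> 0 * C"
    using q by (intro tendsto_mult LIMSEQ_power_zero tendsto_const) auto
  then have "\<delta> x \<le> 0 * C"
    using * x by (intro LIMSEQ_le_const) auto
  then show ?thesis using bnd[OF x] by simp
qed

text \<open>A graph transform with boundary data: the section is prescribed on \<open>L\<close> and
  is a fixed point of the fibre contraction \<open>T\<close> over \<open>K\<close>. The overlap
  conditions make both prescriptions agree where \<open>K\<close> and \<open>L\<close> meet, so each
  iterate is continuous by gluing closed sets, and the iterates converge uniformly. In the
  applications \<open>L\<close> is empty or a fundamental domain through which orbits leave
  \<open>K\<close>.\<close>

lemma invariant_section:
  fixes K L :: "'a::{metric_space,second_countable_topology} set"
    and T :: "'a \<Rightarrow> 'b::euclidean_space \<Rightarrow> 'b"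
  assumes cl: "closed K" "closed L"
    and F: "continuous_on K F" "F ` K \<subseteq> K \<union> L" "F ` (K \<inter> L) \<subseteq> L"
    and e: "continuous_on L e" "\<And>x. x \<in> L \<Longrightarrow> norm (e x) \<le> B"
    and B: "0 \<le> B" and q: "0 \<le> q" "q < 1"
    and contr: "\<And>x v w. x \<in> K \<Longrightarrow> norm (T x v - T x w) \<le> q * norm (v - w)"
    and cont: "\<And>g. continuous_on K g \<Longrightarrow> continuous_on K (\<lambda>x. T x (g x))"
    and inv: "\<And>x v. x \<in> K \<Longrightarrow> norm v \<le> B \<Longrightarrow> norm (T x v) \<le> B"
    and match: "\<And>x. x \<in> K \<Longrightarrow> x \<in> L \<Longrightarrow> T x (e (F x)) = e x"
  obtains \<theta> where "continuous_on (K \<union> L) \<theta>" "\<And>x. x \<in> L \<Longrightarrow> \<theta> x = e x"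
    "\<And>x. x \<in> K \<Longrightarrow> \<theta> x = T x (\<theta> (F x))" "\<And>x. x \<in> K \<union> L \<Longrightarrow> norm (\<theta> x) \<le> B"
proof -
  have "closedin (top_of_set (K \<union> L)) L"
    using cl by (meson closedin_subset_trans closed_closedin sup_ge2 subset_UNIV
        closed_subset)
  \<comment> \<open>Tietze extension supplies a start of the iteration that already has the
    prescribed values on \<open>L\<close> and obeys the bound \<open>B\<close>.\<close>
  then obtain g where g: "continuous_on (K \<union> L) g" "\<And>x. x \<in> L \<Longrightarrow> g x = e x"
    "\<And>x. x \<in> K \<union> L \<Longrightarrow> norm (g x) \<le> B"
    using Tietze[OF e(1) _ B e(2)] by blast
  define t where "t = rec_nat g (\<lambda>_ h x. if x \<in> L then e x else T x (h (F x)))"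
  have t0: "t 0 = g" unfolding t_def by (rule nat.rec)
  have tS: "t (Suc n) = (\<lambda>x. if x \<in> L then e x else T x (t n (F x)))" for n
    unfolding t_def by (rule nat.rec)
  have L: "t n x = e x" if "x \<in> L" for n x
    using that g by (cases n) (auto simp: t0 tS)
  have K: "t (Suc n) x = T x (t n (F x))" if "x \<in> K" for n x
    using that F(3) match L by (auto simp: tS)
  have bd: "norm (t n x) \<le> B" if "x \<in> K \<union> L" for n x
    using that
  proof (induction n arbitrary: x)
    case 0 then show ?case using g by (simp add: t0)
  next
    case (Suc n)
    show ?case
    proof (cases "x \<in> L")
      case True then show ?thesis using e L by simp
    next
      case False
      then have "x \<in> K" using Suc by auto
      then show ?thesis using Suc.IH F(2) inv K by (metis image_subset_iff)
    qed
  qed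
  have ct: "continuous_on (K \<union> L) (t n)" for n
  proof (induction n)
    case 0 then show ?case using g by (simp add: t0)
  next
    case (Suc n)
    have "continuous_on K (\<lambda>x. t n (F x))"
      by (rule continuous_on_compose2[OF Suc F(1,2)])
    from cont[OF this] have "continuous_on K (t (Suc n))"
      by (rule continuous_on_eq) (use K in auto)
    moreover from e(1) have "continuous_on L (t (Suc n))"
      by (rule continuous_on_eq) (use L in auto)
    ultimately show ?case using cl by (intro continuous_on_closed_Un)
  qed
  have diff: "norm (t (Suc n) x - t n x) \<le> 2 * B * q ^ n" if "x \<in> K \<union> L" for n x
    using that
  proof (induction n arbitrary: x)
    case 0
    have "norm (t (Suc 0) x - t 0 x) \<le> norm (t (Suc 0) x) + norm (t 0 x)"
      by (rule norm_triangle_ineq4)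
    also have "\<dots> \<le> 2 * B" using bd[OF 0, of 0] bd[OF 0, of "Suc 0"] by simp
    finally show ?case by simp
  next
    case (Suc n)
    show ?case
    proof (cases "x \<in> L")
      case True then show ?thesis using L B q by simp
    next
      case False
      then have x: "x \<in> K" using Suc by auto
      have "norm (t (Suc (Suc n)) x - t (Suc n) x) \<le> q * norm (t (Suc n) (F x) - t n (F x))"
        using contr[OF x] K[OF x] by simp
      also have "\<dots> \<le> q * (2 * B * q ^ n)"
        using Suc.IH F(2) x q by (intro mult_left_mono) auto
      finally show ?thesis by (simp add: algebra_simps)
    qed
  qed
  have ul: "uniform_limit (K \<union> L) (\<lambda>n x. \<Sum>i<n. t (Suc i) x - t i x)
      (\<lambda>x. \<Sum>i. t (Suc i) x - t i x) sequentially"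
    using q diff by (intro Weierstrass_m_test[where M = "\<lambda>n. 2 * B * q ^ n"] summable_mult
        summable_geometric) auto
  define \<theta> where "\<theta> x = t 0 x + (\<Sum>i. t (Suc i) x - t i x)" for x
  have "(\<Sum>i<n. t (Suc i) x - t i x) = t n x - t 0 x" for n x
    by (rule sum_lessThan_telescope)
  then have "uniform_limit (K \<union> L) (\<lambda>n x. t 0 x + (t n x - t 0 x)) \<theta> sequentially"
    using ul unfolding \<theta>_def by (intro uniform_limit_intros) (simp_all)
  then have ul: "uniform_limit (K \<union> L) t \<theta> sequentially" by simp
  have lim: "(\<lambda>n. t n x) \<longlonglongrightarrow> \<theta> x" if "x \<in> K \<union> L" for x
    using tendsto_uniform_limitI[OF ul that] .
  show thesis
  proof
    show "continuous_on (K \<union> L) \<theta>"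
      using ct by (intro uniform_limit_theorem[OF _ ul]) auto
    show "\<theta> x = e x" if "x \<in> L" for x
      using lim[of x] L[OF that] that by (simp add: LIMSEQ_const_iff)
    show "norm (\<theta> x) \<le> B" if "x \<in> K \<union> L" for x
      using lim[OF that] bd[OF that] by (intro Lim_norm_ubound[OF _ lim[OF that]]) auto
    show "\<theta> x = T x (\<theta> (F x))" if x: "x \<in> K" for x
    proof -
      have "(\<lambda>n. t n (F x)) \<longlonglongrightarrow> \<theta> (F x)" using lim F(2) x by blast
      then have *: "(\<lambda>n. q * norm (t n (F x) - \<theta> (F x))) \<longlonglongrightarrow> 0"
        by (intro tendsto_mult_right_zero) (simp add: LIM_zero tendsto_norm_zero)
      have "(\<lambda>n. T x (t n (F x)) - T x (\<theta> (F x))) \<longlonglongrightarrow> 0"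
        by (rule Lim_null_comparison[OF _ *]) (use contr[OF x] in auto)
      then have "(\<lambda>n. t (Suc n) x) \<longlonglongrightarrow> T x (\<theta> (F x))"
        using K[OF x] by (simp add: LIM_zero_iff)
      moreover have "(\<lambda>n. t (Suc n) x) \<longlonglongrightarrow> \<theta> x"
        using lim x by (intro LIMSEQ_Suc) auto
      ultimately show ?thesis using LIMSEQ_unique by blast
    qed
  qed
qed

section \<open>Topology of the torus and maps given by lifts\<close>

lemma torus_proj_rep [simp]: "torus_proj (torus_rep p) = p"
  using Quotient3_abs_rep[OF Quotient3_torus] .

lemma torus_rep_proj: "torus_rep (torus_proj X) $ i - X $ i \<in> \<int>"
  using torus_proj_rep[of "torus_proj X"] torus_proj_eq_iff by blast

lemma continuous_torus_proj: "continuous_on S torus_proj"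
proof -
  have "continuous_on UNIV (torus_proj :: real ^ 'n \<Rightarrow> _)"
    by (auto simp: continuous_on_open_vimage open_torus_def)
  then show ?thesis by (rule continuous_on_subset) simp
qed

text \<open>The preimage of the image is the union of all integer translates of
  \<open>V\<close>.\<close>

lemma open_torus_proj_image: "open V \<Longrightarrow> open (torus_proj ` V)"
proof -
  assume V: "open V"
  have "torus_proj -` (torus_proj ` V) = (\<Union>n\<in>{n. \<forall>i. n $ i \<in> \<int>}. (\<lambda>x. n + x) ` V)"
  proof (intro set_eqI iffI)
    fix x assume "x \<in> torus_proj -` (torus_proj ` V)"
    then obtain y where y: "y \<in> V" "torus_proj x = torus_proj y" by auto
    then have "x - y \<in> {n. \<forall>i. n $ i \<in> \<int>}" by (simp add: torus_proj_eq_iff)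
    moreover have "x = (x - y) + y" by simp
    ultimately show "x \<in> (\<Union>n\<in>{n. \<forall>i. n $ i \<in> \<int>}. (\<lambda>x. n + x) ` V)"
      using y(1) by blast
  next
    fix x assume "x \<in> (\<Union>n\<in>{n. \<forall>i. n $ i \<in> \<int>}. (\<lambda>x. n + x) ` V)"
    then obtain n y where "\<forall>i. n $ i \<in> \<int>" "y \<in> V" "x = n + y" by auto
    then have "torus_proj x = torus_proj y" by (simp add: torus_proj_eq_iff)
    then show "x \<in> torus_proj -` (torus_proj ` V)" using \<open>y \<in> V\<close> by auto
  qed
  moreover have "open (\<Union>n\<in>{n. \<forall>i. n $ i \<in> \<int>}. (\<lambda>x. n + x) ` V)"
    using V by (intro open_UN ballI open_translation)
  ultimately show ?thesis by (simp add: open_torus_def)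
qed

lemma continuous_on_torusI:
  fixes h :: "'n::finite torus \<Rightarrow> 'b::topological_space"
  assumes U: "open U" and h: "continuous_on (torus_proj -` U) (\<lambda>X. h (torus_proj X))"
  shows "continuous_on U h"
proof -
  have oU: "open (torus_proj -` U)" using U by (simp add: open_torus_def)
  have "open (h -` B \<inter> U)" if "open B" for B
  proof -
    have "open ((\<lambda>X. h (torus_proj X)) -` B \<inter> torus_proj -` U)"
      using h that oU by (simp add: continuous_on_open_vimage)
    moreover have "(\<lambda>X. h (torus_proj X)) -` B \<inter> torus_proj -` U = torus_proj -` (h -` B \<inter> U)"
      by auto
    ultimately show ?thesis by (simp add: open_torus_def)
  qed
  then show ?thesis using U by (simp add: continuous_on_open_vimage)
qed

text \<open>Openness of the projection gives the nontrivial inclusion: a neighbourhood missing the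
  preimage of \<open>S\<close> projects to a neighbourhood missing \<open>S\<close>. Thus the
  boundary of the basin can be computed in the universal cover.\<close>

lemma vimage_closure_torus: "torus_proj -` closure S = closure (torus_proj -` S)"
proof
  have "closed (torus_proj -` closure S)"
    using continuous_on_closed_vimage[of UNIV torus_proj] continuous_torus_proj by auto
  then show "closure (torus_proj -` S) \<subseteq> torus_proj -` closure S"
    by (rule closure_minimal[rotated]) (use closure_subset in auto)
  show "torus_proj -` closure S \<subseteq> closure (torus_proj -` S)"
  proof
    fix X assume X: "X \<in> torus_proj -` closure S"
    show "X \<in> closure (torus_proj -` S)"
    proof (rule ccontr)
      assume A: "X \<notin> closure (torus_proj -` S)"
      define V where "V = - closure (torus_proj -` S)"
      have "open (torus_proj ` V)" unfolding V_def by (intro open_torus_proj_image) auto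
      moreover have "torus_proj X \<in> torus_proj ` V" using A by (auto simp: V_def)
      moreover have "torus_proj ` V \<inter> S = {}"
        using closure_subset[of "torus_proj -` S"] by (auto simp: V_def)
      ultimately have "torus_proj X \<notin> closure S"
        using open_Int_closure_eq_empty by blast
      then show False using X by auto
    qed
  qed
qed

lemma vimage_frontier_torus: "torus_proj -` frontier S = frontier (torus_proj -` S)"
proof -
  have "torus_proj -` frontier S = torus_proj -` closure S \<inter> torus_proj -` closure (- S)"
    by (auto simp: frontier_closures)
  then show ?thesis by (simp only: vimage_closure_torus frontier_closures vimage_Compl)
qed

text \<open>The representative is arbitrary; the value has a meaning independent of it when
  \<open>lattice_map\<close> holds.\<close>

definition torus_map :: "(real ^ 'n \<Rightarrow> real ^ 'm) \<Rightarrow> 'n::finite torus \<Rightarrow> 'm::finite torus" where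
  "torus_map F p = torus_proj (F (torus_rep p))"

definition lattice_map :: "(real ^ 'n \<Rightarrow> real ^ 'm) \<Rightarrow> bool" where
  "lattice_map F \<longleftrightarrow> (\<forall>X Y. (\<forall>i. X $ i - Y $ i \<in> \<int>) \<longrightarrow> (\<forall>i. F X $ i - F Y $ i \<in> \<int>))"

lemma torus_map_proj: "lattice_map F \<Longrightarrow> torus_map F (torus_proj X) = torus_proj (F X)"
  unfolding torus_map_def torus_proj_eq_iff lattice_map_def using torus_rep_proj by blast

lemma has_torus_derivative_torus_map:
  assumes "lattice_map F" "(F has_derivative D) (at X)"
  shows "has_torus_derivative (torus_map F) D (torus_proj X)"
  unfolding has_torus_derivative_def using assms torus_map_proj
  by (intro exI[of _ F] exI[of _ X]) (auto simp: torus_map_proj)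

lemma torus_deriv_torus_map:
  assumes "lattice_map F" "(F has_derivative D) (at X)"
  shows "torus_deriv (torus_map F) (torus_proj X) = D"
  by (rule torus_deriv_eq[OF has_torus_derivative_torus_map[OF assms]])

lemma C1_torus_map_torus_map:
  assumes F: "lattice_map F" "\<And>X. (F has_derivative D X) (at X)"
    and D: "\<And>v. continuous_on UNIV (\<lambda>X. D X v)"
  shows "C1_torus_map (torus_map F)"
  unfolding C1_torus_map_def
proof (intro conjI allI)
  fix p
  show "\<exists>D. has_torus_derivative (torus_map F) D p"
    using has_torus_derivative_torus_map[OF F] by (metis torus_proj_surj)
next
  fix v
  show "continuous_on UNIV (\<lambda>p. torus_deriv (torus_map F) p v)"
    using D[of v] by (intro continuous_on_torusI) (simp_all add: torus_deriv_torus_map[OF F])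
qed

lemma funpow_torus_map:
  assumes "lattice_map (F :: real ^ 'n::finite \<Rightarrow> real ^ 'n)"
  shows "(torus_map F ^^ n) (torus_proj X) = torus_proj ((F ^^ n) X)"
  by (induction n) (simp_all add: torus_map_proj[OF assms])

section \<open>Periodic functions by reduction to a unit cell\<close>

text \<open>Since \<open>round\<close> jumps at half-integers, a function descends from the unit cell
  to the torus only if it takes equal values at congruent points near the boundary of the cell.\<close>

definition rn :: "real ^ 'n \<Rightarrow> real ^ 'n" where "rn X = (\<chi> i. of_int (round (X $ i)))"
definition rd :: "real ^ 'n \<Rightarrow> real ^ 'n" where "rd X = X - rn X"

definition compat :: "(real ^ 'n \<Rightarrow> 'b) \<Rightarrow> bool" where
  "compat h \<longleftrightarrow> (\<forall>X Y. (\<forall>i. \<bar>X $ i\<bar> < 3/4 \<and> \<bar>Y $ i\<bar> < 3/4 \<and> X $ i - Y $ i \<in> \<int>) \<longrightarrow> h X = h Y)"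

lemma rn_Ints: "rn X $ i \<in> \<int>" by (simp add: rn_def)

lemma rd_Ints: "X $ i - rd X $ i \<in> \<int>" by (simp add: rd_def rn_def)

lemma torus_proj_rd [simp]: "torus_proj (rd X) = torus_proj X"
  by (simp add: torus_proj_eq_iff rd_def rn_Ints)

lemma rd_bound: "\<bar>rd X $ i\<bar> \<le> 1/2"
  using of_int_round_abs_le[of "X $ i"] by (simp add: rd_def rn_def abs_minus_commute)

lemma rd_small: "(\<And>i. \<bar>X $ i\<bar> < 1/2) \<Longrightarrow> rd X = X"
  by (simp add: vec_eq_iff rd_def rn_def round_unique')

lemma compat_rd:
  assumes "compat h" "\<And>i. X $ i - Y $ i \<in> \<int>"
  shows "h (rd X) = h (rd Y)"
proof -
  have "rd X $ i - rd Y $ i = (X $ i - Y $ i) - rn X $ i + rn Y $ i" for i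
    by (simp add: rd_def)
  then have "rd X $ i - rd Y $ i \<in> \<int>" for i
    using assms(2)[of i] rn_Ints[of X i] rn_Ints[of Y i] by auto
  moreover have "\<bar>rd X $ i\<bar> < 3/4" for X :: "real^'a" and i using rd_bound[of X i] by linarith
  ultimately show ?thesis using assms(1) unfolding compat_def by blast
qed

text \<open>The cell has half-width 1/2 while \<open>compat\<close> speaks of half-width 3/4. The
  margin 1/4 allows a whole ball around \<open>X\<close> to be translated by the single vector
  \<open>rn X\<close>, so local questions about \<open>h (rd X)\<close> become questions about a
  translate of \<open>h\<close>.\<close>

lemma eventually_rd:
  assumes h: "compat (h :: real ^ 'n::finite \<Rightarrow> 'b)"
  shows "\<forall>\<^sub>F Y in nhds X. h (rd Y) = h (Y - rn X)"
proof -
  have "\<forall>\<^sub>F Y in nhds X. dist Y X < 1/4"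
    by (rule eventually_nhds_ball[of "1/4", simplified ball_def, simplified, THEN eventually_mono])
       (simp add: dist_commute)
  then show ?thesis
  proof eventually_elim
    case (elim Y)
    have "\<bar>Y $ i - rn X $ i\<bar> < 3/4" for i
    proof -
      have "\<bar>(Y - X) $ i\<bar> < 1/4"
        using elim component_le_norm_cart[of "Y - X" i] by (simp add: dist_norm)
      moreover have "\<bar>X $ i - rn X $ i\<bar> \<le> 1/2" using rd_bound[of X i] by (simp add: rd_def)
      ultimately show ?thesis unfolding vector_minus_component by linarith
    qed
    moreover have "\<bar>rd Y $ i\<bar> < 3/4" for i using rd_bound[of Y i] by linarith
    moreover have "rd Y $ i - (Y - rn X) $ i \<in> \<int>" for i
      using rn_Ints[of X i] rn_Ints[of Y i] by (simp add: rd_def)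
    ultimately show ?case using h unfolding compat_def by simp
  qed
qed

lemma has_derivative_shift:
  assumes "(h has_derivative D) (at (X - c))"
  shows "((\<lambda>Y. h (Y - c)) has_derivative D) (at X)"
proof -
  have "((\<lambda>Y. Y - c) has_derivative (\<lambda>v. v)) (at X)"
    by (auto intro!: derivative_eq_intros)
  from has_derivative_compose[OF this assms] show ?thesis .
qed

lemma has_derivative_transform_nhds:
  assumes "(f has_derivative D) (at x)" "\<forall>\<^sub>F y in nhds x. f y = g y"
  shows "(g has_derivative D) (at x)"
  using has_derivative_transform_eventually[of f D x UNIV g] assms by (simp add: eventually_nhds_conv_at)

lemma has_derivative_rd:
  assumes h: "compat h" and d: "\<And>X. (h has_derivative D X) (at X)"
  shows "((\<lambda>X. h (rd X)) has_derivative D (rd X)) (at X)"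
proof -
  have "((\<lambda>Y. h (Y - rn X)) has_derivative D (X - rn X)) (at X)"
    by (rule has_derivative_shift[OF d])
  moreover have "\<forall>\<^sub>F Y in nhds X. h (Y - rn X) = h (rd Y)"
    using eventually_rd[OF h, of X] by eventually_elim simp
  ultimately show ?thesis
    unfolding rd_def[of X] by (rule has_derivative_transform_nhds)
qed

lemma continuous_rd:
  fixes h :: "real ^ 'n::finite \<Rightarrow> 'b::topological_space"
  assumes "compat h" "continuous_on UNIV h"
  shows "continuous_on UNIV (\<lambda>X. h (rd X))"
proof (rule continuous_at_imp_continuous_on, rule ballI)
  fix X
  have "isCont (\<lambda>Y. h (Y - rn X)) X"
    using assms(2) by (intro continuous_on_interior[of UNIV] continuous_on_compose2[OF assms(2)]
      continuous_intros) auto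
  then show "isCont (\<lambda>X. h (rd X)) X"
    using isCont_cong[OF eventually_rd[OF assms(1), of X]] by simp
qed

text \<open>Local agreement of functions passes to their derivatives by uniqueness, so compatibility
  has to be checked for \<open>h\<close> alone and not for its derivative.\<close>

lemma continuous_deriv_rd:
  assumes h: "compat h" and d: "\<And>X. (h has_derivative D X) (at X)"
    and c: "continuous_on UNIV (\<lambda>X. D X v)"
  shows "continuous_on UNIV (\<lambda>X. D (rd X) v)"
proof (rule continuous_at_imp_continuous_on, rule ballI)
  fix X
  have ev: "\<forall>\<^sub>F Y in nhds X. D (rd Y) v = D (Y - rn X) v"
  proof -
    have "\<forall>\<^sub>F Y in nhds X. \<forall>\<^sub>F Z in nhds Y. h (rd Z) = h (Z - rn X)"
      using eventually_rd[OF h, of X] eventually_eventually by metis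
    then show ?thesis
    proof eventually_elim
      case (elim Y)
      have "((\<lambda>Y. h (Y - rn X)) has_derivative D (Y - rn X)) (at Y)"
        by (rule has_derivative_shift[OF d])
      moreover have "\<forall>\<^sub>F Z in nhds Y. h (Z - rn X) = h (rd Z)"
        using elim by eventually_elim simp
      ultimately have "((\<lambda>X. h (rd X)) has_derivative D (Y - rn X)) (at Y)"
        by (rule has_derivative_transform_nhds)
      then show ?case
        using has_derivative_unique has_derivative_rd[OF h d, of Y] by metis
    qed
  qed
  have "isCont (\<lambda>Y. D (Y - rn X) v) X"
    by (intro continuous_on_interior[of UNIV] continuous_on_compose2[OF c] continuous_intros) auto
  then show "isCont (\<lambda>X. D (rd X) v) X"
    using isCont_cong[OF ev] by simp
qed

lemma surj_of_bounded_displacement: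
  fixes h :: "real \<Rightarrow> real"
  assumes cont: "continuous_on UNIV h" and c: "0 < c" and bnd: "\<And>x. \<bar>h x - c * x\<bar> \<le> C"
  shows "\<exists>x. h x = y"
proof -
  define a where "a = (y - C) / c" define b where "b = (y + C) / c"
  have "0 \<le> C" using bnd[of 0] by linarith
  then have "a \<le> b" using c by (simp add: a_def b_def divide_right_mono)
  moreover have "h a \<le> y" using bnd[of a] c by (simp add: a_def)
  moreover have "y \<le> h b" using bnd[of b] c by (simp add: b_def abs_le_iff)
  ultimately show ?thesis
    using IVT'[of h a y b] continuous_on_subset[OF cont] by blast
qed

section \<open>Eigenvalues and piecewise quadratic profiles\<close>

text \<open>Eigenvalues of the integer matrix with rows (0, 1) and (-1, 10). A value near 10 leaves
  room on both sides: it exceeds 1/2 by far, and it stays below 20 even when the horizontal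
  perturbation adds up to \<open>4/5 * kk\<close>.\<close>

definition mu :: real where "mu = 5 + 2 * sqrt 6"
definition lam :: real where "lam = 5 - 2 * sqrt 6"

lemma mu_lam: "mu * lam = 1" "mu + lam = 10"
  by (auto simp: mu_def lam_def algebra_simps)

lemma mu_bounds: "98/10 < mu" "mu < 99/10"
proof -
  have "24/10 < sqrt 6" by (rule real_less_rsqrt) (simp add: power2_eq_square)
  moreover have "sqrt 6 < 245/100" by (rule real_less_lsqrt) (simp_all add: power2_eq_square)
  ultimately show "98/10 < mu" "mu < 99/10" by (auto simp: mu_def)
qed

lemma lam_bounds: "1/10 < lam" "lam < 11/100"
proof -
  have e: "lam = 1 / mu" using mu_lam mu_bounds by (simp add: field_simps)
  show "1/10 < lam" "lam < 11/100" unfolding e using mu_bounds by (auto simp: field_simps)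
qed

text \<open>Building block of the profiles: it is C1 with piecewise linear derivative, so slope
  bounds reduce to linear arithmetic on finitely many intervals.\<close>

definition sqp :: "real \<Rightarrow> real" where "sqp y = (max 0 y)\<^sup>2"

lemma sqp_pos: "0 \<le> y \<Longrightarrow> sqp y = y\<^sup>2" and sqp_neg: "y \<le> 0 \<Longrightarrow> sqp y = 0"
  by (auto simp: sqp_def max_def)

lemma sqp_nonneg [simp]: "0 \<le> sqp y" by (simp add: sqp_def)

lemma DERIV_sqp: "(sqp has_real_derivative 2 * max 0 y) (at y)"
proof (cases "y = 0")
  case True
  have "((\<lambda>h. sqp h / h) \<longlongrightarrow> 0) (at 0)"
  proof (rule Lim_null_comparison[where g = "\<lambda>h. \<bar>h\<bar>"])
    have "norm (sqp h / h) \<le> \<bar>h\<bar>" for h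
      by (cases "h = 0") (auto simp: sqp_def max_def power2_eq_square)
    then show "\<forall>\<^sub>F h in at 0. norm (sqp h / h) \<le> \<bar>h\<bar>" by simp
  qed (auto intro!: tendsto_eq_intros)
  then show ?thesis using True by (simp add: DERIV_def sqp_neg)
next
  case False
  then consider "y < 0" | "0 < y" by linarith
  then show ?thesis
  proof cases
    case 1
    then have "\<forall>\<^sub>F z in nhds y. 0 = sqp z"
      using eventually_nhds_in_open[of "{..<0}" y] by (auto elim!: eventually_mono simp: sqp_neg)
    moreover have "((\<lambda>z. 0) has_real_derivative 0) (at y)" by simp
    ultimately show ?thesis using 1 has_derivative_transform_nhds
      unfolding has_field_derivative_def by fastforce
  next
    case 2
    then have "\<forall>\<^sub>F z in nhds y. z\<^sup>2 = sqp z"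
      using eventually_nhds_in_open[of "{0<..}" y] by (auto elim!: eventually_mono simp: sqp_pos)
    moreover have "((\<lambda>z. z\<^sup>2) has_real_derivative 2 * y) (at y)"
      by (auto intro!: derivative_eq_intros)
    ultimately show ?thesis using 2 has_derivative_transform_nhds
      unfolding has_field_derivative_def by fastforce
  qed
qed

lemma DERIV_sqp_chain [derivative_intros]:
  "(g has_real_derivative g') (at x) \<Longrightarrow>
   ((\<lambda>x. sqp (g x)) has_real_derivative 2 * max 0 (g x) * g') (at x)"
  using DERIV_chain2[OF DERIV_sqp] .

text \<open>Odd and even quadratic splines with knots at \<open>c\<close> and \<open>- c\<close>.
  Their parity lets every estimate be made for nonnegative heights only.\<close>

definition osq :: "real \<Rightarrow> real \<Rightarrow> real" where "osq c w = sqp (w - c) - sqp (- w - c)"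
definition esq :: "real \<Rightarrow> real \<Rightarrow> real" where "esq c w = sqp (w - c) + sqp (- w - c)"
definition dosq :: "real \<Rightarrow> real \<Rightarrow> real" where "dosq c w = 2 * max 0 (w - c) + 2 * max 0 (- w - c)"
definition desq :: "real \<Rightarrow> real \<Rightarrow> real" where "desq c w = 2 * max 0 (w - c) - 2 * max 0 (- w - c)"

lemma DERIV_osq [derivative_intros]:
  "(g has_real_derivative g') (at x) \<Longrightarrow>
   ((\<lambda>x. osq c (g x)) has_real_derivative dosq c (g x) * g') (at x)"
  unfolding osq_def dosq_def by (auto intro!: derivative_eq_intros simp: algebra_simps)

lemma DERIV_esq [derivative_intros]:
  "(g has_real_derivative g') (at x) \<Longrightarrow>
   ((\<lambda>x. esq c (g x)) has_real_derivative desq c (g x) * g') (at x)"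
  unfolding esq_def desq_def by (auto intro!: derivative_eq_intros simp: algebra_simps)

lemma osq_minus: "osq c (- w) = - osq c w" and esq_minus: "esq c (- w) = esq c w"
  and dosq_minus: "dosq c (- w) = dosq c w" and desq_minus: "desq c (- w) = - desq c w"
  by (auto simp: osq_def esq_def dosq_def desq_def)

lemma sq_hi:
  assumes "0 \<le> c" "c \<le> w"
  shows "osq c w = (w - c)\<^sup>2" "esq c w = (w - c)\<^sup>2" "dosq c w = 2 * (w - c)" "desq c w = 2 * (w - c)"
  using assms by (auto simp: osq_def esq_def dosq_def desq_def sqp_pos sqp_neg)

lemma sq_lo:
  assumes "\<bar>w\<bar> \<le> c"
  shows "osq c w = 0" "esq c w = 0" "dosq c w = 0" "desq c w = 0"
  using assms by (auto simp: osq_def esq_def dosq_def desq_def sqp_neg)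

lemma continuous_dsq [continuous_intros]:
  "continuous_on S f \<Longrightarrow> continuous_on S (\<lambda>x. dosq c (f x))"
  "continuous_on S f \<Longrightarrow> continuous_on S (\<lambda>x. desq c (f x))"
  "continuous_on S f \<Longrightarrow> continuous_on S (\<lambda>x. sqp (f x))"
  "continuous_on S f \<Longrightarrow> continuous_on S (\<lambda>x. osq c (f x))"
  "continuous_on S f \<Longrightarrow> continuous_on S (\<lambda>x. esq c (f x))"
  unfolding dosq_def desq_def sqp_def osq_def esq_def by (intro continuous_intros; assumption)+

subsection \<open>The vertical dynamics away from the lens\<close>

text \<open>The coefficient 39/4 lowers the slope from 20 to 1/2 over the interval from 1 to 2. The
  outer branch \<open>117/4 + w / 2\<close> fixes \<open>117/2\<close>, which is to be the antipode;
  this dictates the length 117 of the circle.\<close>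

definition psi0 :: "real \<Rightarrow> real" where "psi0 w = 20 * w - 39/4 * (osq 1 w - osq 2 w)"
definition dpsi0 :: "real \<Rightarrow> real" where "dpsi0 w = 20 - 39/4 * (dosq 1 w - dosq 2 w)"

lemma DERIV_psi0 [derivative_intros]:
  "(g has_real_derivative g') (at x) \<Longrightarrow>
   ((\<lambda>x. psi0 (g x)) has_real_derivative dpsi0 (g x) * g') (at x)"
  unfolding psi0_def dpsi0_def by (auto intro!: derivative_eq_intros simp: field_simps)

lemma psi0_minus: "psi0 (- w) = - psi0 w" and dpsi0_minus: "dpsi0 (- w) = dpsi0 w"
  by (simp_all add: psi0_def dpsi0_def osq_minus dosq_minus field_simps)

lemma psi0_lo: "\<bar>w\<bar> \<le> 1 \<Longrightarrow> psi0 w = 20 * w"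
  by (simp add: psi0_def sq_lo)

lemma psi0_hi: "2 \<le> w \<Longrightarrow> psi0 w = 117/4 + w / 2"
  by (simp add: psi0_def sq_hi power2_eq_square field_simps)

lemma dpsi0_lo: "\<bar>w\<bar> \<le> 1 \<Longrightarrow> dpsi0 w = 20"
  by (simp add: dpsi0_def sq_lo)

lemma even_abs: "(\<And>w::real. f (- w) = f w) \<Longrightarrow> f w = f \<bar>w\<bar>"
  by (cases "0 \<le> w") (auto simp: abs_if)

lemma dpsi0_hi: "2 \<le> \<bar>w\<bar> \<Longrightarrow> dpsi0 w = 1/2"
  by (subst even_abs[of dpsi0, OF dpsi0_minus]) (simp add: dpsi0_def sq_hi)

lemma dpsi0_bounds: "1/2 \<le> dpsi0 w" "dpsi0 w \<le> 20"
proof -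
  have "1/2 \<le> dpsi0 \<bar>w\<bar> \<and> dpsi0 \<bar>w\<bar> \<le> 20"
    by (cases "\<bar>w\<bar> \<le> 1"; cases "2 \<le> \<bar>w\<bar>")
       (auto simp: dpsi0_def sq_hi sq_lo)
  then show "1/2 \<le> dpsi0 w" "dpsi0 w \<le> 20"
    using even_abs[of dpsi0, OF dpsi0_minus] by metis+
qed

section \<open>The shear and the vertical cutoff\<close>

text \<open>Even, hence with the same constant value on both sides of the antipode, so it descends
  to the circle. For \<open>w > 0\<close> the derivative climbs to \<open>mu\<close> between 1/2 and
  1, stays there up to 19 and returns to 0 at 20, the image of 1 under \<open>psi0\<close>. The
  plateau value is chosen equal to the horizontal eigenvalue, which makes the center slope 1 in
  modulus there.\<close>

definition phi :: "real \<Rightarrow> real" where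
  "phi w = mu * (esq (1/2) w - esq 1 w - (esq 19 w - esq 20 w) / 2)"
definition dphi :: "real \<Rightarrow> real" where
  "dphi w = mu * (desq (1/2) w - desq 1 w - (desq 19 w - desq 20 w) / 2)"

lemma DERIV_phi [derivative_intros]:
  "(g has_real_derivative g') (at x) \<Longrightarrow>
   ((\<lambda>x. phi (g x)) has_real_derivative dphi (g x) * g') (at x)"
  unfolding phi_def dphi_def by (auto intro!: derivative_eq_intros simp: field_simps)

lemma phi_minus: "phi (- w) = phi w" and dphi_minus: "dphi (- w) = - dphi w"
  by (simp_all add: phi_def dphi_def esq_minus desq_minus field_simps)

lemma phi_lo: "\<bar>w\<bar> \<le> 1/2 \<Longrightarrow> phi w = 0" and dphi_lo: "\<bar>w\<bar> \<le> 1/2 \<Longrightarrow> dphi w = 0"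
  by (simp_all add: phi_def dphi_def sq_lo)

lemma phi_hi: "20 \<le> \<bar>w\<bar> \<Longrightarrow> phi w = mu * (75/4)"
  by (subst even_abs[of phi, OF phi_minus]) (simp add: phi_def sq_hi power2_eq_square field_simps)

lemma dphi_pos:
  assumes "0 \<le> w"
  shows "w \<le> 1 \<Longrightarrow> 1/2 \<le> w \<Longrightarrow> dphi w = mu * (2 * w - 1)"
    "1 \<le> w \<Longrightarrow> w \<le> 19 \<Longrightarrow> dphi w = mu"
    "19 \<le> w \<Longrightarrow> w \<le> 20 \<Longrightarrow> dphi w = mu * (20 - w)"
    "20 \<le> w \<Longrightarrow> dphi w = 0"
  using assms by (simp_all add: dphi_def sq_lo sq_hi field_simps)

text \<open>Cutoff for the horizontal perturbation, with value 1 up to height 1/2 and 0 from height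
  1 on, glued from two parabolas at 3/4. From height 1 on the horizontal derivative is thus exactly
  \<open>mu\<close>.\<close>

definition chi :: "real \<Rightarrow> real" where "chi w = 1 - 8 * (esq (1/2) w - 2 * esq (3/4) w + esq 1 w)"
definition dchi :: "real \<Rightarrow> real" where "dchi w = - 8 * (desq (1/2) w - 2 * desq (3/4) w + desq 1 w)"

lemma DERIV_chi [derivative_intros]:
  "(g has_real_derivative g') (at x) \<Longrightarrow>
   ((\<lambda>x. chi (g x)) has_real_derivative dchi (g x) * g') (at x)"
  unfolding chi_def dchi_def by (auto intro!: derivative_eq_intros simp: algebra_simps)

lemma chi_minus: "chi (- w) = chi w" and dchi_minus: "dchi (- w) = - dchi w"
  by (simp_all add: chi_def dchi_def esq_minus desq_minus algebra_simps)

lemma chi_lo: "\<bar>w\<bar> \<le> 1/2 \<Longrightarrow> chi w = 1" and dchi_lo: "\<bar>w\<bar> \<le> 1/2 \<Longrightarrow> dchi w = 0"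
  by (simp_all add: chi_def dchi_def sq_lo)

lemma chi_hi: "1 \<le> \<bar>w\<bar> \<Longrightarrow> chi w = 0"
  by (subst even_abs[of chi, OF chi_minus]) (simp add: chi_def sq_hi power2_eq_square algebra_simps)

lemma dchi_hi: "1 \<le> \<bar>w\<bar> \<Longrightarrow> dchi w = 0"
proof -
  have "dchi w = 0" if "1 \<le> w" for w using that by (simp add: dchi_def sq_hi algebra_simps)
  then show "1 \<le> \<bar>w\<bar> \<Longrightarrow> dchi w = 0"
    using dchi_minus[of w] by (cases "0 \<le> w") auto
qed

lemma chi_mid:
  assumes "1/2 \<le> w" "w \<le> 1"
  shows "0 \<le> chi w" "chi w \<le> 1" "3/4 \<le> w \<Longrightarrow> chi w = 8 * (1 - w)\<^sup>2"
    "dchi w \<le> 0" "- dchi w \<le> 8 * (2 * w - 1)"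
proof -
  have "0 \<le> chi w \<and> chi w \<le> 1 \<and> (3/4 \<le> w \<longrightarrow> chi w = 8 * (1 - w)\<^sup>2) \<and> dchi w \<le> 0 \<and> - dchi w \<le> 8 * (2 * w - 1)"
  proof (cases "w < 3/4")
    case True
    then have e: "chi w = 1 - 8 * (w - 1/2)\<^sup>2" using assms by (simp add: chi_def sq_lo sq_hi)
    have "(w - 1/2)\<^sup>2 \<le> (1/4)\<^sup>2" using True assms by (intro power_mono) auto
    then have "0 \<le> chi w" "chi w \<le> 1" using e by (auto simp: power2_eq_square)
    then show ?thesis using True assms by (auto simp: dchi_def sq_lo sq_hi)
  next
    case False
    then have e: "chi w = 8 * (1 - w)\<^sup>2"
      using assms by (simp add: chi_def sq_lo sq_hi power2_eq_square algebra_simps)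
    have "(1 - w)\<^sup>2 \<le> (1/4)\<^sup>2" using False assms by (intro power_mono) auto
    then have "chi w \<le> 1" using e by (auto simp: power2_eq_square)
    then show ?thesis using False assms e by (auto simp: dchi_def sq_lo sq_hi)
  qed
  then show "0 \<le> chi w" "chi w \<le> 1" "3/4 \<le> w \<Longrightarrow> chi w = 8 * (1 - w)\<^sup>2"
    "dchi w \<le> 0" "- dchi w \<le> 8 * (2 * w - 1)" by auto
qed

lemma chi_bounds: "0 \<le> chi w" "chi w \<le> 1"
proof -
  have "0 \<le> chi \<bar>w\<bar> \<and> chi \<bar>w\<bar> \<le> 1"
    by (cases "\<bar>w\<bar> \<le> 1/2"; cases "1 \<le> \<bar>w\<bar>") (auto simp: chi_lo chi_hi chi_mid)
  then show "0 \<le> chi w" "chi w \<le> 1" using even_abs[of chi, OF chi_minus] by metis+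
qed

subsection \<open>The profile of the lens\<close>

text \<open>An odd tent with rounded corners: slope 200/199 up to 99/100, the opposite slope from
  101/100 on, and 0 from 401/200 on. A slope above 1 compensates the rounding, so that still
  \<open>H 1 = 1\<close>; it is close enough to 1 to keep \<open>20 - 19 * (200/199)\<close> above
  9/10.\<close>

definition H :: "real \<Rightarrow> real" where
  "H y = 200/199 * y - 10000/199 * (osq (99/100) y - osq (101/100) y - osq (399/200) y + osq (401/200) y)"
definition dH :: "real \<Rightarrow> real" where
  "dH y = 200/199 - 10000/199 * (dosq (99/100) y - dosq (101/100) y - dosq (399/200) y + dosq (401/200) y)"

lemma DERIV_H [derivative_intros]:
  "(g has_real_derivative g') (at x) \<Longrightarrow>
   ((\<lambda>x. H (g x)) has_real_derivative dH (g x) * g') (at x)"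
  unfolding H_def dH_def by (auto intro!: derivative_eq_intros simp: algebra_simps)

lemma H_minus: "H (- y) = - H y" and dH_minus: "dH (- y) = dH y"
  by (simp_all add: H_def dH_def osq_minus dosq_minus algebra_simps)

lemma H_0 [simp]: "H 0 = 0" using H_minus[of 0] by simp

lemma H_lo: "\<bar>y\<bar> \<le> 99/100 \<Longrightarrow> H y = 200/199 * y"
  by (simp add: H_def sq_lo)

lemma H_1: "H 1 = 1" and dH_1: "dH 1 = 0"
  by (simp_all add: H_def dH_def sq_lo sq_hi power2_eq_square)

lemma H_hi: "401/200 \<le> \<bar>y\<bar> \<Longrightarrow> H y = 0" and dH_hi: "401/200 \<le> \<bar>y\<bar> \<Longrightarrow> dH y = 0"
proof -
  have *: "H y = 0" "dH y = 0" if "401/200 \<le> y" for y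
    using that by (simp_all add: H_def dH_def sq_hi power2_eq_square algebra_simps)
  show "401/200 \<le> \<bar>y\<bar> \<Longrightarrow> H y = 0" "401/200 \<le> \<bar>y\<bar> \<Longrightarrow> dH y = 0"
    using *[of "\<bar>y\<bar>"] H_minus[of y] dH_minus[of y] by (cases "0 \<le> y"; simp add: abs_if)+
qed

lemma dH_bounds: "- (200/199) \<le> dH y" "dH y \<le> 200/199" "1 \<le> \<bar>y\<bar> \<Longrightarrow> dH y \<le> 0"
proof -
  have *: "- (200/199) \<le> dH y \<and> dH y \<le> 200/199 \<and> (1 \<le> y \<longrightarrow> dH y \<le> 0)" if "0 \<le> y" for y
  proof -
    consider "y \<le> 99/100" | "99/100 \<le> y" "y \<le> 101/100" | "101/100 \<le> y" "y \<le> 399/200"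
      | "399/200 \<le> y" "y \<le> 401/200" | "401/200 \<le> y" by linarith
    then show ?thesis using that by cases (auto simp: dH_def sq_lo sq_hi field_simps)
  qed
  show "- (200/199) \<le> dH y" "dH y \<le> 200/199" "1 \<le> \<bar>y\<bar> \<Longrightarrow> dH y \<le> 0"
    using *[of "\<bar>y\<bar>"] even_abs[of dH y, OF dH_minus] by auto
qed

text \<open>On the rounded corner, with \<open>z = 100 * y - 99\<close>, the claim amounts to
  \<open>z\<^sup>2 < y\<close>, which follows from \<open>z\<^sup>2 < z\<close> and
  \<open>z < y\<close>. The strict inequality will exclude fixed heights strictly between the sink
  and the lens boundary.\<close>

lemma H_gt: assumes "0 < y" "y < 1" shows "y < H y"
proof (cases "y \<le> 99/100")
  case True then show ?thesis using assms by (simp add: H_lo)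
next
  case False
  define z where "z = 100 * y - 99"
  have z: "0 < z" "z < 1" using False assms by (auto simp: z_def)
  have "z\<^sup>2 < z" using z by (simp add: power2_eq_square)
  then have "z\<^sup>2 < y" using z_def z by linarith
  moreover have "H y = 200/199 * y - z\<^sup>2 / 199"
    using False assms by (simp add: H_def sq_lo sq_hi z_def power2_eq_square field_simps)
  ultimately show ?thesis by simp
qed

lemma H_abs_le: "\<bar>H y\<bar> \<le> 200/199 * \<bar>y\<bar>"
proof -
  have *: "\<bar>H y\<bar> \<le> 200/199 * y" if "0 \<le> y" for y
  proof -
    have "\<exists>z. ((\<lambda>x. H x + 200/199 * x) has_real_derivative z) (at x) \<and> 0 \<le> z" for x
      using dH_bounds(1)[of x] by (intro exI[of _ "dH x + 200/199"]) (auto intro!: derivative_eq_intros)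
    then have 1: "H 0 + 200/199 * 0 \<le> H y + 200/199 * y"
      by (intro DERIV_nonneg_imp_nondecreasing[OF that]) auto
    have "\<exists>z. ((\<lambda>x. 200/199 * x - H x) has_real_derivative z) (at x) \<and> 0 \<le> z" for x
      using dH_bounds(2)[of x] by (intro exI[of _ "200/199 - dH x"]) (auto intro!: derivative_eq_intros)
    then have 2: "200/199 * 0 - H 0 \<le> 200/199 * y - H y"
      by (intro DERIV_nonneg_imp_nondecreasing[OF that]) auto
    show ?thesis using 1 2 by simp
  qed
  show ?thesis using *[of "\<bar>y\<bar>"] H_minus[of y] by (cases "0 \<le> y") auto
qed

subsection \<open>The horizontal perturbation\<close>

definition K :: "real \<Rightarrow> real" where "K y = sqp (1 - y\<^sup>2)"
definition dK :: "real \<Rightarrow> real" where "dK y = - 4 * y * max 0 (1 - y\<^sup>2)"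

lemma DERIV_K [derivative_intros]:
  "(g has_real_derivative g') (at x) \<Longrightarrow>
   ((\<lambda>x. K (g x)) has_real_derivative dK (g x) * g') (at x)"
  unfolding K_def dK_def by (auto intro!: derivative_eq_intros simp: algebra_simps)

lemma K_in: "\<bar>y\<bar> \<le> 1 \<Longrightarrow> K y = (1 - y\<^sup>2)\<^sup>2" "\<bar>y\<bar> \<le> 1 \<Longrightarrow> dK y = - 4 * y * (1 - y\<^sup>2)"
  and K_out: "1 \<le> \<bar>y\<bar> \<Longrightarrow> K y = 0" "1 \<le> \<bar>y\<bar> \<Longrightarrow> dK y = 0"
proof -
  have "\<bar>y\<bar> \<le> 1 \<longleftrightarrow> y\<^sup>2 \<le> 1" "1 \<le> \<bar>y\<bar> \<longleftrightarrow> 1 \<le> y\<^sup>2"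
    using abs_le_square_iff[of 1 y] by (simp_all add: abs_square_le_1)
  then show "\<bar>y\<bar> \<le> 1 \<Longrightarrow> K y = (1 - y\<^sup>2)\<^sup>2" "\<bar>y\<bar> \<le> 1 \<Longrightarrow> dK y = - 4 * y * (1 - y\<^sup>2)"
    "1 \<le> \<bar>y\<bar> \<Longrightarrow> K y = 0" "1 \<le> \<bar>y\<bar> \<Longrightarrow> dK y = 0"
    by (auto simp: K_def dK_def sqp_pos sqp_neg max_def)
qed

lemma K_bounds: "0 \<le> K y" "K y \<le> 1"
proof -
  show "0 \<le> K y" by (simp add: K_def)
  have "max 0 (1 - y\<^sup>2) \<le> 1" by simp
  then have "(max 0 (1 - y\<^sup>2))\<^sup>2 \<le> 1\<^sup>2" by (intro power_mono) auto
  then show "K y \<le> 1" by (simp add: K_def sqp_def)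
qed

lemma K_antimono: "\<bar>x\<bar> \<le> \<bar>y\<bar> \<Longrightarrow> K y \<le> K x"
  unfolding K_def sqp_def using abs_le_square_iff[of x y] by (intro power_mono) auto

text \<open>Derivative of \<open>y * K y\<close>. Its minimum -4/5, taken at
  \<open>y\<^sup>2 = 3/5\<close>, measures by how much the horizontal derivative overshoots
  \<open>mu\<close>.\<close>

definition dg :: "real \<Rightarrow> real" where "dg y = K y + y * dK y"

lemma dg_in: "\<bar>y\<bar> \<le> 1 \<Longrightarrow> dg y = (1 - y\<^sup>2) * (1 - 5 * y\<^sup>2)" and dg_out: "1 \<le> \<bar>y\<bar> \<Longrightarrow> dg y = 0"
  by (simp_all add: dg_def K_in K_out power2_eq_square algebra_simps)

lemma dg_bounds: "- (4/5) \<le> dg y" "dg y \<le> 1"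
proof -
  have "- (4/5) \<le> dg y \<and> dg y \<le> 1"
  proof (cases "\<bar>y\<bar> \<le> 1")
    case True
    define z where "z = y\<^sup>2"
    have z: "0 \<le> z" "z \<le> 1" using True by (auto simp: z_def abs_square_le_1)
    have e: "dg y = 5 * (z - 3/5)\<^sup>2 - 4/5"
      using True by (simp add: dg_in flip: z_def) (simp add: power2_eq_square algebra_simps)
    have "(z - 3/5)\<^sup>2 \<le> (3/5)\<^sup>2" using z unfolding abs_le_square_iff[symmetric] abs_le_iff by auto
    then have "5 * (z - 3/5)\<^sup>2 - 4/5 \<le> 1" by (simp add: power2_eq_square)
    then show ?thesis by (simp add: e)
  qed (simp add: dg_out)
  then show "- (4/5) \<le> dg y" "dg y \<le> 1" by auto
qed

lemma cubic_bound: assumes "0 \<le> z" shows "z - z ^ 3 \<le> (2/5::real)"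
proof -
  \<comment> \<open>\<open>29/50\<close> approximates the maximiser \<open>1 / sqrt 3\<close>; the
    product is \<open>(z - a)\<^sup>2 * (z + 2 * a) = z ^ 3 - 3 * a\<^sup>2 * z + 2 * a ^ 3\<close>,
    a tangent line estimate for the cube.\<close>
  have "0 \<le> (z - 29/50)\<^sup>2 * (z + 29/25)" using assms by simp
  then show ?thesis using assms by (simp add: power2_eq_square power3_eq_cube field_simps)
qed

lemma dK_bound: "\<bar>dK y\<bar> \<le> 8/5" and yK_bound: "\<bar>y * K y\<bar> \<le> 2/5"
proof -
  have "\<bar>dK y\<bar> \<le> 8/5 \<and> \<bar>y * K y\<bar> \<le> 2/5"
  proof (cases "\<bar>y\<bar> \<le> 1")
    case True
    define z where "z = \<bar>y\<bar>"
    have z: "0 \<le> z" "z \<le> 1" "y\<^sup>2 = z\<^sup>2" using True by (auto simp: z_def)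
    have z2: "0 \<le> 1 - z\<^sup>2" "1 - z\<^sup>2 \<le> 1" using z by (auto simp: abs_square_le_1)
    have c: "z * (1 - z\<^sup>2) \<le> 2/5"
      using cubic_bound[of z] z by (simp add: power2_eq_square power3_eq_cube algebra_simps)
    have "\<bar>dK y\<bar> = 4 * (z * (1 - z\<^sup>2))" "\<bar>y * K y\<bar> = z * (1 - z\<^sup>2) * (1 - z\<^sup>2)"
      using True z z2 by (simp_all add: K_in abs_mult z_def[symmetric] power2_eq_square[of "1 - _"])
    moreover have "z * (1 - z\<^sup>2) * (1 - z\<^sup>2) \<le> z * (1 - z\<^sup>2) * 1"
      using z z2 by (intro mult_left_mono) auto
    ultimately show ?thesis using c by simp
  qed (simp add: K_out)
  then show "\<bar>dK y\<bar> \<le> 8/5" "\<bar>y * K y\<bar> \<le> 2/5" by auto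
qed

text \<open>\<open>kk\<close> makes the horizontal derivative at the origin
  \<open>mu - kk = 1/3\<close>. The bump is constant up to radius \<open>nu\<close> and vanishes
  from \<open>2 * nu\<close> on; \<open>Rc\<close> is so small that its partial derivatives stay
  below 17/1000.\<close>

definition kk :: real where "kk = mu - 1/3"
definition nu :: real where "nu = 1/4000"
definition Rc :: real where "Rc = 1/40000000"

text \<open>The scale 80 confines the perturbation to eigencoordinates below 1/80, well inside the
  unit cell, yet far beyond the disc of radius \<open>2 * nu\<close>, over which both factors
  \<open>K\<close> are nearly 1. The suffixes \<open>_u\<close> and \<open>_s\<close> mark partial
  derivatives.\<close>

definition al :: "real \<Rightarrow> real \<Rightarrow> real" where "al u s = - kk * (u * K (80 * u)) * K (80 * s)"
definition al_u :: "real \<Rightarrow> real \<Rightarrow> real" where "al_u u s = - kk * dg (80 * u) * K (80 * s)"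
definition al_s :: "real \<Rightarrow> real \<Rightarrow> real" where "al_s u s = - kk * (80 * u * K (80 * u)) * dK (80 * s)"

lemma kk_bounds: "94/10 < kk" "kk < 96/10"
  using mu_bounds by (auto simp: kk_def)

lemma al_u_bounds: "- kk \<le> al_u u s" "al_u u s \<le> 4/5 * kk"
proof -
  define x where "x = dg (80 * u) * K (80 * s)"
  have "x \<le> 1 * K (80 * s)" "- (4/5) * K (80 * s) \<le> x"
    unfolding x_def using dg_bounds K_bounds by (intro mult_right_mono; simp)+
  then have x: "x \<le> 1" "- (4/5) \<le> x" using K_bounds[of "80 * s"] by auto
  have "kk * x \<le> kk * 1" "kk * (- (4/5)) \<le> kk * x"
    using x kk_bounds by (intro mult_left_mono; simp)+
  moreover have "al_u u s = - (kk * x)" by (simp add: al_u_def x_def)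
  ultimately show "- kk \<le> al_u u s" "al_u u s \<le> 4/5 * kk" by auto
qed

lemma al_bound: "\<bar>al u s\<bar> \<le> 5/100"
proof -
  have "\<bar>al u s\<bar> = kk * (\<bar>80 * u * K (80 * u)\<bar> / 80 * K (80 * s))"
    using kk_bounds K_bounds by (simp add: al_def abs_mult)
  also have "\<dots> \<le> kk * ((2/5) / 80 * 1)"
    using kk_bounds yK_bound K_bounds by (intro mult_left_mono mult_mono divide_right_mono) auto
  finally show ?thesis using kk_bounds by simp
qed

lemma al_s_bound: "\<bar>al_s u s\<bar> \<le> 7"
proof -
  have "\<bar>al_s u s\<bar> = kk * (\<bar>80 * u * K (80 * u)\<bar> * \<bar>dK (80 * s)\<bar>)"
    using kk_bounds K_bounds by (simp add: al_s_def abs_mult)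
  also have "\<dots> \<le> kk * ((2/5) * (8/5))"
    using kk_bounds yK_bound dK_bound by (intro mult_left_mono mult_mono) auto
  finally show ?thesis using kk_bounds by simp
qed

lemma al_support:
  assumes "1 \<le> \<bar>80 * u\<bar> \<or> 1 \<le> \<bar>80 * s\<bar>"
  shows "al u s = 0"
  using assms by (auto simp: al_def K_out)

section \<open>The bump over the disc\<close>

text \<open>Profile in the squared distance, with value 1 up to 1 and 0 from 4 on; the inner
  \<open>sqp\<close> makes it C1 at 1 and the outer one at 4.\<close>

definition PP :: "real \<Rightarrow> real" where "PP q = sqp (1 - sqp (q - 1) / 9)"
definition dPP :: "real \<Rightarrow> real" where
  "dPP q = 2 * max 0 (1 - sqp (q - 1) / 9) * (- (2 * max 0 (q - 1) / 9))"

lemma DERIV_PP: "(PP has_real_derivative dPP q) (at q)"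
proof -
  have "((\<lambda>q. sqp (1 - sqp (q - 1) / 9)) has_real_derivative dPP q) (at q)"
    unfolding dPP_def by (rule derivative_eq_intros refl | simp)+
  then show ?thesis by (simp add: PP_def[abs_def])
qed

lemma sqp_ge: "4 \<le> q \<Longrightarrow> 9 \<le> sqp (q - 1)"
  using power_mono[of 3 "q - 1" 2] by (simp add: sqp_pos)

lemma PP_hi: "4 \<le> q \<Longrightarrow> PP q = 0" and dPP_hi: "4 \<le> q \<Longrightarrow> dPP q = 0"
  using sqp_ge[of q] by (simp_all add: PP_def dPP_def sqp_neg)

lemma PP_lo: "q \<le> 1 \<Longrightarrow> PP q = 1" by (simp add: PP_def sqp_neg sqp_pos)

lemma PP_pos: "q < 4 \<Longrightarrow> 0 < PP q"
proof -
  assume q: "q < 4"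
  have "sqp (q - 1) < 9"
  proof (cases "q \<le> 1")
    case False
    then have "(q - 1)\<^sup>2 < 3\<^sup>2" using q by (intro power_strict_mono) auto
    then show ?thesis using False by (simp add: sqp_pos)
  qed (simp add: sqp_neg)
  then show ?thesis by (simp add: PP_def sqp_pos)
qed

lemma PP_bounds: "0 \<le> PP q" "PP q \<le> 1"
proof -
  show "0 \<le> PP q" by (simp add: PP_def)
  have "(max 0 (1 - sqp (q - 1) / 9))\<^sup>2 \<le> 1\<^sup>2" by (intro power_mono) auto
  then show "PP q \<le> 1" by (simp add: PP_def sqp_def)
qed

lemma dPP_bound: "\<bar>dPP q\<bar> \<le> 4/3"
proof (cases "q < 4")
  case True
  define x where "x = max 0 (1 - sqp (q - 1) / 9)"
  define z where "z = max 0 (q - 1)"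
  have x: "0 \<le> x" "x \<le> 1" and z: "0 \<le> z" "z \<le> 3" using True by (auto simp: x_def z_def)
  have "\<bar>dPP q\<bar> = x * (4 * z / 9)" using x z unfolding dPP_def x_def[symmetric] z_def[symmetric] by (simp add: abs_mult)
  also have "\<dots> \<le> 1 * (4 * 3 / 9)" using x z by (intro mult_mono) auto
  finally show ?thesis by simp
qed (simp add: dPP_hi)

definition qq :: "real \<Rightarrow> real \<Rightarrow> real" where "qq u s = (u\<^sup>2 + s\<^sup>2) / nu\<^sup>2"
definition rf :: "real \<Rightarrow> real \<Rightarrow> real" where "rf u s = 19 * Rc * PP (qq u s)"
definition rf_u :: "real \<Rightarrow> real \<Rightarrow> real" where "rf_u u s = 19 * Rc * dPP (qq u s) * (2 * u / nu\<^sup>2)"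
definition rf_s :: "real \<Rightarrow> real \<Rightarrow> real" where "rf_s u s = 19 * Rc * dPP (qq u s) * (2 * s / nu\<^sup>2)"

lemma Rc_pos: "0 < Rc" by (simp add: Rc_def)

lemma rf_bounds: "0 \<le> rf u s" "rf u s \<le> 19 * Rc"
  using PP_bounds Rc_pos by (auto simp: rf_def)

lemma rf_pos_iff: "0 < rf u s \<longleftrightarrow> qq u s < 4"
  using PP_pos[of "qq u s"] PP_hi[of "qq u s"] Rc_pos
  by (cases "qq u s < 4") (auto simp: rf_def)

lemma rf_core: "qq u s \<le> 1 \<Longrightarrow> rf u s = 19 * Rc" by (simp add: rf_def PP_lo)

lemma rf_deriv_zero: "rf u s = 0 \<Longrightarrow> rf_u u s = 0" "rf u s = 0 \<Longrightarrow> rf_s u s = 0"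
  using rf_pos_iff[of u s] dPP_hi[of "qq u s"] by (auto simp: rf_u_def rf_s_def)

lemma rf_pos_small:
  assumes "0 < rf u s" shows "\<bar>u\<bar> < 2 * nu" "\<bar>s\<bar> < 2 * nu"
proof -
  have "u\<^sup>2 + s\<^sup>2 < 4 * nu\<^sup>2"
    using assms by (simp add: rf_pos_iff qq_def nu_def field_simps)
  moreover have "(2 * nu)\<^sup>2 = 4 * nu\<^sup>2" by (simp add: power_mult_distrib)
  ultimately have "u\<^sup>2 < (2 * nu)\<^sup>2" and "s\<^sup>2 < (2 * nu)\<^sup>2"
    using zero_le_power2[of u] zero_le_power2[of s] by linarith+
  then show "\<bar>u\<bar> < 2 * nu" "\<bar>s\<bar> < 2 * nu"
    using power2_less_imp_less[of "\<bar>u\<bar>" "2 * nu"] power2_less_imp_less[of "\<bar>s\<bar>" "2 * nu"]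
    by (simp_all add: nu_def)
qed

lemma rf_u_bound: "\<bar>rf_u u s\<bar> \<le> 17/1000"
proof (cases "rf u s = 0")
  case False
  then have "\<bar>u\<bar> < 2 * nu" using rf_pos_small rf_bounds by (metis less_eq_real_def)
  then have u: "2 * \<bar>u\<bar> / nu\<^sup>2 \<le> 16000" by (simp add: nu_def power2_eq_square)
  have "\<bar>rf_u u s\<bar> = 19 * Rc * \<bar>dPP (qq u s)\<bar> * (2 * \<bar>u\<bar> / nu\<^sup>2)"
    using Rc_pos by (simp add: rf_u_def abs_mult)
  also have "\<dots> \<le> 19 * Rc * (4/3) * 16000"
    using dPP_bound u Rc_pos by (intro mult_mono) auto
  finally show ?thesis by (simp add: Rc_def)
qed (simp add: rf_deriv_zero)

section \<open>The vertical map over a point with bump value \<open>r\<close>\<close>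

text \<open>Where \<open>r > 0\<close>, the argument of \<open>H\<close> is the height relative to
  that of the lens (\<open>tau_lens\<close>). \<open>dpsih\<close> and \<open>cpsih\<close> are the
  partial derivatives in \<open>w\<close> and in \<open>r\<close>.\<close>

definition psih :: "real \<Rightarrow> real \<Rightarrow> real" where "psih r w = psi0 w - r * H (20 * w / (r + Rc))"
definition dpsih :: "real \<Rightarrow> real \<Rightarrow> real" where
  "dpsih r w = dpsi0 w - 20 * (r / (r + Rc)) * dH (20 * w / (r + Rc))"
definition cpsih :: "real \<Rightarrow> real \<Rightarrow> real" where
  "cpsih r w = - H (20 * w / (r + Rc)) + dH (20 * w / (r + Rc)) * (20 * w / (r + Rc)) * (r / (r + Rc))"

lemma psih_0: "psih 0 w = psi0 w" "dpsih 0 w = dpsi0 w" by (simp_all add: psih_def dpsih_def)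

lemma psih_minus: "psih r (- w) = - psih r w"
  by (simp add: psih_def psi0_minus H_minus)

text \<open>The lens has a height of order \<open>Rc\<close>, so from height 1/2 on \<open>H\<close>
  is evaluated in the range where it vanishes.\<close>

lemma lens_hi:
  assumes "0 \<le> r" "r \<le> 19 * Rc" "1/2 \<le> \<bar>w\<bar>"
  shows "H (20 * w / (r + Rc)) = 0" "dH (20 * w / (r + Rc)) = 0"
    "psih r w = psi0 w" "dpsih r w = dpsi0 w" "cpsih r w = 0"
proof -
  have rR: "0 < r + Rc" "r + Rc \<le> 20 * Rc" using assms Rc_pos by auto
  have "401/200 * (r + Rc) \<le> 401/200 * (20 * Rc)" using rR by simp
  also have "\<dots> \<le> 20 * \<bar>w\<bar>" using assms by (simp add: Rc_def)
  finally have "401/200 \<le> \<bar>20 * w / (r + Rc)\<bar>" using rR by (simp add: abs_mult field_simps)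
  then show "H (20 * w / (r + Rc)) = 0" "dH (20 * w / (r + Rc)) = 0"
    by (simp_all add: H_hi dH_hi)
  then show "psih r w = psi0 w" "dpsih r w = dpsi0 w" "cpsih r w = 0"
    by (simp_all add: psih_def dpsih_def cpsih_def)
qed

text \<open>Since \<open>r / (r + Rc)\<close> is at most 19/20, the lens lowers the slope 20 by at
  most \<open>19 * (200/199)\<close>. From the boundary of the lens on, \<open>dH\<close> is
  nonpositive and the slope is not lowered at all.\<close>

lemma dpsih_lens:
  assumes "0 \<le> r" "r \<le> 19 * Rc" "\<bar>w\<bar> \<le> 1"
  shows "9/10 \<le> dpsih r w" and "r + Rc \<le> 20 * \<bar>w\<bar> \<Longrightarrow> 20 \<le> dpsih r w"
proof -
  define \<rho> where "\<rho> = r / (r + Rc)"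
  define h where "h = dH (20 * w / (r + Rc))"
  have e: "dpsih r w = 20 - 20 * (\<rho> * h)" using assms by (simp add: dpsih_def \<rho>_def h_def dpsi0_lo)
  have \<rho>: "0 \<le> \<rho>" "\<rho> \<le> 19/20" using assms Rc_pos by (auto simp: \<rho>_def field_simps)
  have "\<rho> * h \<le> \<rho> * (200/199)" using \<rho> dH_bounds(2) by (intro mult_left_mono) (auto simp: h_def)
  also have "\<dots> \<le> 19/20 * (200/199)" using \<rho> by (intro mult_right_mono) auto
  finally show "9/10 \<le> dpsih r w" by (simp add: e)
  assume "r + Rc \<le> 20 * \<bar>w\<bar>"
  then have "1 \<le> \<bar>20 * w / (r + Rc)\<bar>" using assms Rc_pos by (simp add: abs_mult field_simps)
  then have "h \<le> 0" unfolding h_def by (rule dH_bounds)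
  then have "\<rho> * h \<le> 0" using \<rho> by (simp add: mult_nonneg_nonpos)
  then show "20 \<le> dpsih r w" by (simp add: e)
qed

lemma cpsih_bound:
  assumes "0 \<le> r"
  shows "\<bar>cpsih r w\<bar> \<le> 5"
proof -
  define y where "y = 20 * w / (r + Rc)"
  have \<rho>: "0 \<le> r / (r + Rc)" "r / (r + Rc) \<le> 1" using assms Rc_pos by (auto simp: field_simps)
  show ?thesis
  proof (cases "401/200 \<le> \<bar>y\<bar>")
    case True
    then show ?thesis unfolding cpsih_def y_def[symmetric] by (simp add: H_hi dH_hi)
  next
    case False
    have "\<bar>dH y * y * (r / (r + Rc))\<bar> = \<bar>dH y\<bar> * \<bar>y\<bar> * (r / (r + Rc))"
      using assms Rc_pos by (simp add: abs_mult)
    also have "\<dots> \<le> (200/199) * (401/200) * 1"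
      using False dH_bounds[of y] \<rho> by (intro mult_mono) auto
    finally have "\<bar>dH y * y * (r / (r + Rc))\<bar> \<le> 401/199" by simp
    moreover have "\<bar>H y\<bar> \<le> 401/199" using H_abs_le[of y] False by auto
    ultimately show ?thesis unfolding cpsih_def y_def[symmetric] by linarith
  qed
qed

lemma dpsih_pos: "0 \<le> r \<Longrightarrow> r \<le> 19 * Rc \<Longrightarrow> 1/2 \<le> dpsih r w"
  using dpsih_lens(1)[of r w] lens_hi(4)[of r w] dpsi0_bounds(1)[of w]
  by (cases "\<bar>w\<bar> \<le> 1") auto

lemma DERIV_psih: "(psih r has_real_derivative dpsih r w) (at w)"
proof -
  define c where "c = 20 / (r + Rc)"
  have c: "20 * w / (r + Rc) = c * w" for w by (simp add: c_def)
  have "((\<lambda>w. psi0 w - r * H (c * w)) has_real_derivative dpsi0 w - r * dH (c * w) * c) (at w)"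
    by (auto intro!: derivative_eq_intros)
  moreover have "dpsi0 w - r * dH (c * w) * c = dpsih r w"
    unfolding dpsih_def c by (simp add: c_def)
  ultimately show ?thesis by (simp add: psih_def[abs_def] c)
qed

lemma psih_strict_mono:
  assumes "0 \<le> r" "r \<le> 19 * Rc" "v < w" shows "psih r v < psih r w"
proof (rule DERIV_pos_imp_increasing[OF assms(3)])
  fix x show "\<exists>y. DERIV (psih r) x :> y \<and> 0 < y"
    using DERIV_psih[of r x] dpsih_pos[of r x] assms by (intro exI[of _ "dpsih r x"]) auto
qed

subsection \<open>Eigencoordinates\<close>

definition uu :: "real ^ 3 \<Rightarrow> real" where "uu X = (X $ 2 - lam * X $ 1) / (mu - lam)"
definition ss :: "real ^ 3 \<Rightarrow> real" where "ss X = (mu * X $ 1 - X $ 2) / (mu - lam)"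
definition ww :: "real ^ 3 \<Rightarrow> real" where "ww X = 117 * X $ 3"
definition eu :: "real ^ 3" where "eu = vector [1, mu, 0]"
definition es :: "real ^ 3" where "es = vector [1, lam, 0]"
definition ew :: "real ^ 3" where "ew = vector [0, 0, 1/117]"

lemma mu_lam_neq [simp]: "mu - lam \<noteq> 0" "mu \<noteq> lam" "lam \<noteq> mu" using mu_bounds lam_bounds by auto

lemma bounded_linear_coords: "bounded_linear uu" "bounded_linear ss" "bounded_linear ww"
  unfolding uu_def[abs_def] ss_def[abs_def] ww_def[abs_def]
  by (intro bounded_linear_intros bounded_linear_vec_nth bounded_linear_divide
      bounded_linear_compose[OF bounded_linear_divide] bounded_linear_const_mult; simp)+

lemma coords_add [simp]: "uu (X + Y) = uu X + uu Y" "ss (X + Y) = ss X + ss Y" "ww (X + Y) = ww X + ww Y"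
  and coords_diff [simp]: "uu (X - Y) = uu X - uu Y" "ss (X - Y) = ss X - ss Y" "ww (X - Y) = ww X - ww Y"
  and coords_scale [simp]: "uu (c *\<^sub>R X) = c * uu X" "ss (c *\<^sub>R X) = c * ss X" "ww (c *\<^sub>R X) = c * ww X"
  and coords_0 [simp]: "uu 0 = 0" "ss 0 = 0" "ww 0 = 0"
proof -
  note l = bounded_linear_coords[THEN bounded_linear.linear]
  show "uu (X + Y) = uu X + uu Y" "ss (X + Y) = ss X + ss Y" "ww (X + Y) = ww X + ww Y"
    "uu (X - Y) = uu X - uu Y" "ss (X - Y) = ss X - ss Y" "ww (X - Y) = ww X - ww Y"
    "uu (c *\<^sub>R X) = c * uu X" "ss (c *\<^sub>R X) = c * ss X" "ww (c *\<^sub>R X) = c * ww X"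
    "uu 0 = 0" "ss 0 = 0" "ww 0 = 0"
    by (simp_all add: l[THEN linear_add] l[THEN linear_diff] l[THEN linear_scale] l[THEN linear_0])
qed

lemma coords_basis [simp]:
  "uu eu = 1" "ss eu = 0" "ww eu = 0" "uu es = 0" "ss es = 1" "ww es = 0" "uu ew = 0" "ss ew = 0" "ww ew = 1"
  by (simp_all add: uu_def ss_def ww_def eu_def es_def ew_def)

lemma nth_of_coords: "X $ 1 = uu X + ss X" "X $ 2 = mu * uu X + lam * ss X" "X $ 3 = ww X / 117"
proof -
  have u: "(mu - lam) * uu X = X $ 2 - lam * X $ 1" and s: "(mu - lam) * ss X = mu * X $ 1 - X $ 2"
    by (simp_all add: uu_def ss_def)
  have "(mu - lam) * (uu X + ss X) = (mu - lam) * X $ 1"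
    unfolding distrib_left u s by (simp add: algebra_simps)
  then show "X $ 1 = uu X + ss X" by simp
  have "(mu - lam) * (mu * uu X + lam * ss X) = mu * ((mu - lam) * uu X) + lam * ((mu - lam) * ss X)"
    by (simp add: algebra_simps)
  also have "\<dots> = (mu - lam) * X $ 2" unfolding u s by (simp add: algebra_simps)
  finally show "X $ 2 = mu * uu X + lam * ss X" by simp
qed (simp add: ww_def)

lemma coords_eqI: "uu X = uu Y \<Longrightarrow> ss X = ss Y \<Longrightarrow> ww X = ww Y \<Longrightarrow> X = Y"
  by (simp add: vec_eq_iff forall_3 nth_of_coords)

lemma coords_expand: "X = uu X *\<^sub>R eu + ss X *\<^sub>R es + ww X *\<^sub>R ew"
  by (rule coords_eqI) simp_all

lemmas continuous_coords [continuous_intros] =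
  bounded_linear.continuous_on[OF bounded_linear_coords(1)]
  bounded_linear.continuous_on[OF bounded_linear_coords(2)]
  bounded_linear.continuous_on[OF bounded_linear_coords(3)]

lemmas has_derivative_coords [derivative_intros] =
  bounded_linear.has_derivative[OF bounded_linear_coords(1)]
  bounded_linear.has_derivative[OF bounded_linear_coords(2)]
  bounded_linear.has_derivative[OF bounded_linear_coords(3)]

subsection \<open>The perturbation on a neighbourhood of the unit cell\<close>

lemma DERIV_chain_FDERIV:
  assumes "\<And>y. (f has_real_derivative f' y) (at y)" "(g has_derivative g') (at x within S)"
  shows "((\<lambda>x. f (g x)) has_derivative (\<lambda>v. f' (g x) * g' v)) (at x within S)"
  using DERIV_compose_FDERIV[OF assms] by (simp add: mult.commute)

text \<open>On the cell, \<open>ha\<close> and \<open>hp\<close> are the displacements from the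
  linear automorphism in the directions \<open>eu\<close> and \<open>ew\<close>, and
  \<open>hr\<close> is the bump. Displacements, unlike the map itself, have periodic
  extensions.\<close>

definition ha :: "real ^ 3 \<Rightarrow> real" where "ha X = chi (ww X) * al (uu X) (ss X) + phi (ww X)"
definition ha_w :: "real ^ 3 \<Rightarrow> real" where "ha_w X = dchi (ww X) * al (uu X) (ss X) + dphi (ww X)"
definition Dha :: "real ^ 3 \<Rightarrow> real ^ 3 \<Rightarrow> real" where
  "Dha X v = chi (ww X) * al_u (uu X) (ss X) * uu v + chi (ww X) * al_s (uu X) (ss X) * ss v + ha_w X * ww v"

definition hr :: "real ^ 3 \<Rightarrow> real" where "hr X = rf (uu X) (ss X)"
definition Dhr :: "real ^ 3 \<Rightarrow> real ^ 3 \<Rightarrow> real" where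
  "Dhr X v = rf_u (uu X) (ss X) * uu v + rf_s (uu X) (ss X) * ss v"

definition hp :: "real ^ 3 \<Rightarrow> real" where "hp X = psih (hr X) (ww X) - ww X"
definition Dhp :: "real ^ 3 \<Rightarrow> real ^ 3 \<Rightarrow> real" where
  "Dhp X v = cpsih (hr X) (ww X) * Dhr X v + (dpsih (hr X) (ww X) - 1) * ww v"

lemma has_derivative_al:
  "((\<lambda>X. al (uu X) (ss X)) has_derivative
     (\<lambda>v. al_u (uu X) (ss X) * uu v + al_s (uu X) (ss X) * ss v)) (at X)"
proof -
  note K = DERIV_chain_FDERIV[OF DERIV_K[OF DERIV_ident]]
  have 1: "((\<lambda>X. K (80 * uu X)) has_derivative (\<lambda>v. dK (80 * uu X) * 1 * (80 * uu v))) (at X)"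
    by (rule K) (auto intro!: derivative_eq_intros)
  have 2: "((\<lambda>X. K (80 * ss X)) has_derivative (\<lambda>v. dK (80 * ss X) * 1 * (80 * ss v))) (at X)"
    by (rule K) (auto intro!: derivative_eq_intros)
  show ?thesis unfolding al_def
    by (rule has_derivative_eq_rhs, (rule derivative_intros 1 2 refl)+)
      (auto simp: al_u_def al_s_def dg_def fun_eq_iff algebra_simps)
qed

lemma has_derivative_ha: "(ha has_derivative Dha X) (at X)"
proof -
  have 1: "((\<lambda>X. chi (ww X)) has_derivative (\<lambda>v. dchi (ww X) * 1 * ww v)) (at X)"
    by (rule DERIV_chain_FDERIV[OF DERIV_chi[OF DERIV_ident]]) (rule derivative_intros has_derivative_ident)+
  have 2: "((\<lambda>X. phi (ww X)) has_derivative (\<lambda>v. dphi (ww X) * 1 * ww v)) (at X)"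
    by (rule DERIV_chain_FDERIV[OF DERIV_phi[OF DERIV_ident]]) (rule derivative_intros has_derivative_ident)+
  have "((\<lambda>X. chi (ww X) * al (uu X) (ss X) + phi (ww X)) has_derivative Dha X) (at X)"
    by (rule has_derivative_eq_rhs, (rule has_derivative_add has_derivative_mult has_derivative_al 1 2)+)
      (auto simp: Dha_def ha_w_def fun_eq_iff algebra_simps)
  then show ?thesis by (simp add: ha_def[abs_def])
qed

lemma has_derivative_hr: "(hr has_derivative Dhr X) (at X)"
proof -
  have 1: "((\<lambda>X. qq (uu X) (ss X)) has_derivative (\<lambda>v. (2 * uu X * uu v + 2 * ss X * ss v) / nu\<^sup>2)) (at X)"
    unfolding qq_def by (auto intro!: derivative_eq_intros simp: nu_def fun_eq_iff field_simps)
  have "((\<lambda>X. PP (qq (uu X) (ss X))) has_derivative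
      (\<lambda>v. dPP (qq (uu X) (ss X)) * ((2 * uu X * uu v + 2 * ss X * ss v) / nu\<^sup>2))) (at X)"
    by (rule DERIV_chain_FDERIV[OF DERIV_PP 1])
  then have "((\<lambda>X. 19 * Rc * PP (qq (uu X) (ss X))) has_derivative
      (\<lambda>v. 19 * Rc * (dPP (qq (uu X) (ss X)) * ((2 * uu X * uu v + 2 * ss X * ss v) / nu\<^sup>2)))) (at X)"
    by (rule has_derivative_mult_right)
  then have "(hr has_derivative
      (\<lambda>v. 19 * Rc * (dPP (qq (uu X) (ss X)) * ((2 * uu X * uu v + 2 * ss X * ss v) / nu\<^sup>2)))) (at X)"
    by (simp add: hr_def[abs_def] rf_def)
  then show ?thesis
    by (rule has_derivative_eq_rhs)
       (simp add: Dhr_def rf_u_def rf_s_def fun_eq_iff add_divide_distrib algebra_simps)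
qed

lemma hr_bounds: "0 \<le> hr X" "hr X \<le> 19 * Rc"
  using rf_bounds by (auto simp: hr_def)

lemma has_derivative_hp: "(hp has_derivative Dhp X) (at X)"
proof -
  have ne: "hr X + Rc \<noteq> 0" using hr_bounds[of X] Rc_pos by simp
  have w: "(ww has_derivative ww) (at X)"
    using has_derivative_coords(3)[OF has_derivative_ident] .
  have 1: "((\<lambda>X. 20 * ww X / (hr X + Rc)) has_derivative
      (\<lambda>v. 20 * ww v / (hr X + Rc) - 20 * ww X * Dhr X v / (hr X + Rc)\<^sup>2)) (at X)"
    by (rule has_derivative_eq_rhs, (rule has_derivative_divide has_derivative_mult_right
          has_derivative_add has_derivative_const has_derivative_hr w ne)+)
       (simp add: fun_eq_iff power2_eq_square divide_inverse)
  have 2: "((\<lambda>X. H (20 * ww X / (hr X + Rc))) has_derivative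
      (\<lambda>v. dH (20 * ww X / (hr X + Rc)) * 1 * (20 * ww v / (hr X + Rc) - 20 * ww X * Dhr X v / (hr X + Rc)\<^sup>2))) (at X)"
    by (rule DERIV_chain_FDERIV[OF DERIV_H[OF DERIV_ident] 1])
  have 3: "((\<lambda>X. psi0 (ww X)) has_derivative (\<lambda>v. dpsi0 (ww X) * 1 * ww v)) (at X)"
    by (rule DERIV_chain_FDERIV[OF DERIV_psi0[OF DERIV_ident] w])
  have "((\<lambda>X. psi0 (ww X) - hr X * H (20 * ww X / (hr X + Rc)) - ww X) has_derivative Dhp X) (at X)"
    apply (rule has_derivative_eq_rhs, (rule has_derivative_diff has_derivative_mult has_derivative_hr w 2 3)+)
    using ne by (auto simp: Dhp_def cpsih_def dpsih_def fun_eq_iff power2_eq_square field_simps)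
  then show ?thesis by (simp add: hp_def[abs_def] psih_def)
qed

text \<open>Eigencoordinates below 1/80 force both horizontal coordinates below 1/4, away from the
  faces of the cell where congruent points must be compared.\<close>

lemma box_support:
  assumes "1/4 < \<bar>X $ 1\<bar> \<or> 1/4 < \<bar>X $ 2\<bar>"
  shows "al (uu X) (ss X) = 0" "hr X = 0"
proof -
  have *: "1 \<le> \<bar>80 * uu X\<bar> \<or> 1 \<le> \<bar>80 * ss X\<bar>"
  proof (rule ccontr)
    assume "\<not> ?thesis"
    then have b: "\<bar>uu X\<bar> < 1/80" "\<bar>ss X\<bar> < 1/80" by auto
    have "\<bar>mu * uu X\<bar> \<le> 10 * (1/80)" "\<bar>lam * ss X\<bar> \<le> 1 * (1/80)"
      unfolding abs_mult using b mu_bounds lam_bounds by (intro mult_mono; simp)+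
    then have "\<bar>X $ 1\<bar> \<le> 1/4" "\<bar>X $ 2\<bar> \<le> 1/4"
      unfolding nth_of_coords
      using b abs_triangle_ineq[of "uu X" "ss X"] abs_triangle_ineq[of "mu * uu X" "lam * ss X"] by linarith+
    then show False using assms by linarith
  qed
  then show "al (uu X) (ss X) = 0" by (rule al_support)
  show "hr X = 0"
  proof (rule ccontr)
    assume "hr X \<noteq> 0"
    then have "0 < rf (uu X) (ss X)" using rf_bounds[of "uu X" "ss X"] by (simp add: hr_def)
    from rf_pos_small[OF this] show False using * by (auto simp: nu_def)
  qed
qed

lemma Ints_cases_small:
  fixes x y :: real
  assumes "\<bar>x\<bar> < 3/4" "\<bar>y\<bar> < 3/4" "x - y \<in> \<int>" "x \<noteq> y"
  shows "1/4 < \<bar>x\<bar> \<and> 1/4 < \<bar>y\<bar> \<and> (x = y + 1 \<or> y = x + 1)"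
proof -
  obtain n where n: "x - y = of_int n" using assms by (auto elim: Ints_cases)
  have "n \<noteq> 0" using n assms by auto
  moreover have "\<bar>of_int n\<bar> < (2::real)" using n assms by linarith
  then have "\<bar>n\<bar> < 2" by linarith
  ultimately have "n = 1 \<or> n = -1" by linarith
  then show ?thesis using n assms by auto
qed

lemma compat_horizontal:
  assumes "\<And>i. \<bar>X $ i\<bar> < 3/4 \<and> \<bar>Y $ i\<bar> < 3/4 \<and> (X $ i - Y $ i :: real) \<in> \<int>"
  shows "(uu X = uu Y \<and> ss X = ss Y) \<or>
    (al (uu X) (ss X) = 0 \<and> al (uu Y) (ss Y) = 0 \<and> hr X = 0 \<and> hr Y = 0)"
proof (cases "X $ 1 = Y $ 1 \<and> X $ 2 = Y $ 2")
  case True then show ?thesis by (simp add: uu_def ss_def)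
next
  case False
  then have "(1/4 < \<bar>X $ 1\<bar> \<and> 1/4 < \<bar>Y $ 1\<bar>) \<or> (1/4 < \<bar>X $ 2\<bar> \<and> 1/4 < \<bar>Y $ 2\<bar>)"
    using Ints_cases_small[of "X $ 1" "Y $ 1"] Ints_cases_small[of "X $ 2" "Y $ 2"] assms[of 1] assms[of 2] by blast
  then show ?thesis using box_support[of X] box_support[of Y] by blast
qed

text \<open>Beyond height 20 the displacement is \<open>117/4 - w / 2\<close> on the positive side
  and \<open>- 117/4 - w / 2\<close> on the negative one; these agree for heights 117 apart.\<close>

lemma compat_vertical:
  assumes "\<And>i. \<bar>X $ i\<bar> < 3/4 \<and> \<bar>Y $ i\<bar> < 3/4 \<and> (X $ i - Y $ i :: real) \<in> \<int>"
  shows "ww X = ww Y \<or> (20 \<le> \<bar>ww X\<bar> \<and> 20 \<le> \<bar>ww Y\<bar> \<and> psi0 (ww X) - ww X = psi0 (ww Y) - ww Y)"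
proof (cases "X $ 3 = Y $ 3")
  case False
  then have *: "1/4 < \<bar>X $ 3\<bar>" "1/4 < \<bar>Y $ 3\<bar>" "X $ 3 = Y $ 3 + 1 \<or> Y $ 3 = X $ 3 + 1"
    using Ints_cases_small[of "X $ 3" "Y $ 3"] assms[of 3] by blast+
  have p: "psi0 w = (if 0 \<le> w then 117/4 else - (117/4)) + w / 2" if "20 \<le> \<bar>w\<bar>" for w
    using that psi0_hi[of w] psi0_hi[of "- w"] psi0_minus[of w] by auto
  have "20 \<le> \<bar>ww X\<bar>" "20 \<le> \<bar>ww Y\<bar>" using * by (auto simp: ww_def)
  moreover have "psi0 (ww X) - ww X = psi0 (ww Y) - ww Y"
    using p[OF calculation(1)] p[OF calculation(2)] * assms[of 3]
    by (auto simp: ww_def field_simps split: if_splits)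
  ultimately show ?thesis by blast
qed (simp add: ww_def)

lemma compat_hr: "compat hr"
  unfolding compat_def
proof (intro allI impI)
  fix X Y :: "real ^ 3" assume "\<forall>i. \<bar>X $ i\<bar> < 3/4 \<and> \<bar>Y $ i\<bar> < 3/4 \<and> X $ i - Y $ i \<in> \<int>"
  then show "hr X = hr Y" using compat_horizontal[of X Y] by (auto simp: hr_def)
qed

lemma compat_al: "compat (\<lambda>X. al (uu X) (ss X))"
  unfolding compat_def
proof (intro allI impI)
  fix X Y :: "real ^ 3" assume "\<forall>i. \<bar>X $ i\<bar> < 3/4 \<and> \<bar>Y $ i\<bar> < 3/4 \<and> X $ i - Y $ i \<in> \<int>"
  then show "al (uu X) (ss X) = al (uu Y) (ss Y)" using compat_horizontal[of X Y] by auto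
qed

lemma compat_ha: "compat ha"
  unfolding compat_def
proof (intro allI impI)
  fix X Y :: "real ^ 3" assume A: "\<forall>i. \<bar>X $ i\<bar> < 3/4 \<and> \<bar>Y $ i\<bar> < 3/4 \<and> X $ i - Y $ i \<in> \<int>"
  have "al (uu X) (ss X) = al (uu Y) (ss Y)" using compat_horizontal[of X Y] A by auto
  then show "ha X = ha Y"
    using compat_vertical[of X Y] A phi_hi[of "ww X"] phi_hi[of "ww Y"] chi_hi[of "ww X"] chi_hi[of "ww Y"]
    by (auto simp: ha_def)
qed

lemma compat_hp: "compat hp"
  unfolding compat_def
proof (intro allI impI)
  fix X Y :: "real ^ 3" assume A: "\<forall>i. \<bar>X $ i\<bar> < 3/4 \<and> \<bar>Y $ i\<bar> < 3/4 \<and> X $ i - Y $ i \<in> \<int>"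
  have "hr X = hr Y" using compat_horizontal[of X Y] A by (auto simp: hr_def)
  then show "hp X = hp Y"
    using compat_vertical[of X Y] A lens_hi(3)[of "hr X" "ww X"] lens_hi(3)[of "hr Y" "ww Y"]
      hr_bounds[of X] hr_bounds[of Y]
    by (auto simp: hp_def)
qed

lemma continuous_profiles [continuous_intros]:
  fixes f :: "'a::topological_space \<Rightarrow> real"
  assumes "continuous_on S f"
  shows "continuous_on S (\<lambda>x. dpsi0 (f x))" "continuous_on S (\<lambda>x. dphi (f x))"
    "continuous_on S (\<lambda>x. chi (f x))" "continuous_on S (\<lambda>x. dchi (f x))"
    "continuous_on S (\<lambda>x. H (f x))" "continuous_on S (\<lambda>x. dH (f x))"
    "continuous_on S (\<lambda>x. K (f x))" "continuous_on S (\<lambda>x. dK (f x))" "continuous_on S (\<lambda>x. dPP (f x))"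
  unfolding dpsi0_def dphi_def chi_def dchi_def H_def dH_def K_def dK_def dPP_def
  by (auto intro!: continuous_intros assms)

lemma continuous_on_hr: "continuous_on UNIV hr"
  using has_derivative_hr has_derivative_continuous_on by (metis has_derivative_at_withinI)

lemma continuous_Dhr: "continuous_on UNIV (\<lambda>X. Dhr X v)"
  unfolding Dhr_def rf_u_def rf_s_def qq_def by (intro continuous_intros) (auto simp: nu_def)

lemma continuous_Dha: "continuous_on UNIV (\<lambda>X. Dha X v)"
  unfolding Dha_def ha_w_def al_def al_u_def al_s_def dg_def by (intro continuous_intros)

lemma continuous_Dhp: "continuous_on UNIV (\<lambda>X. Dhp X v)"
proof -
  have "hr X + Rc \<noteq> 0" for X using hr_bounds[of X] Rc_pos by simp
  then show ?thesis
    unfolding Dhp_def cpsih_def dpsih_def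
    by (intro continuous_intros continuous_on_hr continuous_Dhr) auto
qed

section \<open>The lifted map and its derivative\<close>

definition Alin :: "real ^ 3 \<Rightarrow> real ^ 3" where "Alin X = vector [X $ 2, - (X $ 1) + 10 * X $ 2, X $ 3]"

lemma coords_Alin [simp]: "uu (Alin X) = mu * uu X" "ss (Alin X) = lam * ss X" "ww (Alin X) = ww X"
proof -
  have l: "lam = 10 - mu" using mu_lam by simp
  have e: "mu * (X $ 2 - lam * X $ 1) = mu * X $ 2 - X $ 1" "lam * (mu * X $ 1 - X $ 2) = X $ 1 - lam * X $ 2"
    using mu_lam by (simp_all add: right_diff_distrib mult.assoc[symmetric] mult.commute[of lam mu])
  have 1: "- (X $ 1) + 10 * X $ 2 - lam * X $ 2 = mu * (X $ 2 - lam * X $ 1)"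
    unfolding e by (simp add: l algebra_simps)
  have 2: "mu * X $ 2 - (- (X $ 1) + 10 * X $ 2) = lam * (mu * X $ 1 - X $ 2)"
    unfolding e by (simp add: l algebra_simps)
  show "uu (Alin X) = mu * uu X" "ss (Alin X) = lam * ss X" "ww (Alin X) = ww X"
    unfolding uu_def ss_def ww_def Alin_def by (simp_all add: 1[simplified] 2[simplified])
qed

lemma Alin_Ints: "(\<And>i. X $ i - Y $ i \<in> \<int>) \<Longrightarrow> Alin X $ i - Alin Y $ i \<in> \<int>"
proof -
  assume A: "\<And>i. X $ i - Y $ i \<in> \<int>"
  have "Alin X $ 2 - Alin Y $ 2 = - (X $ 1 - Y $ 1) + 10 * (X $ 2 - Y $ 2)"
    by (simp add: Alin_def)
  also have "\<dots> \<in> \<int>" using A by (intro Ints_add Ints_minus Ints_mult) auto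
  finally show ?thesis using A exhaust_3[of i] by (auto simp: Alin_def)
qed

text \<open>Periodic extensions of the displacements and of the bump; \<open>aa\<close> is the
  horizontal perturbation without the vertical cutoff, which drives \<open>G\<close>.
  \<open>wb\<close> is the height modulo 117, and \<open>wa\<close> is its distance from the zero
  level.\<close>

definition pa :: "real ^ 3 \<Rightarrow> real" where "pa X = ha (rd X)"
definition pp :: "real ^ 3 \<Rightarrow> real" where "pp X = hp (rd X)"
definition rr :: "real ^ 3 \<Rightarrow> real" where "rr X = hr (rd X)"
definition aa :: "real ^ 3 \<Rightarrow> real" where "aa X = al (uu (rd X)) (ss (rd X))"
definition wb :: "real ^ 3 \<Rightarrow> real" where "wb X = ww (rd X)"
definition wa :: "real ^ 3 \<Rightarrow> real" where "wa X = \<bar>wb X\<bar>"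

definition F :: "real ^ 3 \<Rightarrow> real ^ 3" where "F X = Alin X + pa X *\<^sub>R eu + pp X *\<^sub>R ew"

text \<open>Entries of the derivative in the basis \<open>eu\<close>, \<open>es\<close>,
  \<open>ew\<close>: the rows are (\<open>fa\<close>, \<open>fp\<close>, \<open>fb\<close>), (0,
  \<open>lam\<close>, 0) and (\<open>fc\<close>, \<open>fq\<close>, \<open>fd\<close>). The plane of
  \<open>eu\<close> and \<open>ew\<close> is invariant, and it will carry the center and unstable
  directions.\<close>

definition fa :: "real ^ 3 \<Rightarrow> real" where "fa X = mu + chi (wb X) * al_u (uu (rd X)) (ss (rd X))"
definition fp :: "real ^ 3 \<Rightarrow> real" where "fp X = chi (wb X) * al_s (uu (rd X)) (ss (rd X))"
definition fb :: "real ^ 3 \<Rightarrow> real" where "fb X = ha_w (rd X)"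
definition fc :: "real ^ 3 \<Rightarrow> real" where "fc X = cpsih (rr X) (wb X) * rf_u (uu (rd X)) (ss (rd X))"
definition fq :: "real ^ 3 \<Rightarrow> real" where "fq X = cpsih (rr X) (wb X) * rf_s (uu (rd X)) (ss (rd X))"
definition fd :: "real ^ 3 \<Rightarrow> real" where "fd X = dpsih (rr X) (wb X)"

definition DF :: "real ^ 3 \<Rightarrow> real ^ 3 \<Rightarrow> real ^ 3" where
  "DF X v = (fa X * uu v + fp X * ss v + fb X * ww v) *\<^sub>R eu + (lam * ss v) *\<^sub>R es
     + (fc X * uu v + fq X * ss v + fd X * ww v) *\<^sub>R ew"

lemma coords_F [simp]: "uu (F X) = mu * uu X + pa X" "ss (F X) = lam * ss X" "ww (F X) = ww X + pp X"
  by (simp_all add: F_def)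

lemma coords_DF [simp]: "uu (DF X v) = fa X * uu v + fp X * ss v + fb X * ww v" "ss (DF X v) = lam * ss v"
  "ww (DF X v) = fc X * uu v + fq X * ss v + fd X * ww v"
  by (simp_all add: DF_def)

lemma Alin_eq: "Alin X = (mu * uu X) *\<^sub>R eu + (lam * ss X) *\<^sub>R es + ww X *\<^sub>R ew"
  by (rule coords_eqI) simp_all

lemma has_derivative_F: "(F has_derivative DF X) (at X)"
proof -
  have 1: "(pa has_derivative Dha (rd X)) (at X)" "(pp has_derivative Dhp (rd X)) (at X)"
    unfolding pa_def[abs_def] pp_def[abs_def]
    by (intro has_derivative_rd compat_ha compat_hp has_derivative_ha has_derivative_hp)+
  have "((\<lambda>X. (mu * uu X + pa X) *\<^sub>R eu + (lam * ss X) *\<^sub>R es + (ww X + pp X) *\<^sub>R ew) has_derivative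
    (\<lambda>v. (mu * uu v + Dha (rd X) v) *\<^sub>R eu + (lam * ss v) *\<^sub>R es + (ww v + Dhp (rd X) v) *\<^sub>R ew)) (at X)"
    by (intro has_derivative_add has_derivative_scaleR_left has_derivative_mult_right 1
        bounded_linear.has_derivative[OF bounded_linear_coords(1)]
        bounded_linear.has_derivative[OF bounded_linear_coords(2)]
        bounded_linear.has_derivative[OF bounded_linear_coords(3)] has_derivative_ident)
  moreover have "(\<lambda>X. (mu * uu X + pa X) *\<^sub>R eu + (lam * ss X) *\<^sub>R es + (ww X + pp X) *\<^sub>R ew) = F"
    by (simp add: F_def Alin_eq fun_eq_iff algebra_simps)
  moreover have "(\<lambda>v. (mu * uu v + Dha (rd X) v) *\<^sub>R eu + (lam * ss v) *\<^sub>R es + (ww v + Dhp (rd X) v) *\<^sub>R ew) = DF X"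
    by (auto simp: fun_eq_iff intro!: coords_eqI)
       (simp_all add: Dha_def Dhp_def Dhr_def fa_def fb_def fc_def fd_def fp_def fq_def rr_def wb_def algebra_simps)
  ultimately show ?thesis by simp
qed

lemma continuous_coeffs: "continuous_on S fa" "continuous_on S fb" "continuous_on S fc"
  "continuous_on S fd" "continuous_on S fp" "continuous_on S fq"
proof -
  have a: "continuous_on UNIV (\<lambda>X. Dha (rd X) v)" for v
    by (intro continuous_deriv_rd[OF compat_ha has_derivative_ha] continuous_Dha)
  have p: "continuous_on UNIV (\<lambda>X. Dhp (rd X) v)" for v
    by (intro continuous_deriv_rd[OF compat_hp has_derivative_hp] continuous_Dhp)
  have e: "fa = (\<lambda>X. mu + Dha (rd X) eu)" "fb = (\<lambda>X. Dha (rd X) ew)" "fp = (\<lambda>X. Dha (rd X) es)"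
    "fc = (\<lambda>X. Dhp (rd X) eu)" "fq = (\<lambda>X. Dhp (rd X) es)" "fd = (\<lambda>X. 1 + Dhp (rd X) ew)"
    by (simp_all add: fun_eq_iff Dha_def Dhp_def Dhr_def fa_def fb_def fc_def fd_def fp_def fq_def rr_def wb_def)
  have "continuous_on UNIV fa" "continuous_on UNIV fd"
    unfolding e by (intro continuous_on_add continuous_on_const a p)+
  moreover have "continuous_on UNIV fb" "continuous_on UNIV fc" "continuous_on UNIV fp" "continuous_on UNIV fq"
    unfolding e by (rule a p)+
  ultimately show "continuous_on S fa" "continuous_on S fb" "continuous_on S fc"
    "continuous_on S fd" "continuous_on S fp" "continuous_on S fq"
    using continuous_on_subset by blast+
qed

lemma continuous_F: "continuous_on S F"
  by (intro continuous_at_imp_continuous_on ballI has_derivative_continuous[OF has_derivative_F])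

lemma compat_coeff_rd:
  assumes "\<And>i. (X $ i - Y $ i :: real) \<in> \<int>"
  shows "pa X = pa Y" "pp X = pp Y" "rr X = rr Y" "aa X = aa Y"
  unfolding pa_def pp_def rr_def aa_def
  using compat_rd[OF compat_ha assms] compat_rd[OF compat_hp assms] compat_rd[OF compat_hr assms]
    compat_rd[OF compat_al assms] by simp_all

lemma lattice_map_F: "lattice_map F"
  unfolding lattice_map_def
proof (intro allI impI)
  fix X Y :: "real ^ 3" and i assume "\<forall>i. X $ i - Y $ i \<in> \<int>"
  then show "F X $ i - F Y $ i \<in> \<int>"
    using Alin_Ints[of X Y i] compat_coeff_rd[of X Y] by (simp add: F_def)
qed

lemma pj_F: "torus_proj X = torus_proj Y \<Longrightarrow> torus_proj (F X) = torus_proj (F Y)"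
  using lattice_map_F by (auto simp: torus_proj_eq_iff lattice_map_def)

text \<open>Both sides are the derivative of the induced torus map at the same point, and that
  derivative is unique.\<close>

lemma DF_proj:
  assumes "torus_proj X = torus_proj Y"
  shows "DF X = DF Y"
proof -
  have "\<And>i. X $ i - Y $ i \<in> \<int>" using assms by (simp add: torus_proj_eq_iff)
  then show ?thesis
    using torus_deriv_torus_map[OF lattice_map_F has_derivative_F] assms by metis
qed

lemma coeffs_DF: "fa X = uu (DF X eu)" "fb X = uu (DF X ew)" "fp X = uu (DF X es)"
  "fc X = ww (DF X eu)" "fd X = ww (DF X ew)" "fq X = ww (DF X es)"
  by simp_all

lemma coeffs_proj:
  assumes "torus_proj X = torus_proj Y"
  shows "fa X = fa Y" "fb X = fb Y" "fp X = fp Y" "fc X = fc Y" "fd X = fd Y" "fq X = fq Y"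
  unfolding coeffs_DF DF_proj[OF assms] by rule+

subsection \<open>The vertical coordinate\<close>

lemma wb_bound: "wa X \<le> 117/2"
  using rd_bound[of X 3] by (simp add: wa_def wb_def ww_def abs_mult)

text \<open>At half-integers \<open>round\<close> may pick the other neighbour and flip the sign of
  the reduced coordinate, but not its modulus. Hence regions are described by \<open>wa\<close>, and
  facts about \<open>wb\<close> exclude the antipode.\<close>

lemma round_shift:
  fixes y :: real
  assumes "\<bar>y\<bar> \<le> 1/2"
  shows "\<bar>y + of_int n - of_int (round (y + of_int n))\<bar> = \<bar>y\<bar>"
    "\<bar>y\<bar> < 1/2 \<Longrightarrow> y + of_int n - of_int (round (y + of_int n)) = y"
proof -
  have *: "round (y + of_int n) = n" if "\<bar>y\<bar> < 1/2"
    using that by (intro round_unique') simp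
  then show "\<bar>y\<bar> < 1/2 \<Longrightarrow> y + of_int n - of_int (round (y + of_int n)) = y" by simp
  show "\<bar>y + of_int n - of_int (round (y + of_int n))\<bar> = \<bar>y\<bar>"
  proof (cases "\<bar>y\<bar> < 1/2")
    case True then show ?thesis using * by simp
  next
    case False
    then have "y = 1/2 \<or> y = - 1/2" using assms by linarith
    then show ?thesis
    proof
      assume y: "y = 1/2"
      have "y + of_int n + 1/2 = of_int (n + 1)" using y by simp
      then have e: "round (y + of_int n) = n + 1" by (simp only: round_def floor_of_int)
      show ?thesis unfolding e using y by simp
    next
      assume y: "y = - 1/2"
      have "round (y + of_int n) = n" using y by (simp add: round_def)
      then show ?thesis using y by simp
    qed
  qed
qed

lemma wb_shift:
  assumes "ww X = v + 117 * of_int n" "\<bar>v\<bar> \<le> 117/2"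
  shows "wa X = \<bar>v\<bar>" "\<bar>v\<bar> < 117/2 \<Longrightarrow> wb X = v"
proof -
  have X3: "X $ 3 = v / 117 + of_int n" using assms by (simp add: ww_def)
  have e: "wb X = 117 * (v / 117 + of_int n - of_int (round (v / 117 + of_int n)))"
    by (simp add: wb_def ww_def rd_def rn_def X3)
  show "wa X = \<bar>v\<bar>"
    using round_shift(1)[of "v / 117" n] assms unfolding wa_def e by (simp only: abs_mult)
  show "\<bar>v\<bar> < 117/2 \<Longrightarrow> wb X = v"
    using round_shift(2)[of "v / 117" n] unfolding e by simp
qed

lemma ww_wb: obtains n :: int where "ww X = wb X + 117 * of_int n"
proof -
  have "rn X $ 3 = of_int (round (X $ 3))" by (simp add: rn_def)
  then have "ww X = wb X + 117 * of_int (round (X $ 3))" by (simp add: wb_def ww_def rd_def)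
  then show thesis by (rule that)
qed

lemma wa_proj: assumes "torus_proj X = torus_proj Y"
  shows "wa X = wa Y" "wa X < 117/2 \<Longrightarrow> wb X = wb Y"
proof -
  have "X $ 3 - Y $ 3 \<in> \<int>" using assms by (simp add: torus_proj_eq_iff)
  then obtain n where "X $ 3 = Y $ 3 + of_int n" by (auto elim!: Ints_cases simp: algebra_simps)
  moreover obtain m where "ww Y = wb Y + 117 * of_int m" by (rule ww_wb)
  ultimately have *: "ww X = wb Y + 117 * of_int (n + m)" by (simp add: ww_def)
  show 1: "wa X = wa Y" using wb_shift(1)[OF *] wb_bound[of Y] by (simp add: wa_def)
  show "wa X < 117/2 \<Longrightarrow> wb X = wb Y" using wb_shift(2)[OF *] wb_bound[of Y] 1 by (simp add: wa_def)
qed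

lemma rr_bounds: "0 \<le> rr X" "rr X \<le> 19 * Rc"
  using hr_bounds by (auto simp: rr_def)

lemma psih_values:
  assumes "0 \<le> r" "r \<le> 19 * Rc"
  shows "psih r 0 = 0" "psih r (1/2) = 10" "psih r 1 = 20" "psih r (95/100) = 19" "psih r 20 = 157/4" "psih r (117/2) = 117/2"
  using assms psih_minus[of r 0] by (simp_all add: lens_hi psi0_lo psi0_hi)

lemma psih_mono: "0 \<le> r \<Longrightarrow> r \<le> 19 * Rc \<Longrightarrow> v \<le> w \<Longrightarrow> psih r v \<le> psih r w"
  using psih_strict_mono[of r v w] by (cases "v = w") auto

text \<open>The fibre map \<open>psih\<close> is odd, monotone and fixes \<open>117/2\<close> for
  every admissible bump value, so it acts on the interval from 0 to \<open>117/2\<close>.\<close>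

lemma wa_F: "wa (F X) = psih (rr X) (wa X)"
  and wb_F: "wa X < 117/2 \<Longrightarrow> wb (F X) = psih (rr X) (wb X)"
proof -
  have r: "0 \<le> rr X" "rr X \<le> 19 * Rc" using rr_bounds by auto
  obtain n where n: "ww X = wb X + 117 * of_int n" by (rule ww_wb)
  have *: "ww (F X) = psih (rr X) (wb X) + 117 * of_int n"
    by (simp add: n pp_def hp_def rr_def wb_def[symmetric])
  have abs: "\<bar>psih (rr X) (wb X)\<bar> = psih (rr X) (wa X)"
    using psih_minus[of "rr X" "wb X"] psih_mono[OF r, of 0 "wa X"] psih_values[OF r]
    by (auto simp: wa_def abs_if split: if_splits)
  have le: "psih (rr X) (wa X) \<le> 117/2" using psih_mono[OF r wb_bound] psih_values[OF r] by simp
  show "wa (F X) = psih (rr X) (wa X)" using wb_shift(1)[OF *] abs le by simp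
  assume "wa X < 117/2"
  then have "psih (rr X) (wa X) < 117/2" using psih_strict_mono[OF r] psih_values[OF r] by metis
  then show "wb (F X) = psih (rr X) (wb X)" using wb_shift(2)[OF *] abs le by simp
qed

lemma wa_nonneg: "0 \<le> wa X" by (simp add: wa_def)

text \<open>All listed heights lie above the lens, where the fibre maps do not depend on the bump.
  Monotonicity then makes the regions between them common to all fibres; from 1/2 to 10 and from 20
  to 157/4 they form fundamental domains.\<close>

lemma wa_F_less_iff:
  assumes "c \<in> {(1/2, 10), (1, 20), (95/100, 19), (20, 157/4)}"
  shows "wa (F X) < snd c \<longleftrightarrow> wa X < fst c" "wa (F X) \<le> snd c \<longleftrightarrow> wa X \<le> fst c"
proof -
  have r: "0 \<le> rr X" "rr X \<le> 19 * Rc" using rr_bounds by auto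
  have "snd c = psih (rr X) (fst c)" using assms psih_values[OF r] by auto
  then show "wa (F X) < snd c \<longleftrightarrow> wa X < fst c" "wa (F X) \<le> snd c \<longleftrightarrow> wa X \<le> fst c"
    unfolding wa_F using psih_strict_mono[OF r] psih_mono[OF r]
    by (metis less_le_not_le not_le_imp_less)+
qed

lemmas wa_F_iff = wa_F_less_iff[of "(1/2, 10)", simplified] wa_F_less_iff[of "(1, 20)", simplified]
  wa_F_less_iff[of "(95/100, 19)", simplified] wa_F_less_iff[of "(20, 157/4)", simplified]

lemma sgn_wb_F:
  assumes "wa X < 117/2" shows "sgn (wb (F X)) = sgn (wb X)"
proof -
  have r: "0 \<le> rr X" "rr X \<le> 19 * Rc" using rr_bounds by auto
  show ?thesis
    using psih_strict_mono[OF r, of 0 "wb X"] psih_strict_mono[OF r, of "wb X" 0] psih_values[OF r]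
    unfolding wb_F[OF assms] by (cases "wb X" "0::real" rule: linorder_cases) auto
qed

text \<open>Up to the factor 117 this is the distance of a coordinate to the nearest integer, a
  Lipschitz function even where \<open>wb\<close> jumps.\<close>

lemma continuous_wa: "continuous_on S wa"
proof -
  have wa: "wa X = 117 * \<bar>X $ 3 - of_int (round (X $ 3))\<bar>" for X
    by (simp only: wa_def wb_def ww_def rd_def rn_def abs_mult vector_minus_component vec_lambda_beta abs_numeral)
  have le: "wa X \<le> wa Y + 117 * \<bar>X $ 3 - Y $ 3\<bar>" for X Y
    using round_diff_minimal[of "X $ 3" "round (Y $ 3)"]
      abs_triangle_ineq[of "X $ 3 - Y $ 3" "Y $ 3 - of_int (round (Y $ 3))"] unfolding wa by simp
  show ?thesis
  proof (rule continuous_at_imp_continuous_on, rule ballI)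
    fix X :: "real ^ 3"
    have "((\<lambda>Y. 117 * \<bar>Y $ 3 - X $ 3\<bar>) \<longlongrightarrow> 117 * \<bar>X $ 3 - X $ 3\<bar>) (at X)"
      by (intro tendsto_intros)
    then have *: "((\<lambda>Y. 117 * \<bar>Y $ 3 - X $ 3\<bar>) \<longlongrightarrow> 0) (at X)" by simp
    have "norm (wa Y - wa X) \<le> 117 * \<bar>Y $ 3 - X $ 3\<bar>" for Y
      using le[of X Y] le[of Y X] by (simp add: abs_minus_commute abs_le_iff)
    then have "((\<lambda>Y. wa Y - wa X) \<longlongrightarrow> 0) (at X)"
      by (intro Lim_null_comparison[OF _ *]) simp
    then show "isCont wa X" by (simp add: isCont_def LIM_zero_iff)
  qed
qed

subsection \<open>Bounds on the derivative\<close>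

lemma fa_bounds: "1/3 \<le> fa X" "fa X \<le> 18"
proof -
  define c where "c = chi (wb X)"
  define x where "x = al_u (uu (rd X)) (ss (rd X))"
  have c: "0 \<le> c" "c \<le> 1" using chi_bounds by (auto simp: c_def)
  have x: "- kk \<le> x" "x \<le> 4/5 * kk" using al_u_bounds by (auto simp: x_def)
  have "c * x \<le> c * (4/5 * kk)" "c * (- kk) \<le> c * x" using c x by (intro mult_left_mono; simp)+
  moreover have "c * (4/5 * kk) \<le> 1 * (4/5 * kk)" "c * kk \<le> 1 * kk"
    using c kk_bounds by (intro mult_right_mono; simp)+
  ultimately have "c * x \<le> 8" and "- kk \<le> c * x" using kk_bounds by linarith+
  then show "1/3 \<le> fa X" "fa X \<le> 18"
    using mu_bounds unfolding fa_def c_def[symmetric] x_def[symmetric] by (auto simp: kk_def)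
qed

lemma fa_hi: "1 \<le> wa X \<Longrightarrow> fa X = mu" by (simp add: fa_def chi_hi wa_def)

lemma chi_wa: "chi (wb X) = chi (wa X)"
  using chi_minus[of "wb X"] by (simp add: wa_def abs_if)

text \<open>At 95/100 the cutoff has almost died. The general bound 18 would be too weak for the
  slope estimate \<open>x2_lower\<close> on the last bit of the ramp.\<close>

lemma fa_near: assumes "95/100 \<le> wa X" shows "fa X \<le> 102/10"
proof (cases "1 \<le> wa X")
  case True then show ?thesis using mu_bounds by (simp add: fa_hi)
next
  case False
  define x where "x = al_u (uu (rd X)) (ss (rd X))"
  have x: "x \<le> 8" using al_u_bounds(2)[of "uu (rd X)" "ss (rd X)"] kk_bounds unfolding x_def by simp
  have "chi (wa X) = 8 * (1 - wa X)\<^sup>2" using False assms by (intro chi_mid) auto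
  moreover have "(1 - wa X)\<^sup>2 \<le> (5/100)\<^sup>2" using False assms by (intro power_mono) auto
  ultimately have c: "chi (wa X) \<le> 2/100" by (simp add: power2_eq_square)
  have "chi (wa X) * x \<le> chi (wa X) * 8" using x chi_bounds by (intro mult_left_mono) auto
  then show ?thesis using c mu_bounds unfolding fa_def chi_wa x_def[symmetric] by simp
qed

text \<open>On the support of the bump \<open>80 * u\<close> and \<open>80 * s\<close> are below
  \<open>160 * nu = 4/100\<close>, where \<open>K\<close> and \<open>dg\<close> are nearly 1; so all
  these quantities are close to \<open>mu - kk = 1/3\<close>.\<close>

lemma contraction_factor:
  assumes "0 < rf u s"
  shows "0 \<le> mu - kk * K (80 * u) * K (80 * s)" "mu - kk * K (80 * u) * K (80 * s) \<le> 1/2"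
    "mu + al_u u s \<le> 1/2"
proof -
  define y z where "y = 80 * u" and "z = 80 * s"
  have yz: "\<bar>y\<bar> \<le> 4/100" "\<bar>z\<bar> \<le> 4/100"
    using rf_pos_small[OF assms] by (auto simp: y_def z_def nu_def)
  have "y\<^sup>2 \<le> (4/100)\<^sup>2" "z\<^sup>2 \<le> (4/100)\<^sup>2"
    using yz by (metis power2_abs power_mono abs_ge_zero)+
  then have sq: "y\<^sup>2 \<le> 16/10000" "z\<^sup>2 \<le> 16/10000" by (auto simp: power2_eq_square)
  have "(1 - 16/10000)\<^sup>2 \<le> (1 - y\<^sup>2)\<^sup>2" "(1 - 16/10000)\<^sup>2 \<le> (1 - z\<^sup>2)\<^sup>2"
    using sq by (intro power_mono; simp)+
  then have K: "996/1000 \<le> K y" "996/1000 \<le> K z" using yz by (auto simp: K_in power2_eq_square)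
  have "(1 - 16/10000) * (1 - 5 * (16/10000)) \<le> (1 - y\<^sup>2) * (1 - 5 * y\<^sup>2)"
    using sq by (intro mult_mono) auto
  then have g: "990/1000 \<le> dg y" using yz by (simp add: dg_in)
  have "990/1000 * (996/1000) \<le> K y * K z" "990/1000 * (996/1000) \<le> dg y * K z"
    using K g by (intro mult_mono; simp)+
  moreover have "K y * K z \<le> 1 * 1" using K_bounds by (intro mult_mono) auto
  ultimately have "kk * (986/1000) \<le> kk * (K y * K z)" "kk * (986/1000) \<le> kk * (dg y * K z)"
    "kk * (K y * K z) \<le> kk * 1"
    using kk_bounds by (intro mult_left_mono; simp)+
  moreover have "mu = kk + 1/3" by (simp add: kk_def)
  ultimately have "0 \<le> mu - kk * (K y * K z)" and "mu - kk * (K y * K z) \<le> 1/2"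
    and "mu - kk * (dg y * K z) \<le> 1/2"
    using kk_bounds by linarith+
  then show "0 \<le> mu - kk * K (80 * u) * K (80 * s)" "mu - kk * K (80 * u) * K (80 * s) \<le> 1/2"
    "mu + al_u u s \<le> 1/2"
    by (simp_all add: y_def z_def mult.assoc al_u_def)
qed

lemma fa_lens: "0 < rr X \<Longrightarrow> wa X \<le> 1/2 \<Longrightarrow> fa X \<le> 1/2"
  using contraction_factor(3) by (auto simp: rr_def hr_def fa_def wa_def chi_lo)

lemma fp_bound: "\<bar>fp X\<bar> \<le> 7"
proof -
  have "\<bar>fp X\<bar> = chi (wb X) * \<bar>al_s (uu (rd X)) (ss (rd X))\<bar>"
    using chi_bounds by (simp add: fp_def abs_mult)
  also have "\<dots> \<le> 1 * 7" using chi_bounds al_s_bound by (intro mult_mono) auto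
  finally show ?thesis by simp
qed

text \<open>The shear coefficient stripped of the sign of the height. It includes the derivative of
  the cutoff.\<close>

definition fbp :: "real ^ 3 \<Rightarrow> real" where "fbp X = dchi (wa X) * aa X + dphi (wa X)"

lemma fb_eq: "fb X = sgn (wb X) * fbp X"
  using dchi_minus[of "wb X"] dphi_minus[of "wb X"] dchi_lo[of 0] dphi_lo[of 0]
  by (cases "wb X" "0::real" rule: linorder_cases)
    (auto simp: fb_def ha_w_def fbp_def wa_def aa_def wb_def[symmetric])

lemma fbp_lo: "wa X \<le> 1/2 \<Longrightarrow> fbp X = 0"
  using wa_nonneg[of X] by (simp add: fbp_def dchi_lo dphi_lo)

lemma fbp_mid: "1 \<le> wa X \<Longrightarrow> wa X \<le> 19 \<Longrightarrow> fbp X = mu"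
  and fbp_end: "19 \<le> wa X \<Longrightarrow> wa X \<le> 20 \<Longrightarrow> fbp X = mu * (20 - wa X)"
  and fbp_hi: "20 \<le> wa X \<Longrightarrow> fbp X = 0"
  by (simp_all add: fbp_def dchi_hi dphi_pos)

text \<open>The cutoff contributes at most \<open>8 * (5/100)\<close> times
  \<open>2 * wa X - 1\<close>, the shear at least \<open>98/10\<close> times the same ramp, so the
  sign of the shear survives.\<close>

lemma fbp_start:
  assumes "1/2 \<le> wa X" "wa X \<le> 1"
  shows "94/10 * (2 * wa X - 1) \<le> fbp X" "fbp X \<le> 103/10 * (2 * wa X - 1)"
proof -
  have "\<bar>dchi (wa X) * aa X\<bar> \<le> (8 * (2 * wa X - 1)) * (5/100)"
    unfolding abs_mult using chi_mid(4,5)[OF assms] al_bound assms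
    by (intro mult_mono) (auto simp: aa_def)
  moreover have "dphi (wa X) = mu * (2 * wa X - 1)" using assms by (simp add: dphi_pos)
  moreover have "98/10 * (2 * wa X - 1) \<le> mu * (2 * wa X - 1)" "mu * (2 * wa X - 1) \<le> 99/10 * (2 * wa X - 1)"
    using mu_bounds assms by (intro mult_right_mono; simp)+
  ultimately show "94/10 * (2 * wa X - 1) \<le> fbp X" "fbp X \<le> 103/10 * (2 * wa X - 1)"
    unfolding fbp_def by linarith+
qed

lemma fbp_nonneg: "0 \<le> fbp X" and fbp_le: "fbp X \<le> 11"
proof -
  have "0 \<le> fbp X \<and> fbp X \<le> 11"
  proof -
    consider "wa X \<le> 1/2" | "1/2 \<le> wa X" "wa X \<le> 1" | "1 \<le> wa X" "wa X \<le> 19"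
      | "19 \<le> wa X" "wa X \<le> 20" | "20 \<le> wa X" by linarith
    then show ?thesis
    proof cases
      case 2 then show ?thesis using fbp_start[OF 2] by auto
    next
      case 4
      then have "mu * (20 - wa X) \<le> mu * 1" using mu_bounds by (intro mult_left_mono) auto
      moreover have "0 \<le> mu * (20 - wa X)" using 4 mu_bounds by simp
      ultimately show ?thesis unfolding fbp_end[OF 4] using mu_bounds by linarith
    qed (use mu_bounds in \<open>auto simp: fbp_lo fbp_mid fbp_hi\<close>)
  qed
  then show "0 \<le> fbp X" "fbp X \<le> 11" by auto
qed

lemma fbp_pos: "1/2 < wa X \<Longrightarrow> wa X < 20 \<Longrightarrow> 0 < fbp X"
  using fbp_start[of X] mu_bounds
  by (cases "wa X \<le> 1"; cases "wa X \<le> 19") (auto simp: fbp_mid fbp_end)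

lemma fc_zero: "1/2 \<le> wa X \<Longrightarrow> fc X = 0" "rr X = 0 \<Longrightarrow> fc X = 0"
  using lens_hi(5)[OF rr_bounds[of X], of "wb X"] rf_deriv_zero
  by (auto simp: fc_def wa_def rr_def hr_def)

lemma fc_bound: "\<bar>fc X\<bar> \<le> 9/100"
proof -
  have "\<bar>fc X\<bar> \<le> 5 * (17/1000)"
    unfolding fc_def abs_mult using cpsih_bound rr_bounds rf_u_bound by (intro mult_mono) auto
  then show ?thesis by simp
qed

lemma fd_hi: "1/2 \<le> wa X \<Longrightarrow> fd X = dpsi0 (wb X)"
  using lens_hi(4)[OF rr_bounds[of X], of "wb X"] by (simp add: fd_def wa_def)

lemma fd_20: "1/2 \<le> wa X \<Longrightarrow> wa X \<le> 1 \<Longrightarrow> fd X = 20" "rr X = 0 \<Longrightarrow> wa X \<le> 1 \<Longrightarrow> fd X = 20"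
  by (simp_all add: fd_hi wa_def dpsi0_lo) (simp add: fd_def psih_0 dpsi0_lo)

lemma fd_half: "2 \<le> wa X \<Longrightarrow> fd X = 1/2"
  by (simp add: fd_hi dpsi0_hi wa_def)

lemma fd_le: "1/2 \<le> wa X \<Longrightarrow> fd X \<le> 20" and fd_ge: "1/2 \<le> fd X"
  using dpsi0_bounds(2) fd_hi[of X] dpsih_pos[OF rr_bounds[of X], of "wb X"] by (simp_all add: fd_def)

lemma fd_lens: "wa X \<le> 1 \<Longrightarrow> 9/10 \<le> fd X"
  "wa X \<le> 1 \<Longrightarrow> rr X + Rc \<le> 20 * wa X \<Longrightarrow> 20 \<le> fd X"
  using dpsih_lens[OF rr_bounds[of X], of "wb X"] by (auto simp: fd_def wa_def)

text \<open>Either the bump vanishes and the ratio is at most 18/20, or it is active and the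
  horizontal derivative is at most 1/2 against a vertical one of at least 9/10. This is the
  contraction rate behind \<open>th\<close>.\<close>

lemma ratio_lens: "wa X \<le> 1/2 \<Longrightarrow> fa X / fd X \<le> 9/10"
proof -
  assume w: "wa X \<le> 1/2"
  show ?thesis
  proof (cases "rr X = 0")
    case True
    then show ?thesis using w fd_20(2)[OF True] fa_bounds[of X] by simp
  next
    case False
    then have "fa X \<le> 1/2" using w fa_lens rr_bounds[of X] by simp
    then show ?thesis using fd_lens(1)[of X] w by (simp add: field_simps)
  qed
qed

subsection \<open>The map is a diffeomorphism\<close>

text \<open>Shear and lens act at different heights. Hence the block on the plane of
  \<open>eu\<close> and \<open>ew\<close> is triangular at each point, with determinant
  \<open>fa X * fd X\<close>.\<close>

lemma fd_fa_fb_fc: "fb X * fc X = 0"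
  using fc_zero[of X] fbp_lo[of X] by (cases "1/2 \<le> wa X") (auto simp: fb_eq)

definition DFi :: "real ^ 3 \<Rightarrow> real ^ 3 \<Rightarrow> real ^ 3" where
  "DFi X v = ((fd X * (uu v - fp X * (ss v / lam)) - fb X * (ww v - fq X * (ss v / lam))) / (fa X * fd X)) *\<^sub>R eu
    + (ss v / lam) *\<^sub>R es
    + ((fa X * (ww v - fq X * (ss v / lam)) - fc X * (uu v - fp X * (ss v / lam))) / (fa X * fd X)) *\<^sub>R ew"

lemma coords_DFi [simp]:
  "uu (DFi X v) = (fd X * (uu v - fp X * (ss v / lam)) - fb X * (ww v - fq X * (ss v / lam))) / (fa X * fd X)"
  "ss (DFi X v) = ss v / lam"
  "ww (DFi X v) = (fa X * (ww v - fq X * (ss v / lam)) - fc X * (uu v - fp X * (ss v / lam))) / (fa X * fd X)"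
  by (simp_all add: DFi_def)

lemma DFi_DF: "DFi X (DF X v) = v"
proof -
  have nz: "fa X \<noteq> 0" "fd X \<noteq> 0" "lam \<noteq> 0" "fb X * fc X = 0"
    using fa_bounds[of X] fd_ge[of X] lam_bounds fd_fa_fb_fc[of X] by auto
  show "DFi X (DF X v) = v"
    using nz by (intro coords_eqI) (auto simp: field_simps)
qed

lemma continuous_on_of_derivative:
  "(\<And>X. (h has_derivative D X) (at X)) \<Longrightarrow> continuous_on S h"
  by (intro continuous_at_imp_continuous_on ballI has_derivative_continuous)

lemma continuous_coeffs_compose [continuous_intros]:
  assumes "continuous_on S g"
  shows "continuous_on S (\<lambda>x. F (g x))" "continuous_on S (\<lambda>x. fa (g x))" "continuous_on S (\<lambda>x. fb (g x))"
    "continuous_on S (\<lambda>x. fc (g x))" "continuous_on S (\<lambda>x. fd (g x))" "continuous_on S (\<lambda>x. fp (g x))"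
    "continuous_on S (\<lambda>x. fq (g x))" "continuous_on S (\<lambda>x. wa (g x))"
  by (rule continuous_on_compose2[OF _ assms subset_UNIV], rule continuous_F continuous_coeffs continuous_wa)+

lemma bounded_rd:
  assumes "continuous_on UNIV (h :: real ^ 'n::finite \<Rightarrow> real)"
  shows "\<exists>C>0. \<forall>X. \<bar>h (rd X)\<bar> \<le> C"
proof -
  have "compact (h ` cball 0 (real CARD('n)))"
    using assms by (intro compact_continuous_image) (auto intro: continuous_on_subset)
  then obtain C where C: "\<And>Y. Y \<in> cball 0 (real CARD('n)) \<Longrightarrow> norm (h Y) \<le> C" "0 < C"
    using compact_imp_bounded bounded_pos by (metis imageI)
  have "rd X \<in> cball 0 (real CARD('n))" for X :: "real ^ 'n"
  proof -
    have "norm (rd X) \<le> (\<Sum>i\<in>UNIV. \<bar>rd X $ i\<bar>)" by (rule norm_le_l1_cart)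
    also have "\<dots> \<le> (\<Sum>i\<in>(UNIV :: 'n set). 1)"
    proof (rule sum_mono)
      fix i show "\<bar>rd X $ i\<bar> \<le> 1" using rd_bound[of X i] by linarith
    qed
    finally show ?thesis by simp
  qed
  then have "\<bar>h (rd X)\<bar> \<le> C" for X using C(1)[of "rd X"] by simp
  then show ?thesis using C(2) by blast
qed

lemma wb_add [simp]: "wb (X + c *\<^sub>R eu) = wb X" "wa (X + c *\<^sub>R eu) = wa X"
  "wb (X + c *\<^sub>R es) = wb X" "wa (X + c *\<^sub>R es) = wa X"
  by (simp_all add: wa_def wb_def ww_def rd_def rn_def eu_def es_def)

lemma vertical_shift [simp]: "aa (X + c *\<^sub>R ew) = aa X" "rr (X + c *\<^sub>R ew) = rr X"
  by (simp_all add: aa_def rr_def hr_def uu_def ss_def rd_def rn_def ew_def)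

lemma pa_lo: "wa X \<le> 1/2 \<Longrightarrow> pa X = aa X"
  by (simp add: pa_def ha_def aa_def wa_def wb_def chi_lo phi_lo)

lemma pp_hi: "1/2 \<le> wa X \<Longrightarrow> pp X = psi0 (wb X) - wb X"
  using lens_hi(3)[OF hr_bounds[of "rd X"], of "wb X"] by (simp add: pp_def hp_def wa_def wb_def)

lemma F_mono_u: assumes "0 < c" shows "uu (F X) < uu (F (X + c *\<^sub>R eu))"
proof -
  have "((\<lambda>t. uu (F (X + t *\<^sub>R eu))) has_derivative (\<lambda>h. uu (DF (X + t *\<^sub>R eu) (h *\<^sub>R eu)))) (at t)" for t
    by (rule has_derivative_coords(1), rule has_derivative_compose[OF _ has_derivative_F])
       (auto intro!: derivative_eq_intros)
  then have "((\<lambda>t. uu (F (X + t *\<^sub>R eu))) has_real_derivative fa (X + t *\<^sub>R eu)) (at t)" for t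
    unfolding has_field_derivative_def
    by (rule has_derivative_eq_rhs) (simp add: fun_eq_iff)
  then have "uu (F (X + 0 *\<^sub>R eu)) < uu (F (X + c *\<^sub>R eu))"
    using fa_bounds(1) by (intro DERIV_pos_imp_increasing[OF assms]) (metis less_le_trans zero_less_divide_1_iff zero_less_numeral)
  then show ?thesis by simp
qed

lemma F_mono_w: assumes "0 < c" shows "ww (F X) < ww (F (X + c *\<^sub>R ew))"
proof -
  have "((\<lambda>t. ww (F (X + t *\<^sub>R ew))) has_derivative (\<lambda>h. ww (DF (X + t *\<^sub>R ew) (h *\<^sub>R ew)))) (at t)" for t
    by (rule has_derivative_coords(3), rule has_derivative_compose[OF _ has_derivative_F])
       (auto intro!: derivative_eq_intros)
  then have "((\<lambda>t. ww (F (X + t *\<^sub>R ew))) has_real_derivative fd (X + t *\<^sub>R ew)) (at t)" for t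
    unfolding has_field_derivative_def
    by (rule has_derivative_eq_rhs) (simp add: fun_eq_iff)
  then have "ww (F (X + 0 *\<^sub>R ew)) < ww (F (X + c *\<^sub>R ew))"
    using fd_ge by (intro DERIV_pos_imp_increasing[OF assms]) (metis less_le_trans zero_less_divide_1_iff zero_less_numeral)
  then show ?thesis by simp
qed

lemma F_cancel_u: "uu (F (X + c *\<^sub>R eu)) = uu (F X) \<Longrightarrow> c = 0"
  using F_mono_u[of c X] F_mono_u[of "- c" "X + c *\<^sub>R eu"]
  by (cases c "0::real" rule: linorder_cases) (auto simp del: coords_F)

lemma F_cancel_w: "ww (F (X + c *\<^sub>R ew)) = ww (F X) \<Longrightarrow> c = 0"
  using F_mono_w[of c X] F_mono_w[of "- c" "X + c *\<^sub>R ew"]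
  by (cases c "0::real" rule: linorder_cases) (auto simp del: coords_F)

text \<open>Up to height 1/2 the horizontal image does not depend on the height; above it, the
  vertical image does not depend on \<open>uu\<close>. The strictly monotone coordinates are
  cancelled one after the other, in the order suited to the case, which the height of the image
  reveals.\<close>

lemma inj_F: "inj F"
proof (rule injI)
  fix X Y assume e: "F X = F Y"
  define c where "c = uu Y - uu X"
  define d where "d = ww Y - ww X"
  have "ss X = ss Y" using arg_cong[OF e, of ss] lam_bounds by simp
  then have Y: "Y = X + c *\<^sub>R eu + d *\<^sub>R ew"
    by (intro coords_eqI) (simp_all add: c_def d_def)
  have iff: "wa X \<le> 1/2 \<longleftrightarrow> wa Y \<le> 1/2" "wa X < 1/2 \<longleftrightarrow> wa Y < 1/2"
    using wa_F_iff(1,2)[of X] wa_F_iff(1,2)[of Y] e by simp_all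
  show "X = Y"
  proof (cases "wa X \<le> 1/2")
    case True
    then have "uu (F (X + c *\<^sub>R eu)) = uu (F Y)"
      using iff by (simp add: pa_lo Y)
    then have "c = 0" using F_cancel_u[of X c] e by metis
    moreover have "d = 0" using F_cancel_w[of X d] e Y calculation by simp
    ultimately show ?thesis using Y by simp
  next
    case False
    have Y2: "Y = X + d *\<^sub>R ew + c *\<^sub>R eu" using Y by (simp add: algebra_simps)
    have wY: "wa Y = wa (X + d *\<^sub>R ew)" "wb Y = wb (X + d *\<^sub>R ew)" unfolding Y2 by simp_all
    have "ww (F (X + d *\<^sub>R ew)) = ww (F Y)"
      using iff False by (simp add: pp_hi wY[symmetric]) (simp add: Y)
    then have "d = 0" using F_cancel_w[of X d] e by metis
    moreover have "c = 0" using F_cancel_u[of X c] e Y calculation by simp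
    ultimately show ?thesis using Y by simp
  qed
qed

text \<open>The triangular structure again: the coordinate that decouples is solved for by the
  intermediate value theorem, then the other one. Image height 10, coming from 1/2, decides the
  order.\<close>

lemma surj_F: "\<exists>X. F X = Z"
proof -
  have cha: "continuous_on UNIV ha" "continuous_on UNIV hp"
    by (rule continuous_on_of_derivative, rule has_derivative_ha has_derivative_hp)+
  have "\<exists>C>0. \<forall>X. \<bar>pa X\<bar> \<le> C" "\<exists>C>0. \<forall>X. \<bar>pp X\<bar> \<le> C"
    unfolding pa_def pp_def by (rule bounded_rd cha)+
  then obtain Ca Cp where Ca: "\<And>X. \<bar>pa X\<bar> \<le> Ca" and Cp: "\<And>X. \<bar>pp X\<bar> \<le> Cp" by blast
  define s where "s = ss Z / lam"
  have lam: "lam * s = ss Z" using lam_bounds by (simp add: s_def)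
  have w: "\<exists>w. ww (F (X + w *\<^sub>R ew)) = ww Z" if "ww X = 0" for X
  proof (rule surj_of_bounded_displacement[where c = 1 and C = Cp])
    show "continuous_on UNIV (\<lambda>w. ww (F (X + w *\<^sub>R ew)))"
      by (intro continuous_intros)
    show "\<bar>ww (F (X + w *\<^sub>R ew)) - 1 * w\<bar> \<le> Cp" for w using that Cp by simp
  qed simp
  show ?thesis
  proof (cases "wa Z \<le> 10")
    case True
    have "\<exists>u. mu * u + aa (u *\<^sub>R eu + s *\<^sub>R es) = uu Z"
    proof (rule surj_of_bounded_displacement[where c = mu and C = 1])
      have cal: "continuous_on UNIV (\<lambda>X. al (uu X) (ss X))"
        by (rule continuous_on_of_derivative, rule has_derivative_al)
      have "continuous_on UNIV aa"
        unfolding aa_def[abs_def] by (rule continuous_rd[OF compat_al cal])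
      then have "continuous_on UNIV (\<lambda>u. aa (u *\<^sub>R eu + s *\<^sub>R es))"
        by (rule continuous_on_compose2) (auto intro!: continuous_intros)
      then show "continuous_on UNIV (\<lambda>u. mu * u + aa (u *\<^sub>R eu + s *\<^sub>R es))"
        by (intro continuous_intros)
      show "\<bar>mu * u + aa (u *\<^sub>R eu + s *\<^sub>R es) - mu * u\<bar> \<le> 1" for u
        using al_bound[of "uu (rd (u *\<^sub>R eu + s *\<^sub>R es))" "ss (rd (u *\<^sub>R eu + s *\<^sub>R es))"]
        unfolding aa_def by simp
    qed (use mu_bounds in auto)
    then obtain u where u: "mu * u + aa (u *\<^sub>R eu + s *\<^sub>R es) = uu Z" by blast
    obtain w where w: "ww (F (u *\<^sub>R eu + s *\<^sub>R es + w *\<^sub>R ew)) = ww Z"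
      using w[of "u *\<^sub>R eu + s *\<^sub>R es"] by auto
    define X where "X = u *\<^sub>R eu + s *\<^sub>R es + w *\<^sub>R ew"
    have "wa (F X) = wa Z"
      using w unfolding X_def[symmetric] by (simp add: wa_def wb_def ww_def rd_def rn_def del: coords_F)
    then have "wa X \<le> 1/2" using True wa_F_iff(2)[of X] by simp
    then have "uu (F X) = uu Z" using u pa_lo[of X] by (simp add: X_def)
    moreover have "ss (F X) = ss Z" by (simp add: X_def lam)
    ultimately show ?thesis using w coords_eqI unfolding X_def[symmetric] by blast
  next
    case False
    obtain w where w: "ww (F (s *\<^sub>R es + w *\<^sub>R ew)) = ww Z" using w[of "s *\<^sub>R es"] by auto
    define X where "X = s *\<^sub>R es + w *\<^sub>R ew"
    have "wa (F X) = wa Z"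
      using w unfolding X_def[symmetric] by (simp add: wa_def wb_def ww_def rd_def rn_def del: coords_F)
    then have X: "1/2 \<le> wa X" using False wa_F_iff(2)[of X] by simp
    have "\<exists>u. uu (F (X + u *\<^sub>R eu)) = uu Z"
    proof (rule surj_of_bounded_displacement[where c = mu and C = Ca])
      show "continuous_on UNIV (\<lambda>u. uu (F (X + u *\<^sub>R eu)))"
        by (intro continuous_intros)
      show "\<bar>uu (F (X + u *\<^sub>R eu)) - mu * u\<bar> \<le> Ca" for u
        using Ca by (simp add: X_def)
    qed (use mu_bounds in auto)
    then obtain u where u: "uu (F (X + u *\<^sub>R eu)) = uu Z" by blast
    have "ww (F (X + u *\<^sub>R eu)) = ww (F X)" using X by (simp add: pp_hi)
    then have "ww (F (X + u *\<^sub>R eu)) = ww Z" using w unfolding X_def[symmetric] by metis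
    moreover have "ss (F (X + u *\<^sub>R eu)) = ss Z" by (simp add: X_def lam)
    ultimately show ?thesis using u coords_eqI by blast
  qed
qed

lemma bij_F: "bij F" using inj_F surj_F by (metis bijI surjI)

definition Fi :: "real ^ 3 \<Rightarrow> real ^ 3" where "Fi = inv F"

lemma F_Fi [simp]: "F (Fi X) = X" "Fi (F X) = X"
  using bij_F by (simp_all add: Fi_def bij_is_inj bij_is_surj surj_f_inv_f)

lemma continuous_Fi: "continuous_on S Fi"
proof -
  have "continuous_on (F ` UNIV) (inv_into UNIV F)"
    by (rule continuous_on_inverse_open[where S = UNIV]) (auto simp: continuous_F inj_F)
  then show ?thesis
    using bij_F by (auto simp: Fi_def bij_is_surj intro: continuous_on_subset)
qed

lemma bounded_linear_DFi: "bounded_linear (DFi X)"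
proof -
  have "linear (DFi X)"
    by (rule linearI) (auto intro!: coords_eqI simp: field_simps add_divide_distrib diff_divide_distrib)
  then show ?thesis by (rule linear_conv_bounded_linear[THEN iffD1])
qed

lemma has_derivative_Fi: "(Fi has_derivative DFi (Fi X)) (at X)"
proof (rule has_derivative_inverse_basic[where f = F and f' = "DF (Fi X)" and T = UNIV])
  show "isCont Fi X" using continuous_Fi[of UNIV] by (simp add: continuous_on_eq_continuous_at)
qed (auto simp: has_derivative_F bounded_linear_DFi DFi_DF fun_eq_iff)

definition Ali :: "real ^ 3 \<Rightarrow> real ^ 3" where "Ali X = vector [10 * X $ 1 - X $ 2, X $ 1, X $ 3]"

lemma Alin_Ali: "Alin (Ali X) = X"
  by (simp add: vec_eq_iff forall_3 Alin_def Ali_def)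

lemma Ali_Ints: "(\<And>i. X $ i \<in> \<int>) \<Longrightarrow> Ali X $ i \<in> \<int>"
  using exhaust_3[of i] by (auto simp: Ali_def intro!: Ints_diff Ints_mult)

lemma F_shift: assumes "\<And>i. n $ i \<in> \<int>" shows "F (X + n) = F X + Alin n"
proof -
  have "Alin (X + n) = Alin X + Alin n" by (rule coords_eqI) (simp_all add: algebra_simps)
  moreover have "pa (X + n) = pa X" "pp (X + n) = pp X"
    using compat_coeff_rd(1,2)[of "X + n" X] assms by simp_all
  ultimately show ?thesis by (simp add: F_def)
qed

text \<open>The matrix has determinant 1, so its inverse \<open>Ali\<close> is integral and
  congruent images have congruent preimages.\<close>

lemma lattice_map_Fi: "lattice_map Fi"
  unfolding lattice_map_def
proof (intro allI impI)
  fix X Y :: "real ^ 3" and i assume A: "\<forall>i. X $ i - Y $ i \<in> \<int>"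
  define n where "n = Ali (X - Y)"
  have n: "n $ i \<in> \<int>" for i unfolding n_def using A by (intro Ali_Ints) auto
  have "F (Fi Y + n) = X" using n by (simp add: F_shift n_def Alin_Ali)
  then have "Fi X = Fi Y + n" by (metis F_Fi(2))
  then show "Fi X $ i - Fi Y $ i \<in> \<int>" using n by simp
qed

lemma torus_diffeo_F: "torus_diffeo (torus_map F)"
proof -
  have 1: "torus_map F (torus_map Fi p) = p \<and> torus_map Fi (torus_map F p) = p" for p
  proof -
    obtain X where "p = torus_proj X" using torus_proj_surj by metis
    then show ?thesis by (simp add: torus_map_proj lattice_map_F lattice_map_Fi)
  qed
  then have b: "bij (torus_map F)" by (intro bij_betw_byWitness[where f' = "torus_map Fi"]) auto
  have i: "inv (torus_map F) = torus_map Fi" using 1 by (intro inv_equality) auto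
  have "continuous_on UNIV (\<lambda>X. DF X v)" for v
    unfolding DF_def by (intro continuous_intros continuous_coeffs)
  then have c1: "C1_torus_map (torus_map F)"
    by (rule C1_torus_map_torus_map[OF lattice_map_F has_derivative_F])
  have nz: "fa X \<noteq> 0" "fd X \<noteq> 0" for X using fa_bounds[of X] fd_ge[of X] by auto
  have "continuous_on UNIV (\<lambda>X. DFi (Fi X) v)" for v
    unfolding DFi_def using nz lam_bounds by (intro continuous_intros continuous_Fi) auto
  then have "C1_torus_map (torus_map Fi)"
    by (rule C1_torus_map_torus_map[OF lattice_map_Fi has_derivative_Fi])
  then show ?thesis using b c1 by (simp add: torus_diffeo_def i)
qed

section \<open>The derived-from-Anosov map\<close>

text \<open>The height is kept as a passive third coordinate, so that \<open>F\<close> and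
  \<open>G\<close> are compared at the same point. \<open>ga\<close> and \<open>gp\<close> are the
  partial derivatives of the unstable coordinate of \<open>G\<close>, \<open>ru\<close> and
  \<open>rs\<close> those of the bump.\<close>

definition G :: "real ^ 3 \<Rightarrow> real ^ 3" where "G X = Alin X + aa X *\<^sub>R eu"
definition ga :: "real ^ 3 \<Rightarrow> real" where "ga X = mu + al_u (uu (rd X)) (ss (rd X))"
definition gp :: "real ^ 3 \<Rightarrow> real" where "gp X = al_s (uu (rd X)) (ss (rd X))"
definition ru :: "real ^ 3 \<Rightarrow> real" where "ru X = rf_u (uu (rd X)) (ss (rd X))"
definition rs :: "real ^ 3 \<Rightarrow> real" where "rs X = rf_s (uu (rd X)) (ss (rd X))"

lemma coords_G [simp]: "uu (G X) = mu * uu X + aa X" "ss (G X) = lam * ss X" "ww (G X) = ww X"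
  by (simp_all add: G_def)

lemma lattice_map_G: "lattice_map G"
  unfolding lattice_map_def
proof (intro allI impI)
  fix X Y :: "real ^ 3" and i assume "\<forall>i. X $ i - Y $ i \<in> \<int>"
  then show "G X $ i - G Y $ i \<in> \<int>"
    using Alin_Ints[of X Y i] compat_coeff_rd(4)[of X Y] by (simp add: G_def)
qed

lemma has_derivative_aa: "(aa has_derivative (\<lambda>v. (ga X - mu) * uu v + gp X * ss v)) (at X)"
  using has_derivative_rd[OF compat_al has_derivative_al, of X]
  by (simp add: aa_def[abs_def] ga_def gp_def)

lemma has_derivative_rr: "(rr has_derivative (\<lambda>v. ru X * uu v + rs X * ss v)) (at X)"
  using has_derivative_rd[OF compat_hr has_derivative_hr, of X]
  by (simp add: rr_def[abs_def] Dhr_def[abs_def] ru_def rs_def)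

lemma continuous_gcoeffs:
  shows "continuous_on UNIV ga" "continuous_on UNIV gp" "continuous_on UNIV ru" "continuous_on UNIV rs"
proof -
  have a: "continuous_on UNIV (\<lambda>X. al_u (uu (rd X)) (ss (rd X)) * uu v + al_s (uu (rd X)) (ss (rd X)) * ss v)" for v
    by (rule continuous_deriv_rd[OF compat_al has_derivative_al])
       (unfold al_u_def al_s_def dg_def, intro continuous_intros)
  show "continuous_on UNIV gp" using a[of es] by (simp add: gp_def[abs_def])
  have "continuous_on UNIV (\<lambda>X. mu + al_u (uu (rd X)) (ss (rd X)))"
    using a[of eu] by (intro continuous_intros) simp
  then show "continuous_on UNIV ga" by (simp add: ga_def[abs_def])
  have r: "continuous_on UNIV (\<lambda>X. Dhr (rd X) v)" for v
    by (intro continuous_deriv_rd[OF compat_hr has_derivative_hr] continuous_Dhr)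
  show "continuous_on UNIV ru" using r[of eu] by (simp add: ru_def[abs_def] Dhr_def)
  show "continuous_on UNIV rs" using r[of es] by (simp add: rs_def[abs_def] Dhr_def)
qed

lemma G_eq: "G X = (mu * uu X + aa X) *\<^sub>R eu + (lam * ss X) *\<^sub>R es + ww X *\<^sub>R ew"
  by (rule coords_eqI) simp_all

lemma has_derivative_G:
  "(G has_derivative (\<lambda>v. (ga X * uu v + gp X * ss v) *\<^sub>R eu + (lam * ss v) *\<^sub>R es + ww v *\<^sub>R ew)) (at X)"
proof -
  have "((\<lambda>X. (mu * uu X + aa X) *\<^sub>R eu + (lam * ss X) *\<^sub>R es + ww X *\<^sub>R ew) has_derivative
    (\<lambda>v. (mu * uu v + ((ga X - mu) * uu v + gp X * ss v)) *\<^sub>R eu + (lam * ss v) *\<^sub>R es + ww v *\<^sub>R ew)) (at X)"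
    by (intro has_derivative_add has_derivative_scaleR_left has_derivative_mult_right has_derivative_aa
        bounded_linear.has_derivative[OF bounded_linear_coords(1)]
        bounded_linear.has_derivative[OF bounded_linear_coords(2)]
        bounded_linear.has_derivative[OF bounded_linear_coords(3)] has_derivative_ident)
  then show ?thesis by (simp add: G_eq[abs_def] algebra_simps)
qed

lemma continuous_G: "continuous_on S G"
  by (rule continuous_on_of_derivative, rule has_derivative_G)

lemma ga_bounds: "1/3 \<le> ga X" "ga X \<le> 18"
proof -
  show "1/3 \<le> ga X" using al_u_bounds(1)[of "uu (rd X)" "ss (rd X)"] unfolding ga_def kk_def by linarith
  show "ga X \<le> 18"
    using al_u_bounds(2)[of "uu (rd X)" "ss (rd X)"] mu_bounds(2) kk_bounds(2) unfolding ga_def by linarith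
qed

lemma F_G: "wa X \<le> 1/2 \<Longrightarrow> F X = G X + pp X *\<^sub>R ew" "wa X \<le> 1/2 \<Longrightarrow> fa X = ga X"
  "wa X \<le> 1/2 \<Longrightarrow> fp X = gp X"
  by (simp_all add: F_def G_def pa_lo fa_def ga_def fp_def gp_def wa_def chi_lo)

lemma G_shift_ew: "G (X + c *\<^sub>R ew) = G X + c *\<^sub>R ew"
  by (rule coords_eqI) simp_all

lemma rd_uv:
  assumes "\<And>i. X $ i - Y $ i \<in> \<int>" "\<bar>uu Y\<bar> \<le> 1/40" "\<bar>ss Y\<bar> \<le> 1/40"
  shows "uu (rd X) = uu Y" "ss (rd X) = ss Y"
proof -
  have "\<bar>mu * uu Y\<bar> \<le> 10 * (1/40)" "\<bar>lam * ss Y\<bar> \<le> 1 * (1/40)"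
    unfolding abs_mult using assms mu_bounds lam_bounds by (intro mult_mono; simp)+
  then have b: "\<bar>Y $ 1\<bar> < 1/2" "\<bar>Y $ 2\<bar> < 1/2"
    unfolding nth_of_coords using assms
      abs_triangle_ineq[of "uu Y" "ss Y"] abs_triangle_ineq[of "mu * uu Y" "lam * ss Y"] by linarith+
  have *: "rd X $ i = Y $ i" if "\<bar>Y $ i\<bar> < 1/2" for i
  proof -
    obtain n where n: "X $ i = Y $ i + of_int n"
      using assms(1)[of i] by (auto elim!: Ints_cases simp: algebra_simps)
    have "round (X $ i) = n" using that n by (intro round_unique') simp
    then show ?thesis using n by (simp add: rd_def rn_def)
  qed
  show "uu (rd X) = uu Y" "ss (rd X) = ss Y" using *[of 1] *[of 2] b by (simp_all add: uu_def ss_def)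
qed

text \<open>When the horizontal factor is at most 1 in modulus, the image of the reduced point stays
  near the origin, so reduction to the cell commutes with \<open>G\<close>.\<close>

lemma G_in_box:
  assumes "\<bar>uu (rd X)\<bar> \<le> 1/80" "\<bar>ss (rd X)\<bar> \<le> 1/80"
    "\<bar>mu - kk * K (80 * uu (rd X)) * K (80 * ss (rd X))\<bar> \<le> 1"
  shows "uu (rd (G X)) = (mu - kk * K (80 * uu (rd X)) * K (80 * ss (rd X))) * uu (rd X)"
    "ss (rd (G X)) = lam * ss (rd X)"
proof -
  define f where "f = mu - kk * K (80 * uu (rd X)) * K (80 * ss (rd X))"
  define Y where "Y = G (rd X)"
  have aa: "aa (rd X) = al (uu (rd X)) (ss (rd X))"
    using compat_coeff_rd(4)[of "rd X" X] by (simp add: aa_def rd_def rn_Ints)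
  have uY: "uu Y = f * uu (rd X)"
    by (simp add: Y_def aa al_def f_def algebra_simps)
  have sY: "ss Y = lam * ss (rd X)" by (simp add: Y_def)
  have "\<bar>uu Y\<bar> \<le> 1 * (1/80)" "\<bar>ss Y\<bar> \<le> 1 * (1/80)"
    unfolding uY sY abs_mult using assms lam_bounds by (intro mult_mono; simp add: f_def)+
  moreover have "G X $ i - Y $ i \<in> \<int>" for i
    using lattice_map_G rd_Ints[of X] unfolding lattice_map_def Y_def by blast
  ultimately show "uu (rd (G X)) = (mu - kk * K (80 * uu (rd X)) * K (80 * ss (rd X))) * uu (rd X)"
    "ss (rd (G X)) = lam * ss (rd X)"
    using rd_uv[of "G X" Y] uY sY by (simp_all add: f_def)
qed

lemma rr_G_box:
  assumes "0 < rr X"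
  shows "\<bar>uu (rd (G X))\<bar> \<le> 1/2 * \<bar>uu (rd X)\<bar>" "\<bar>ss (rd (G X))\<bar> \<le> 1/2 * \<bar>ss (rd X)\<bar>"
    "\<bar>uu (rd X)\<bar> \<le> 1/80" "\<bar>ss (rd X)\<bar> \<le> 1/80"
proof -
  have r: "0 < rf (uu (rd X)) (ss (rd X))" using assms by (simp add: rr_def hr_def)
  show b: "\<bar>uu (rd X)\<bar> \<le> 1/80" "\<bar>ss (rd X)\<bar> \<le> 1/80"
    using rf_pos_small[OF r] by (auto simp: nu_def)
  define f where "f = mu - kk * K (80 * uu (rd X)) * K (80 * ss (rd X))"
  have f: "0 \<le> f" "f \<le> 1/2" using contraction_factor[OF r] by (auto simp: f_def)
  have e: "uu (rd (G X)) = f * uu (rd X)" "ss (rd (G X)) = lam * ss (rd X)"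
    using G_in_box[of X] b f by (auto simp: f_def)
  show "\<bar>uu (rd (G X))\<bar> \<le> 1/2 * \<bar>uu (rd X)\<bar>" "\<bar>ss (rd (G X))\<bar> \<le> 1/2 * \<bar>ss (rd X)\<bar>"
    unfolding e abs_mult using f lam_bounds by (intro mult_right_mono; simp)+
qed

text \<open>Coordinates are at least halved, so the squared distance is at least quartered: the
  support \<open>qq < 4\<close> lands in the plateau \<open>qq \<le> 1\<close>.\<close>

lemma rr_G: assumes "0 < rr X" shows "rr (G X) = 19 * Rc"
proof -
  have "qq (uu (rd X)) (ss (rd X)) < 4" using assms by (simp add: rr_def hr_def rf_pos_iff)
  then have q: "(uu (rd X))\<^sup>2 + (ss (rd X))\<^sup>2 < 4 * nu\<^sup>2" by (simp add: qq_def nu_def field_simps)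
  have "\<bar>uu (rd (G X))\<bar>\<^sup>2 \<le> (1/2 * \<bar>uu (rd X)\<bar>)\<^sup>2" "\<bar>ss (rd (G X))\<bar>\<^sup>2 \<le> (1/2 * \<bar>ss (rd X)\<bar>)\<^sup>2"
    using rr_G_box[OF assms] by (intro power_mono; simp)+
  then have "(uu (rd (G X)))\<^sup>2 + (ss (rd (G X)))\<^sup>2 \<le> nu\<^sup>2" using q by (simp add: power_mult_distrib power_divide)
  then have "qq (uu (rd (G X))) (ss (rd (G X))) \<le> 1" by (simp add: qq_def nu_def)
  then show ?thesis by (simp add: rr_def hr_def rf_core)
qed

subsection \<open>The height of the lens\<close>

text \<open>The equation that the gradient of \<open>tau\<close>, in eigencoordinates, inherits from
  differentiating \<open>tau X = (tau (G X) + rr X) / 20\<close>.\<close>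

definition TT :: "real ^ 3 \<Rightarrow> real \<times> real \<Rightarrow> real \<times> real" where
  "TT X v = ((ga X * fst v + ru X) / 20, (gp X * fst v + lam * snd v + rs X) / 20)"

lemma TT_contract: "norm (TT X v - TT X w) \<le> 99/100 * norm (v - w)"
proof -
  define x y where "x = fst v - fst w" and "y = snd v - snd w"
  have g: "\<bar>gp X\<bar> \<le> 7" by (simp add: gp_def al_s_bound)
  have d: "TT X v - TT X w = ((ga X * x) / 20, (gp X * x + lam * y) / 20)"
    by (simp add: TT_def x_def y_def field_simps)
  have 1: "(ga X * x)\<^sup>2 \<le> 324 * x\<^sup>2"
    unfolding power_mult_distrib using ga_bounds[of X] power_mono[of "ga X" 18 2] by (intro mult_right_mono) auto
  have "(gp X)\<^sup>2 \<le> 7\<^sup>2" using g by (intro power2_le_iff_abs_le[THEN iffD2]) auto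
  then have 2: "(gp X * x)\<^sup>2 \<le> 49 * x\<^sup>2" unfolding power_mult_distrib by (intro mult_right_mono) auto
  have "lam\<^sup>2 \<le> (11/100)\<^sup>2" using lam_bounds by (intro power_mono) auto
  then have 3: "(lam * y)\<^sup>2 \<le> 2/100 * y\<^sup>2" unfolding power_mult_distrib
    by (intro mult_right_mono) (auto simp: power2_eq_square)
  \<comment> \<open>A weighted Young inequality. The weight 5 burdens the tiny \<open>lam\<close>
    term, so that \<open>(324 + 6/5 * 49) / 400\<close> stays below 98/100.\<close>
  have "0 \<le> (gp X * x - 5 * (lam * y))\<^sup>2" by simp
  then have 4: "(gp X * x + lam * y)\<^sup>2 \<le> 6/5 * (gp X * x)\<^sup>2 + 6 * (lam * y)\<^sup>2"
    by (simp add: power2_eq_square algebra_simps)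
  have "(norm (TT X v - TT X w))\<^sup>2 = ((ga X * x)\<^sup>2 + (gp X * x + lam * y)\<^sup>2) / 400"
    unfolding d norm_Pair by (simp add: power_divide)
  also have "\<dots> \<le> 98/100 * (x\<^sup>2 + y\<^sup>2)"
  proof -
    have "(p1 + p4) / 400 \<le> 98/100 * (a + b)" if "p1 \<le> 324 * a" "p2 \<le> 49 * a" "p3 \<le> 2/100 * b"
      "p4 \<le> 6/5 * p2 + 6 * p3" "0 \<le> a" "0 \<le> b" for p1 p2 p3 p4 a b :: real
      using that by argo
    from this[OF 1 2 3 4] show ?thesis by simp
  qed
  also have "\<dots> \<le> (99/100 * norm (v - w))\<^sup>2"
  proof -
    have "(norm (v - w))\<^sup>2 = x\<^sup>2 + y\<^sup>2" by (simp add: norm_prod_def x_def y_def)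
    moreover have "0 \<le> x\<^sup>2 + y\<^sup>2" by simp
    ultimately show ?thesis unfolding power_mult_distrib by (simp add: power2_eq_square[of "_ / _"])
  qed
  finally show ?thesis by (rule power2_le_imp_le) simp
qed

lemma rs_bound: "\<bar>rs X\<bar> \<le> 17/1000" and ru_bound: "\<bar>ru X\<bar> \<le> 17/1000"
proof -
  have "rf_s u s = rf_u s u" for u s by (simp add: rf_s_def rf_u_def qq_def add.commute)
  then show "\<bar>rs X\<bar> \<le> 17/1000" "\<bar>ru X\<bar> \<le> 17/1000" using rf_u_bound by (simp_all add: rs_def ru_def)
qed

lemma TT_bound: assumes "norm v \<le> 1" shows "norm (TT X v) \<le> 1"
proof -
  have "norm (TT X v) \<le> norm (TT X v - TT X 0) + norm (TT X 0)" using norm_triangle_sub by (metis add.commute)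
  also have "norm (TT X v - TT X 0) \<le> 99/100 * norm (v - 0)" by (rule TT_contract)
  also have "norm (TT X 0) \<le> \<bar>ru X / 20\<bar> + \<bar>rs X / 20\<bar>"
    unfolding TT_def using norm_Pair_le[of "ru X / 20" "rs X / 20"] by simp
  finally show ?thesis using assms rs_bound[of X] ru_bound[of X] by simp
qed

lemma continuous_TT:
  assumes "continuous_on S g" shows "continuous_on S (\<lambda>X. TT X (g X))"
proof -
  have "continuous_on S ga" "continuous_on S gp" "continuous_on S ru" "continuous_on S rs"
    using continuous_gcoeffs by (auto intro: continuous_on_subset)
  then show ?thesis unfolding TT_def using assms by (intro continuous_intros) auto
qed

text \<open>Candidate for the gradient of \<open>tau\<close>, constructed independently of it;
  \<open>has_derivative_tau\<close> identifies the two.\<close>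

definition dtau :: "real ^ 3 \<Rightarrow> real \<times> real" where
  "dtau = (SOME \<theta>. continuous_on UNIV \<theta> \<and> (\<forall>X. \<theta> X = TT X (\<theta> (G X))) \<and> (\<forall>X. norm (\<theta> X) \<le> 1))"

lemma dtau: "continuous_on UNIV dtau" "dtau X = TT X (dtau (G X))" "norm (dtau X) \<le> 1"
proof -
  have "\<exists>\<theta>. continuous_on UNIV \<theta> \<and> (\<forall>X. \<theta> X = TT X (\<theta> (G X))) \<and> (\<forall>X. norm (\<theta> X) \<le> 1)"
  proof (rule invariant_section[of UNIV "{}" G undefined 1 "99/100" TT])
    fix \<theta> assume "continuous_on (UNIV \<union> {}) \<theta>" "\<And>X. X \<in> UNIV \<Longrightarrow> \<theta> X = TT X (\<theta> (G X))"
      "\<And>X. X \<in> UNIV \<union> {} \<Longrightarrow> norm (\<theta> X) \<le> 1"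
    then show ?thesis unfolding Un_empty_right by blast
  qed (simp_all add: continuous_G TT_contract[simplified] TT_bound continuous_TT)
  from someI_ex[OF this] show "continuous_on UNIV dtau" "dtau X = TT X (dtau (G X))" "norm (dtau X) \<le> 1"
    unfolding dtau_def by blast+
qed

text \<open>Partial sums of the series with terms \<open>rr ((G ^^ n) X) / 20 ^ (n + 1)\<close>;
  \<open>dtaun\<close> collects their gradients.\<close>

primrec taun :: "nat \<Rightarrow> real ^ 3 \<Rightarrow> real" where
  "taun 0 X = 0" | "taun (Suc n) X = (taun n (G X) + rr X) / 20"

primrec dtaun :: "nat \<Rightarrow> real ^ 3 \<Rightarrow> real \<times> real" where
  "dtaun 0 X = 0" | "dtaun (Suc n) X = TT X (dtaun n (G X))"

lemma has_derivative_taun: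
  "(taun n has_derivative (\<lambda>v. fst (dtaun n X) * uu v + snd (dtaun n X) * ss v)) (at X)"
proof (induction n arbitrary: X)
  case 0
  have "taun 0 = (\<lambda>X. 0)" by (simp add: fun_eq_iff)
  then show ?case by simp
next
  case (Suc n)
  note 1 = has_derivative_compose[OF has_derivative_G Suc, of X]
  have "((\<lambda>x. (taun n (G x) + rr x) * (1/20)) has_derivative
    (\<lambda>v. (fst (dtaun n (G X)) * (ga X * uu v + gp X * ss v) + snd (dtaun n (G X)) * (lam * ss v)
        + (ru X * uu v + rs X * ss v)) * (1/20))) (at X)"
    using has_derivative_mult_left[OF has_derivative_add[OF 1 has_derivative_rr], where y = "1/20"] by simp
  moreover have "(\<lambda>x. (taun n (G x) + rr x) * (1/20)) = taun (Suc n)" by (simp add: fun_eq_iff)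
  ultimately show ?case
    by (simp only:) (erule has_derivative_eq_rhs, simp add: TT_def fun_eq_iff field_simps)
qed

lemma dtaun_close: "norm (dtaun n X - dtau X) \<le> (99/100) ^ n"
proof (induction n arbitrary: X)
  case 0 then show ?case using dtau(3) by simp
next
  case (Suc n)
  have "norm (dtaun (Suc n) X - dtau X) \<le> 99/100 * norm (dtaun n (G X) - dtau (G X))"
    using TT_contract dtau(2)[of X] by simp
  then show ?case using Suc[of "G X"] by simp
qed

lemma rd_0 [simp]: "rd (0 :: real ^ 'n) = 0" by (simp add: vec_eq_iff rd_def rn_def)

lemma G_0: "G 0 = 0"
proof -
  have "aa 0 = 0" by (simp add: aa_def al_def)
  then show ?thesis by (intro coords_eqI) simp_all
qed

lemma rr_0: "rr 0 = 19 * Rc" by (simp add: rr_def hr_def rf_core qq_def)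

definition tau :: "real ^ 3 \<Rightarrow> real" where "tau X = lim (\<lambda>n. taun n X)"

text \<open>The gradients converge uniformly at rate 99/100, and the values converge at the origin,
  a fixed point of \<open>G\<close>, to \<open>Rc\<close>. Together this permits termwise
  differentiation.\<close>

lemma tau_limit: "(\<lambda>n. taun n X) \<longlonglongrightarrow> tau X"
  and has_derivative_tau: "(tau has_derivative (\<lambda>v. fst (dtau X) * uu v + snd (dtau X) * ss v)) (at X)"
proof -
  obtain Ku where Ku: "0 \<le> Ku" "\<And>v. \<bar>uu v\<bar> \<le> norm v * Ku"
    using bounded_linear.nonneg_bounded[OF bounded_linear_coords(1)] by auto
  obtain Ks where Ks: "0 \<le> Ks" "\<And>v. \<bar>ss v\<bar> \<le> norm v * Ks"
    using bounded_linear.nonneg_bounded[OF bounded_linear_coords(2)] by auto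
  have close: "norm ((fst (dtaun n X) * uu v + snd (dtaun n X) * ss v) - (fst (dtau X) * uu v + snd (dtau X) * ss v))
     \<le> (99/100) ^ n * (Ku + Ks) * norm v" for n X v
  proof -
    define p where "p = dtaun n X - dtau X"
    have p: "\<bar>fst p\<bar> \<le> (99/100) ^ n" "\<bar>snd p\<bar> \<le> (99/100) ^ n"
      using dtaun_close[of n X] norm_fst_le[of "fst p" "snd p"] norm_snd_le[of "snd p" "fst p"] unfolding p_def[symmetric] by auto
    have "norm ((fst (dtaun n X) * uu v + snd (dtaun n X) * ss v) - (fst (dtau X) * uu v + snd (dtau X) * ss v))
      = \<bar>fst p * uu v + snd p * ss v\<bar>"
      by (simp add: p_def algebra_simps)
    also have "\<dots> \<le> \<bar>fst p\<bar> * \<bar>uu v\<bar> + \<bar>snd p\<bar> * \<bar>ss v\<bar>"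
      by (metis abs_mult abs_triangle_ineq)
    also have "\<dots> \<le> (99/100) ^ n * (norm v * Ku) + (99/100) ^ n * (norm v * Ks)"
      using p Ku Ks by (intro add_mono mult_mono) auto
    finally show ?thesis by (simp add: algebra_simps)
  qed
  have ex: "\<exists>g. \<forall>X\<in>UNIV. (\<lambda>n. taun n X) \<longlonglongrightarrow> g X \<and>
     (g has_derivative (\<lambda>v. fst (dtau X) * uu v + snd (dtau X) * ss v)) (at X within UNIV)"
  proof (rule has_derivative_sequence[of UNIV taun
        "\<lambda>n X v. fst (dtaun n X) * uu v + snd (dtaun n X) * ss v" _ 0 Rc])
    show "\<forall>\<^sub>F n in sequentially. \<forall>X\<in>UNIV. \<forall>v. norm ((fst (dtaun n X) * uu v + snd (dtaun n X) * ss v)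
       - (fst (dtau X) * uu v + snd (dtau X) * ss v)) \<le> e * norm v" if "0 < e" for e
    proof -
      have "(\<lambda>n. (99/100) ^ n * (Ku + Ks)) \<longlonglongrightarrow> 0 * (Ku + Ks)"
        by (intro tendsto_mult LIMSEQ_power_zero tendsto_const) auto
      then have "\<forall>\<^sub>F n in sequentially. (99/100) ^ n * (Ku + Ks) < e"
        using that by (auto dest: order_tendstoD(2))
      then show ?thesis
      proof eventually_elim
        case (elim n)
        show ?case
        proof (intro ballI allI)
          fix X v :: "real ^ 3"
          have "(99/100) ^ n * (Ku + Ks) * norm v \<le> e * norm v" using elim by (intro mult_right_mono) auto
          with close[of n X v] show "norm ((fst (dtaun n X) * uu v + snd (dtaun n X) * ss v)
            - (fst (dtau X) * uu v + snd (dtau X) * ss v)) \<le> e * norm v" by linarith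
        qed
      qed
    qed
    have "taun n 0 = Rc * (1 - (1/20) ^ n)" for n
      by (induction n) (simp_all add: G_0 rr_0 field_simps)
    moreover have "(\<lambda>n. Rc * (1 - (1/20) ^ n)) \<longlonglongrightarrow> Rc * (1 - 0)"
      by (intro tendsto_intros LIMSEQ_power_zero) auto
    ultimately show "(\<lambda>n. taun n 0) \<longlonglongrightarrow> Rc" by simp
  qed (simp_all add: has_derivative_taun)
  obtain g where g: "\<And>X. (\<lambda>n. taun n X) \<longlonglongrightarrow> g X"
    "\<And>X. (g has_derivative (\<lambda>v. fst (dtau X) * uu v + snd (dtau X) * ss v)) (at X)" using ex by auto
  have "g X = tau X" for X using limI[OF g(1)] by (simp add: tau_def)
  then have "g = tau" by (simp add: fun_eq_iff)
  then show "(\<lambda>n. taun n X) \<longlonglongrightarrow> tau X"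
    "(tau has_derivative (\<lambda>v. fst (dtau X) * uu v + snd (dtau X) * ss v)) (at X)" using g by auto
qed

lemma continuous_tau: "continuous_on S tau"
  by (rule continuous_on_of_derivative, rule has_derivative_tau)

lemma tau_G: "tau (G X) = 20 * tau X - rr X"
proof -
  have "(\<lambda>n. taun (Suc n) X) \<longlonglongrightarrow> (tau (G X) + rr X) / 20"
    unfolding taun.simps by (intro tendsto_intros tau_limit) simp
  moreover have "(\<lambda>n. taun (Suc n) X) \<longlonglongrightarrow> tau X" by (intro LIMSEQ_Suc tau_limit)
  ultimately have "tau X = (tau (G X) + rr X) / 20" using LIMSEQ_unique by blast
  then show ?thesis by simp
qed

lemma taun_bounds: "0 \<le> taun n X \<and> taun n X \<le> Rc"
proof (induction n arbitrary: X)
  case (Suc n)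
  have "0 \<le> taun n (G X)" "taun n (G X) \<le> Rc" using Suc by auto
  moreover have "0 \<le> rr X" "rr X \<le> 19 * Rc" by (rule rr_bounds)+
  ultimately show ?case by simp
qed (use Rc_pos in simp)

lemma tau_bounds: "0 \<le> tau X" "tau X \<le> Rc"
  using taun_bounds by (auto intro!: LIMSEQ_le_const[OF tau_limit] LIMSEQ_le_const2[OF tau_limit])

lemma tau_proj: "(\<And>i. X $ i - Y $ i \<in> \<int>) \<Longrightarrow> tau X = tau Y"
proof -
  assume A: "\<And>i. X $ i - Y $ i \<in> \<int>"
  have "taun n X = taun n Y" for n
    using A
  proof (induction n arbitrary: X Y)
    case (Suc n)
    have "taun n (G X) = taun n (G Y)"
      using lattice_map_G Suc.prems unfolding lattice_map_def by (intro Suc.IH) blast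
    then show ?case using compat_coeff_rd(3)[OF Suc.prems] by simp
  qed simp
  then show ?thesis by (simp add: tau_def)
qed

lemma tau_vertical [simp]: "tau (X + c *\<^sub>R ew) = tau X"
proof -
  have "taun n (X + c *\<^sub>R ew) = taun n X" for n
    by (induction n arbitrary: X) (simp_all add: G_shift_ew)
  then show ?thesis by (simp add: tau_def)
qed

text \<open>The plateau is mapped into itself, and \<open>Rc\<close> solves
  \<open>t = 20 * t - 19 * Rc\<close>; the defect \<open>Rc - tau X\<close> shrinks by 1/20 when
  traced back along orbits.\<close>

lemma tau_core: assumes "rr X = 19 * Rc" shows "tau X = Rc"
proof -
  have "Rc - tau X = 0"
  proof (rule vanishing_of_contraction[where N = "{X. rr X = 19 * Rc}" and F = G and q = "1/20" and C = Rc])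
    fix X assume X: "X \<in> {X. rr X = 19 * Rc}"
    then show "0 \<le> Rc - tau X \<and> Rc - tau X \<le> Rc" using tau_bounds by simp
    show "Rc - tau X = 0 \<or> (G X \<in> {X. rr X = 19 * Rc} \<and> Rc - tau X \<le> 1/20 * (Rc - tau (G X)))"
      using X rr_G[of X] Rc_pos by (simp add: tau_G)
  qed (use assms in auto)
  then show ?thesis by simp
qed

text \<open>One step of \<open>G\<close> leads to the plateau, where \<open>tau\<close> is known.
  This formula is the origin of the denominator \<open>r + Rc\<close> in
  \<open>psih\<close>.\<close>

lemma tau_lens: assumes "0 < rr X" shows "tau X = (rr X + Rc) / 20"
  using tau_G[of X] tau_core[OF rr_G[OF assms]] by simp

lemma tau_zero: "tau X = 0 \<Longrightarrow> rr X = 0 \<and> tau (G X) = 0"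
  using tau_G[of X] tau_bounds[of "G X"] rr_bounds[of X] by simp

subsection \<open>The lens lies over a dense set\<close>

text \<open>\<open>K y - dg y\<close> equals \<open>4 * y\<^sup>2 * (1 - y\<^sup>2)\<close> here,
  and the last factor is at least 3/4. It is a quantitative gap between the chord and the tangent of
  \<open>y * K y\<close>.\<close>

lemma K_minus_dg: "\<bar>y\<bar> \<le> 1/2 \<Longrightarrow> dg y + 3 * y\<^sup>2 \<le> K y"
proof -
  have "y * dK y = - (4 * (y\<^sup>2 * max 0 (1 - y\<^sup>2)))" by (simp add: dK_def power2_eq_square)
  then have e: "K y = dg y + 4 * (y\<^sup>2 * max 0 (1 - y\<^sup>2))" by (simp add: dg_def)
  assume "\<bar>y\<bar> \<le> 1/2"
  then have "\<bar>y\<bar>\<^sup>2 \<le> (1/2)\<^sup>2" by (intro power_mono) auto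
  then have "y\<^sup>2 * (3/4) \<le> y\<^sup>2 * max 0 (1 - y\<^sup>2)" by (intro mult_left_mono) (auto simp: power2_eq_square)
  then show "dg y + 3 * y\<^sup>2 \<le> K y" by (simp add: e)
qed

lemma dg_antimono: "\<bar>x\<bar> \<le> \<bar>y\<bar> \<Longrightarrow> \<bar>y\<bar> \<le> 1/2 \<Longrightarrow> dg y \<le> dg x"
proof -
  assume "\<bar>x\<bar> \<le> \<bar>y\<bar>" "\<bar>y\<bar> \<le> 1/2"
  then have xy: "\<bar>x\<bar>\<^sup>2 \<le> \<bar>y\<bar>\<^sup>2" "\<bar>y\<bar>\<^sup>2 \<le> (1/2)\<^sup>2" by (intro power_mono; simp)+
  then have "0 \<le> (y\<^sup>2 - x\<^sup>2) * (6 - 5 * (x\<^sup>2 + y\<^sup>2))"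
    by (intro mult_nonneg_nonneg) (auto simp: power2_eq_square)
  then show ?thesis using \<open>\<bar>x\<bar> \<le> \<bar>y\<bar>\<close> \<open>\<bar>y\<bar> \<le> 1/2\<close> by (simp add: dg_in algebra_simps)
qed

lemma dg_pos_small: "0 < dg y \<Longrightarrow> \<bar>y\<bar> \<le> 1/2"
proof (rule ccontr)
  assume A: "0 < dg y" "\<not> \<bar>y\<bar> \<le> 1/2"
  show False
  proof (cases "\<bar>y\<bar> \<le> 1")
    case True
    have "(1/2)\<^sup>2 \<le> \<bar>y\<bar>\<^sup>2" using A by (intro power_mono) auto
    then have "1/4 \<le> y\<^sup>2" by (simp add: power_divide)
    moreover have "y\<^sup>2 \<le> 1" using True by (simp add: abs_square_le_1)
    ultimately have "(1 - y\<^sup>2) * (1 - 5 * y\<^sup>2) \<le> 0" by (intro mult_nonneg_nonpos) auto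
    then show False using A True by (simp add: dg_in)
  next
    case False then show False using A by (simp add: dg_out)
  qed
qed

text \<open>Where the horizontal derivative is at most one, concavity of the profile makes the orbit
  approach the lattice, hence enter the support of the lens.\<close>

lemma ga_le_1_step:
  assumes "ga X \<le> 1"
  defines "u \<equiv> uu (rd X)" and "s \<equiv> ss (rd X)"
  shows "ga (G X) \<le> 1"
    "\<bar>uu (rd (G X))\<bar> \<le> (1 - 24 * (80 * u)\<^sup>2) * \<bar>u\<bar>" "\<bar>ss (rd (G X))\<bar> \<le> 11/100 * \<bar>s\<bar>"
proof -
  define f where "f = mu - kk * K (80 * u) * K (80 * s)"
  \<comment> \<open>\<open>88/10\<close> is \<open>98/10 - 1\<close>: a derivative of at most 1
    forces the perturbation to be almost maximal, hence the point to be close to the origin.\<close>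
  have p: "88/10 \<le> kk * (dg (80 * u) * K (80 * s))"
    using assms(1) mu_bounds by (simp add: ga_def al_u_def u_def s_def mult.assoc)
  have dpos: "0 < dg (80 * u)"
  proof (rule ccontr)
    assume "\<not> ?thesis"
    then have "kk * (dg (80 * u) * K (80 * s)) \<le> 0"
      using K_bounds kk_bounds by (intro mult_nonneg_nonpos mult_nonpos_nonneg) auto
    then show False using p by simp
  qed
  then have y: "\<bar>80 * u\<bar> \<le> 1/2" by (rule dg_pos_small)
  have z: "\<bar>80 * s\<bar> \<le> 1"
    using p K_out(1)[of "80 * s"] by (cases "\<bar>80 * s\<bar> \<le> 1") auto
  have "dg (80 * u) * K (80 * s) \<le> 1 * K (80 * s)" using dg_bounds K_bounds by (intro mult_right_mono) auto
  then have "kk * (dg (80 * u) * K (80 * s)) \<le> kk * K (80 * s)" using kk_bounds by simp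
  then have kz: "8 \<le> kk * K (80 * s)" using p by linarith
  \<comment> \<open>The constant 24 is \<open>8 * 3\<close>: the factor 8 bounds
    \<open>kk * K (80 * s)\<close> from below, and 3 comes from \<open>K_minus_dg\<close>.\<close>
  have "kk * K (80 * s) * (dg (80 * u) + 3 * (80 * u)\<^sup>2) \<le> kk * K (80 * s) * K (80 * u)"
    using K_minus_dg[OF y] kz by (intro mult_left_mono) auto
  moreover have "8 * (3 * (80 * u)\<^sup>2) \<le> kk * K (80 * s) * (3 * (80 * u)\<^sup>2)"
    using kz by (intro mult_right_mono) auto
  moreover have "mu - kk * K (80 * s) * dg (80 * u) \<le> 1"
    using assms(1) by (simp add: ga_def al_u_def u_def s_def algebra_simps)
  ultimately have f1: "f \<le> 1 - 24 * (80 * u)\<^sup>2" unfolding f_def by (simp add: algebra_simps)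
  have "K (80 * u) * K (80 * s) \<le> 1 * 1" using K_bounds by (intro mult_mono) auto
  then have "kk * (K (80 * u) * K (80 * s)) \<le> kk * 1" using kk_bounds by (intro mult_left_mono) auto
  then have f0: "0 \<le> f" by (simp add: f_def mult.assoc kk_def)
  have "\<bar>f\<bar> \<le> 1" using f0 f1 zero_le_power2[of "80 * u"] by linarith
  then have e: "uu (rd (G X)) = f * u" "ss (rd (G X)) = lam * s"
    using G_in_box[of X] y z by (auto simp: f_def u_def s_def)
  show 1: "\<bar>uu (rd (G X))\<bar> \<le> (1 - 24 * (80 * u)\<^sup>2) * \<bar>u\<bar>"
    unfolding e abs_mult using f0 f1 by (intro mult_right_mono) auto
  show 2: "\<bar>ss (rd (G X))\<bar> \<le> 11/100 * \<bar>s\<bar>"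
    unfolding e abs_mult using lam_bounds by (intro mult_right_mono) auto
  have u': "\<bar>80 * uu (rd (G X))\<bar> \<le> \<bar>80 * u\<bar>"
    unfolding e abs_mult using \<open>\<bar>f\<bar> \<le> 1\<close> by (simp add: mult_left_le_one_le)
  have s': "\<bar>80 * ss (rd (G X))\<bar> \<le> \<bar>80 * s\<bar>" using 2 by (simp add: abs_mult)
  have "dg (80 * u) * K (80 * s) \<le> dg (80 * uu (rd (G X))) * K (80 * ss (rd (G X)))"
    using dg_antimono[OF u' y] K_antimono[OF s'] dpos K_bounds by (intro mult_mono) auto
  then have "kk * (dg (80 * u) * K (80 * s)) \<le> kk * (dg (80 * uu (rd (G X))) * K (80 * ss (rd (G X))))"
    using kk_bounds by (intro mult_left_mono) auto
  then show "ga (G X) \<le> 1" using assms(1) by (simp add: ga_def al_u_def u_def s_def mult.assoc)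
qed

text \<open>A derivative of at most 1 persists along the orbit, by \<open>ga_le_1_step\<close>, and
  drives the orbit to the lattice. But \<open>tau = 0\<close> persists too and keeps it outside the
  support of the bump, which contains a neighbourhood of the lattice points.\<close>

lemma ga_gt_1: assumes "tau X = 0" shows "1 < ga X"
proof (rule ccontr)
  assume "\<not> 1 < ga X"
  define V where "V X = \<bar>uu (rd X)\<bar> + \<bar>ss (rd X)\<bar>" for X
  have step: "tau (G X) = 0 \<and> ga (G X) \<le> 1 \<and> V (G X) \<le> 991/1000 * V X" and low: "nu \<le> V X"
    if X: "tau X = 0" "ga X \<le> 1" for X
  proof -
    define u s where "u = \<bar>uu (rd X)\<bar>" and "s = \<bar>ss (rd X)\<bar>"
    have "rr X = 0" using tau_zero X by blast
    then have "4 \<le> qq (uu (rd X)) (ss (rd X))" using rf_pos_iff[of "uu (rd X)" "ss (rd X)"] by (simp add: rr_def hr_def)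
    then have us: "4 * nu\<^sup>2 \<le> u\<^sup>2 + s\<^sup>2" by (simp add: qq_def u_def s_def nu_def field_simps)
    have pos: "0 \<le> u" "0 \<le> s" by (auto simp: u_def s_def)
    have big: "nu \<le> u \<or> nu \<le> s"
    proof (rule ccontr)
      assume "\<not> ?thesis"
      then have "u\<^sup>2 \<le> nu\<^sup>2" "s\<^sup>2 \<le> nu\<^sup>2" using pos by (auto intro!: power_mono)
      moreover have "0 < nu\<^sup>2" by (simp add: nu_def)
      ultimately show False using us by linarith
    qed
    then show "nu \<le> V X" using pos by (auto simp: V_def u_def s_def)
    have g: "\<bar>uu (rd (G X))\<bar> \<le> (1 - 24 * (80 * u)\<^sup>2) * u" "\<bar>ss (rd (G X))\<bar> \<le> 11/100 * s"
      using ga_le_1_step(2,3)[OF X(2)] by (simp_all add: u_def s_def power_mult_distrib)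
    have "\<bar>uu (rd (G X))\<bar> + \<bar>ss (rd (G X))\<bar> \<le> 991/1000 * (u + s)"
    proof (cases "nu \<le> u")
      case True
      then have "nu\<^sup>2 \<le> u\<^sup>2" by (intro power_mono) (auto simp: nu_def)
      \<comment> \<open>For \<open>u = nu\<close> the loss is
        \<open>24 * (80 * nu)\<^sup>2 = 96/10000\<close>.\<close>
      then have "1 - 24 * (80 * u)\<^sup>2 \<le> 991/1000" by (simp add: power_mult_distrib nu_def power_divide)
      then have "(1 - 24 * (80 * u)\<^sup>2) * u \<le> 991/1000 * u" using pos by (intro mult_right_mono) auto
      then show ?thesis using g pos by simp
    next
      case False
      then have "u \<le> s" using big by simp
      moreover have "(1 - 24 * (80 * u)\<^sup>2) * u \<le> 1 * u" using pos by (intro mult_right_mono) auto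
      ultimately show ?thesis using g pos by simp
    qed
    then show "tau (G X) = 0 \<and> ga (G X) \<le> 1 \<and> V (G X) \<le> 991/1000 * V X"
      using tau_zero X ga_le_1_step(1)[OF X(2)] by (simp add: V_def u_def s_def)
  qed
  have "V X = 0"
  \<comment> \<open>The constant sequence on \<open>nat\<close> is only a frame for a contradiction:
    the orbit brings \<open>V\<close> below \<open>nu\<close>, against \<open>low\<close>, and from
    this the step condition follows.\<close>
  proof (rule vanishing_of_contraction[where N = "{0::nat..}" and F = Suc and \<delta> = "\<lambda>n. V X" and q = "0" and C = "V X" and x = 0])
    have iter: "tau ((G ^^ n) X) = 0 \<and> ga ((G ^^ n) X) \<le> 1 \<and> V ((G ^^ n) X) \<le> (991/1000) ^ n * V X" for n
    proof (induction n)
      case 0 then show ?case using assms \<open>\<not> 1 < ga X\<close> by simp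
    next
      case (Suc n)
      have "V (G ((G ^^ n) X)) \<le> 991/1000 * V ((G ^^ n) X)" using step Suc by blast
      also have "\<dots> \<le> 991/1000 * ((991/1000) ^ n * V X)" using Suc by (intro mult_left_mono) auto
      finally show ?case using step Suc by simp
    qed
    have "(\<lambda>n. (991/1000) ^ n * V X) \<longlonglongrightarrow> 0 * V X"
      by (intro tendsto_mult LIMSEQ_power_zero tendsto_const) auto
    then have "\<forall>\<^sub>F n in sequentially. (991/1000) ^ n * V X < nu"
      using order_tendstoD(2)[of _ 0 sequentially nu] by (simp add: nu_def)
    then obtain n where "(991/1000) ^ n * V X < nu" by (auto simp: eventually_sequentially)
    then have False using iter[of n] low[of "(G ^^ n) X"] by linarith
    then show "V X = 0 \<or> Suc n \<in> {0..} \<and> V X \<le> 0 * V X" for n ..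
  qed (auto simp: V_def)
  then show False using low[of X] assms \<open>\<not> 1 < ga X\<close> by (simp add: nu_def)
qed

text \<open>Compactness of the reduced zero set turns strict expansion into uniform
  expansion.\<close>

lemma ga_gap: "\<exists>\<epsilon>>0. \<forall>X. tau X = 0 \<longrightarrow> 1 + \<epsilon> \<le> ga X"
proof -
  define S where "S = {Y \<in> cball 0 3. tau Y = 0}"
  have rdS: "rd X \<in> S" if "tau X = 0" for X
  proof -
    have "norm (rd X) \<le> (\<Sum>i\<in>UNIV. \<bar>rd X $ i\<bar>)" by (rule norm_le_l1_cart)
    also have "\<dots> \<le> (\<Sum>i\<in>(UNIV :: 3 set). 1)"
    proof (rule sum_mono)
      fix i show "\<bar>rd X $ i\<bar> \<le> 1" using rd_bound[of X i] by linarith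
    qed
    finally have "norm (rd X) \<le> 3" by simp
    moreover have "tau (rd X) = tau X" by (rule tau_proj) (simp add: rd_def rn_Ints)
    ultimately show ?thesis using that by (simp add: S_def)
  qed
  \<comment> \<open>Periodicity of \<open>ga\<close> is read off from \<open>fa\<close>, with which
    it agrees at height zero. Translation by \<open>- ww X\<close> brings \<open>X\<close> to that
    height without changing \<open>ga\<close>.\<close>
  have gr: "ga (rd X) = ga X" for X
  proof -
    define c where "c = - ww X"
    have v: "ga (X + c *\<^sub>R ew) = ga X" for X :: "real ^ 3"
      by (simp add: ga_def uu_def ss_def rd_def rn_def ew_def)
    have "torus_proj (X + c *\<^sub>R ew) = torus_proj (rd X + c *\<^sub>R ew)"
      by (simp add: torus_proj_eq_iff rd_Ints)
    note e = coeffs_proj(1)[OF this] wa_proj(1)[OF this]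
    have "wa (X + c *\<^sub>R ew) = 0" using wb_shift(1)[of "X + c *\<^sub>R ew" 0 0] by (simp add: c_def)
    then have "fa (X + c *\<^sub>R ew) = ga X" "fa (rd X + c *\<^sub>R ew) = ga (rd X)"
      using F_G(2)[of "X + c *\<^sub>R ew"] F_G(2)[of "rd X + c *\<^sub>R ew"] e v by auto
    then show ?thesis using e by simp
  qed
  have "S = cball 0 3 \<inter> tau -` {0}" by (auto simp: S_def)
  then have "compact S"
    using continuous_closed_vimage[of "{0}" tau] continuous_tau[of UNIV]
    by (auto simp: continuous_on_eq_continuous_at intro: compact_Int_closed)
  show ?thesis
  proof (cases "S = {}")
    case True then show ?thesis using rdS by (intro exI[of _ 1]) auto
  next
    case False
    have "continuous_on S ga" using continuous_gcoeffs(1) by (rule continuous_on_subset) simp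
    then obtain Y where Y: "Y \<in> S" "\<And>X. X \<in> S \<Longrightarrow> ga Y \<le> ga X"
      using continuous_attains_inf[OF \<open>compact S\<close> False] by blast
    have "1 < ga Y" using ga_gt_1 Y by (simp add: S_def)
    then show ?thesis using Y(2) rdS gr by (intro exI[of _ "ga Y - 1"]) fastforce
  qed
qed

lemma coords_rd_bound: "\<bar>uu (rd X)\<bar> \<le> 1" "\<bar>ss (rd X)\<bar> \<le> 1"
proof -
  have b: "\<bar>rd X $ 1\<bar> \<le> 1/2" "\<bar>rd X $ 2\<bar> \<le> 1/2" by (rule rd_bound)+
  have ml: "9 \<le> mu - lam" using mu_bounds lam_bounds by simp
  have "\<bar>lam * rd X $ 1\<bar> \<le> 1 * (1/2)" "\<bar>mu * rd X $ 1\<bar> \<le> 10 * (1/2)"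
    unfolding abs_mult using b mu_bounds lam_bounds by (intro mult_mono; simp)+
  then have "\<bar>rd X $ 2 - lam * rd X $ 1\<bar> \<le> mu - lam" "\<bar>mu * rd X $ 1 - rd X $ 2\<bar> \<le> mu - lam"
    using b ml by linarith+
  then show "\<bar>uu (rd X)\<bar> \<le> 1" "\<bar>ss (rd X)\<bar> \<le> 1"
    unfolding uu_def ss_def using ml by (simp_all add: abs_divide)
qed

text \<open>Lattice points near a prescribed unstable segment are images under a power of the linear
  automorphism of lattice points near the shrunken, far away preimage of the segment.\<close>

lemma long_segment_meets_lens:
  "\<exists>L. \<forall>X. \<exists>v. 0 \<le> v \<and> v \<le> L \<and> 0 < rr (X + v *\<^sub>R eu)"
proof -
  have "(\<lambda>n. lam ^ n) \<longlonglongrightarrow> 0" using lam_bounds by (intro LIMSEQ_power_zero) auto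
  then have "\<forall>\<^sub>F n in sequentially. lam ^ n < nu" by (rule order_tendstoD(2)) (simp add: nu_def)
  then obtain j where j: "lam ^ j < nu" by (auto simp: eventually_sequentially)
  have pos: "0 < lam ^ j" "0 < mu ^ j" using lam_bounds mu_bounds by auto
  have c: "uu ((Alin ^^ j) Y) = mu ^ j * uu Y" "ss ((Alin ^^ j) Y) = lam ^ j * ss Y" "ww ((Alin ^^ j) Y) = ww Y" for Y
    by (induction j) (simp_all add: mult.assoc)
  have int: "(Alin ^^ j) Y $ i \<in> \<int>" if "\<And>i. Y $ i \<in> \<int>" for Y i
  proof (induction j arbitrary: i)
    case (Suc n)
    have "Alin 0 = 0" by (rule coords_eqI) simp_all
    then show ?case using Alin_Ints[of "(Alin ^^ n) Y" 0 i] Suc by simp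
  qed (use that in simp)
  have "\<exists>v. 0 \<le> v \<and> v \<le> 2 * mu ^ j \<and> 0 < rr (X + v *\<^sub>R eu)" for X
  proof -
    \<comment> \<open>Pull the midpoint of the segment of length \<open>2 * mu ^ j\<close> back by
      \<open>Alin ^^ j\<close> and round it to the lattice. Pushed forward again, the rounding error
      of at most 1 per eigencoordinate becomes at most \<open>mu ^ j\<close> along the segment and
      less than \<open>nu\<close> across it.\<close>
    define Y where "Y = ((uu X + mu ^ j) / mu ^ j) *\<^sub>R eu + (ss X / lam ^ j) *\<^sub>R es + ww X *\<^sub>R ew"
    define k where "k = (Alin ^^ j) (rn Y)"
    have "Y = rd Y + rn Y" by (simp add: rd_def)
    then have dec: "uu Y = uu (rd Y) + uu (rn Y)" "ss Y = ss (rd Y) + ss (rn Y)" by (metis coords_add)+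
    have "uu (rn Y) = uu Y - uu (rd Y)" "ss (rn Y) = ss Y - ss (rd Y)" using dec by simp_all
    moreover have "mu \<noteq> 0" "lam \<noteq> 0" using mu_bounds lam_bounds by auto
    then have "mu ^ j * uu Y = uu X + mu ^ j" "lam ^ j * ss Y = ss X" by (simp_all add: Y_def)
    ultimately have uk: "uu k = uu X + mu ^ j - mu ^ j * uu (rd Y)" and sk: "ss k = ss X - lam ^ j * ss (rd Y)"
      by (simp_all add: k_def c right_diff_distrib)
    define v where "v = uu k - uu X"
    have "\<bar>mu ^ j * uu (rd Y)\<bar> \<le> mu ^ j * 1"
      unfolding abs_mult using coords_rd_bound[of Y] pos by (intro mult_mono) auto
    then have v: "0 \<le> v" "v \<le> 2 * mu ^ j" by (auto simp: v_def uk)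
    have "\<bar>lam ^ j * ss (rd Y)\<bar> \<le> lam ^ j * 1"
      unfolding abs_mult using coords_rd_bound[of Y] pos by (intro mult_mono) auto
    then have s: "\<bar>ss (X - k)\<bar> < nu" using j by (simp add: sk)
    define Z where "Z = X + v *\<^sub>R eu - k"
    have Z: "uu Z = 0" "\<bar>ss Z\<bar> < nu" using s by (simp_all add: Z_def v_def)
    have "(X + v *\<^sub>R eu) $ i - Z $ i \<in> \<int>" for i
      unfolding Z_def using int[of "rn Y", OF rn_Ints] by (simp add: k_def)
    then have "uu (rd (X + v *\<^sub>R eu)) = 0" "ss (rd (X + v *\<^sub>R eu)) = ss Z"
      using rd_uv[of "X + v *\<^sub>R eu" Z] Z by (auto simp: nu_def)
    moreover have "(ss Z)\<^sup>2 \<le> nu\<^sup>2" using Z by (intro power2_le_iff_abs_le[THEN iffD2]) (auto simp: nu_def)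
    ultimately have "qq (uu (rd (X + v *\<^sub>R eu))) (ss (rd (X + v *\<^sub>R eu))) \<le> 1"
      unfolding qq_def by (simp add: nu_def)
    then have "qq (uu (rd (X + v *\<^sub>R eu))) (ss (rd (X + v *\<^sub>R eu))) < 4" by simp
    then have "0 < rr (X + v *\<^sub>R eu)" by (simp add: rr_def hr_def rf_pos_iff)
    then show ?thesis using v by blast
  qed
  then show ?thesis by blast
qed

text \<open>\<open>G\<close> maps lines in direction \<open>eu\<close> to such lines and stretches
  them by at least \<open>1 + \<epsilon>\<close> where \<open>tau\<close> vanishes; zeros of
  \<open>tau\<close> go to zeros.\<close>

lemma segment_growth:
  assumes seg: "\<And>v. 0 \<le> v \<Longrightarrow> v \<le> l \<Longrightarrow> tau (X + v *\<^sub>R eu) = 0" and l: "0 \<le> l"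
    and e: "\<And>X. tau X = 0 \<Longrightarrow> 1 + \<epsilon> \<le> ga X"
    and v: "0 \<le> v" "v \<le> (1 + \<epsilon>) * l"
  shows "tau (G X + v *\<^sub>R eu) = 0"
proof -
  define \<gamma> where "\<gamma> t = uu (G (X + t *\<^sub>R eu)) - uu (G X)" for t
  have G: "G (X + t *\<^sub>R eu) = G X + \<gamma> t *\<^sub>R eu" for t
    by (rule coords_eqI) (simp_all add: \<gamma>_def)
  have d: "(\<gamma> has_real_derivative ga (X + t *\<^sub>R eu)) (at t)" for t
  proof -
    have "((\<lambda>t. uu (G (X + t *\<^sub>R eu))) has_derivative (\<lambda>h. uu ((ga (X + t *\<^sub>R eu) * uu (h *\<^sub>R eu) + gp (X + t *\<^sub>R eu) * ss (h *\<^sub>R eu)) *\<^sub>R eu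
       + (lam * ss (h *\<^sub>R eu)) *\<^sub>R es + ww (h *\<^sub>R eu) *\<^sub>R ew))) (at t)"
      by (rule has_derivative_coords(1), rule has_derivative_compose[OF _ has_derivative_G])
         (auto intro!: derivative_eq_intros)
    then have "((\<lambda>t. uu (G (X + t *\<^sub>R eu))) has_real_derivative ga (X + t *\<^sub>R eu)) (at t)"
      unfolding has_field_derivative_def by (rule has_derivative_eq_rhs) (simp add: fun_eq_iff)
    from DERIV_diff[OF this DERIV_const[of "uu (G X)"]]
    show ?thesis unfolding \<gamma>_def[abs_def] by (simp del: coords_G)
  qed
  have "\<gamma> 0 - (1 + \<epsilon>) * 0 \<le> \<gamma> l - (1 + \<epsilon>) * l"
  proof (rule DERIV_nonneg_imp_nondecreasing[OF l])
    fix t assume "0 \<le> t" "t \<le> l"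
    then have "0 \<le> ga (X + t *\<^sub>R eu) - (1 + \<epsilon>)" using e seg by simp
    moreover have "((\<lambda>t. \<gamma> t - (1 + \<epsilon>) * t) has_real_derivative ga (X + t *\<^sub>R eu) - (1 + \<epsilon>)) (at t)"
      by (auto intro!: derivative_eq_intros d)
    ultimately show "\<exists>y. ((\<lambda>t. \<gamma> t - (1 + \<epsilon>) * t) has_real_derivative y) (at t) \<and> 0 \<le> y" by blast
  qed
  moreover have "\<gamma> 0 = 0" by (simp add: \<gamma>_def)
  ultimately have "\<gamma> 0 \<le> v" "v \<le> \<gamma> l" using v by auto
  moreover have "continuous_on {0..l} \<gamma>"
    using d by (intro DERIV_continuous_on[of _ \<gamma>]) (auto intro: has_field_derivative_at_within)
  ultimately obtain t where t: "0 \<le> t" "t \<le> l" "\<gamma> t = v" using IVT'[of \<gamma> 0 v l] l by auto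
  then have "tau (G (X + t *\<^sub>R eu)) = 0" using tau_zero seg by blast
  then show ?thesis using G t by simp
qed

text \<open>A ball of zeros contains an unstable segment of zeros. Its images are segments of zeros
  whose length grows geometrically, yet every sufficiently long segment meets the disc, where
  \<open>tau\<close> is positive.\<close>

lemma tau_pos_dense: assumes "0 < e" shows "\<exists>Y. dist X Y < e \<and> 0 < tau Y"
proof (rule ccontr)
  assume "\<not> ?thesis"
  then have zero: "\<And>Y. dist X Y < e \<Longrightarrow> tau Y = 0" using tau_bounds(1) by (metis less_eq_real_def)
  obtain \<epsilon> where \<epsilon>: "0 < \<epsilon>" "\<And>X. tau X = 0 \<Longrightarrow> 1 + \<epsilon> \<le> ga X" using ga_gap by auto
  define N where "N = norm eu + 1"
  define l where "l = e / (2 * N)"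
  have N: "0 < N" "norm eu \<le> N" by (simp_all add: N_def add_nonneg_pos)
  have l: "0 < l" "l * N = e / 2" using assms N by (simp_all add: l_def)
  have *: "\<exists>Z. \<forall>v. 0 \<le> v \<and> v \<le> (1 + \<epsilon>) ^ n * l \<longrightarrow> tau (Z + v *\<^sub>R eu) = 0" for n
  proof (induction n)
    case 0
    have "tau (X + v *\<^sub>R eu) = 0" if "0 \<le> v" "v \<le> l" for v
    proof (rule zero)
      have "norm (v *\<^sub>R eu) \<le> l * N" using that N by (auto intro!: mult_mono)
      also have "\<dots> < e" unfolding l(2) using assms by simp
      finally show "dist X (X + v *\<^sub>R eu) < e" by (simp add: dist_norm)
    qed
    then show ?case by auto
  next
    case (Suc n)
    then obtain Z where "\<And>v. 0 \<le> v \<Longrightarrow> v \<le> (1 + \<epsilon>) ^ n * l \<Longrightarrow> tau (Z + v *\<^sub>R eu) = 0" by blast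
    then have "tau (G Z + v *\<^sub>R eu) = 0" if "0 \<le> v" "v \<le> (1 + \<epsilon>) * ((1 + \<epsilon>) ^ n * l)" for v
      using segment_growth[of "(1 + \<epsilon>) ^ n * l" Z \<epsilon> v] \<epsilon> l that by simp
    then show ?case by (intro exI[of _ "G Z"]) (simp add: mult.assoc)
  qed
  obtain L where L: "\<And>X. \<exists>v. 0 \<le> v \<and> v \<le> L \<and> 0 < rr (X + v *\<^sub>R eu)"
    using long_segment_meets_lens by blast
  obtain n where "L / l < (1 + \<epsilon>) ^ n" using real_arch_pow[of "1 + \<epsilon>" "L / l"] \<epsilon> by auto
  then have n: "L \<le> (1 + \<epsilon>) ^ n * l" using l by (simp add: field_simps)
  obtain Z where Z: "\<And>v. 0 \<le> v \<and> v \<le> (1 + \<epsilon>) ^ n * l \<Longrightarrow> tau (Z + v *\<^sub>R eu) = 0" using * by blast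
  obtain v where "0 \<le> v" "v \<le> L" "0 < rr (Z + v *\<^sub>R eu)" using L by blast
  then show False using Z[of v] n tau_zero[of "Z + v *\<^sub>R eu"] by simp
qed

section \<open>Functions that descend to the torus\<close>

definition periodic :: "(real ^ 'n::finite \<Rightarrow> 'b) \<Rightarrow> bool" where
  "periodic h \<longleftrightarrow> (\<forall>X Y. torus_proj X = torus_proj Y \<longrightarrow> h X = h Y)"

lemma periodicD: "periodic h \<Longrightarrow> torus_proj X = torus_proj Y \<Longrightarrow> h X = h Y"
  unfolding periodic_def by blast

lemma periodicI: "(\<And>X Y. torus_proj X = torus_proj Y \<Longrightarrow> h X = h Y) \<Longrightarrow> periodic h"
  unfolding periodic_def by blast

lemma torus_proj_Fi: "torus_proj X = torus_proj Y \<Longrightarrow> torus_proj (Fi X) = torus_proj (Fi Y)"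
  using lattice_map_Fi unfolding torus_proj_eq_iff lattice_map_def by blast

lemma periodic_F: "periodic h \<Longrightarrow> periodic (\<lambda>X. h (F X))" and periodic_Fi: "periodic h \<Longrightarrow> periodic (\<lambda>X. h (Fi X))"
  unfolding periodic_def using pj_F torus_proj_Fi by blast+

lemma wa_Fi_iff:
  "wa (Fi X) < 1/2 \<longleftrightarrow> wa X < 10" "wa (Fi X) \<le> 1/2 \<longleftrightarrow> wa X \<le> 10"
  "wa (Fi X) < 1 \<longleftrightarrow> wa X < 20" "wa (Fi X) \<le> 1 \<longleftrightarrow> wa X \<le> 20"
  "wa (Fi X) < 95/100 \<longleftrightarrow> wa X < 19" "wa (Fi X) \<le> 95/100 \<longleftrightarrow> wa X \<le> 19"
  "wa (Fi X) < 20 \<longleftrightarrow> wa X < 157/4" "wa (Fi X) \<le> 20 \<longleftrightarrow> wa X \<le> 157/4"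
  using wa_F_iff[of "Fi X"] by simp_all

text \<open>A section obtained by choice comes without periodicity. At congruent points its two
  values obey the same recursion, so their difference is bounded and contracted, hence zero.\<close>

lemma periodic_unique:
  fixes \<theta> :: "real ^ 'n::finite \<Rightarrow> 'b::real_normed_vector"
  assumes bnd: "\<And>X. X \<in> N \<Longrightarrow> norm (\<theta> X) \<le> B" and q: "0 \<le> q" "q < 1"
    and N: "\<And>X Y. torus_proj X = torus_proj Y \<Longrightarrow> X \<in> N \<Longrightarrow> Y \<in> N"
    and f: "\<And>X Y. torus_proj X = torus_proj Y \<Longrightarrow> torus_proj (f X) = torus_proj (f Y)"
    and step: "\<And>X Y. torus_proj X = torus_proj Y \<Longrightarrow> X \<in> N \<Longrightarrow> \<theta> X = \<theta> Y \<or>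
       (f X \<in> N \<and> norm (\<theta> X - \<theta> Y) \<le> q * norm (\<theta> (f X) - \<theta> (f Y)))"
    and XY: "torus_proj X = torus_proj Y" "X \<in> N"
  shows "\<theta> X = \<theta> Y"
proof -
  have "(\<lambda>(X, Y). norm (\<theta> X - \<theta> Y)) (X, Y) = 0"
  proof (rule vanishing_of_contraction[where N = "{(X, Y). torus_proj X = torus_proj Y \<and> X \<in> N}"
        and F = "\<lambda>(X, Y). (f X, f Y)" and q = q and C = "2 * B"
        and \<delta> = "\<lambda>(X, Y). norm (\<theta> X - \<theta> Y)" and x = "(X, Y)"])
    fix P assume P: "P \<in> {(X, Y). torus_proj X = torus_proj Y \<and> X \<in> N}"
    obtain X Y where p: "P = (X, Y)" by (cases P)
    with P have X: "torus_proj X = torus_proj Y" "X \<in> N" by simp_all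
    then have Y: "Y \<in> N" by (rule N)
    have "norm (\<theta> X - \<theta> Y) \<le> norm (\<theta> X) + norm (\<theta> Y)" by (rule norm_triangle_ineq4)
    then show "0 \<le> (\<lambda>(X, Y). norm (\<theta> X - \<theta> Y)) P \<and> (\<lambda>(X, Y). norm (\<theta> X - \<theta> Y)) P \<le> 2 * B"
      using bnd[OF X(2)] bnd[OF Y] by (simp add: p)
    show "(\<lambda>(X, Y). norm (\<theta> X - \<theta> Y)) P = 0 \<or>
      ((\<lambda>(X, Y). (f X, f Y)) P \<in> {(X, Y). torus_proj X = torus_proj Y \<and> X \<in> N} \<and>
       (\<lambda>(X, Y). norm (\<theta> X - \<theta> Y)) P \<le> q * (\<lambda>(X, Y). norm (\<theta> X - \<theta> Y)) ((\<lambda>(X, Y). (f X, f Y)) P))"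
      using step[OF X(1,2)] f[OF X(1)] unfolding p by simp
  qed (use q XY in simp_all)
  then show ?thesis by simp
qed

lemma closed_wa: "closed {X. wa X \<le> c}" "closed {X. c \<le> wa X}" "closed {X. c \<le> wa X \<and> wa X \<le> d}"
  by (intro closed_Collect_le closed_Collect_conj continuous_wa continuous_intros)+

lemma open_wa: "open {X. wa X < c}" "open {X. c < wa X}"
  by (intro open_Collect_less continuous_wa continuous_intros)+

subsection \<open>The center direction\<close>

text \<open>Slopes of the center direction, as \<open>eu\<close> component per unit of
  \<open>ew\<close>. From height 20 on the shear is absent and the center is vertical;
  \<open>xi1\<close> pulls this direction back by one step and \<open>xi2\<close> by two.
  \<open>x2\<close> is \<open>xi2\<close> with the sign removed.\<close>

definition xi1 :: "real ^ 3 \<Rightarrow> real" where "xi1 X = - fb X / fa X"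
definition xi2 :: "real ^ 3 \<Rightarrow> real" where "xi2 X = (fd X * xi1 (F X) - fb X) / fa X"
definition x2 :: "real ^ 3 \<Rightarrow> real" where "x2 X = (fd X * (fbp (F X) / fa (F X)) + fbp X) / fa X"

lemma fa_pos: "0 < fa X" and fd_pos: "0 < fd X"
  using fa_bounds[of X] fd_ge[of X] by auto

lemma continuous_xi: "continuous_on S xi1" "continuous_on S xi2"
proof -
  have nz: "fa X \<noteq> 0" for X using fa_pos[of X] by simp
  show "continuous_on S xi1" for S unfolding xi1_def[abs_def]
    by (intro continuous_intros) (use nz in auto)
  then have "continuous_on S (\<lambda>X. xi1 (F X))"
    by (rule continuous_on_compose2[OF _ continuous_F subset_UNIV])
  then show "continuous_on S xi2" unfolding xi2_def[abs_def]
    by (intro continuous_intros) (use nz in auto)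
qed

lemma periodic_xi: "periodic xi1" "periodic xi2"
proof -
  show 1: "periodic xi1" unfolding periodic_def
  proof (intro allI impI)
    fix X Y :: "real ^ 3" assume "torus_proj X = torus_proj Y"
    note c = coeffs_proj[OF this]
    show "xi1 X = xi1 Y" by (simp add: xi1_def c(1) c(2))
  qed
  show "periodic xi2" unfolding periodic_def
  proof (intro allI impI)
    fix X Y :: "real ^ 3" assume h: "torus_proj X = torus_proj Y"
    note c = coeffs_proj[OF h] periodicD[OF periodic_F[OF 1] h]
    show "xi2 X = xi2 Y" unfolding xi2_def c(1) c(2) c(5) c(7) by (rule refl)
  qed
qed

lemma xi2_hi: "1 \<le> wa X \<Longrightarrow> xi2 X = xi1 X"
  using wa_F_iff(3)[of X] fbp_hi[of "F X"] by (simp add: xi2_def xi1_def fb_eq not_less)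

lemma xi1_zero: "20 \<le> wa X \<Longrightarrow> xi1 X = 0"
  by (simp add: xi1_def fb_eq fbp_hi)

lemma xi2_eq: "xi2 X = - sgn (wb X) * x2 X" if "wa X < 117/2"
  using sgn_wb_F[OF that] by (simp add: xi2_def x2_def xi1_def fb_eq algebra_simps)

lemma fbp_F_le: "10 \<le> wa X \<Longrightarrow> fbp X \<le> mu"
  using mu_bounds fbp_mid[of X] fbp_end[of X] fbp_hi[of X] by (cases "wa X \<le> 19"; cases "wa X \<le> 20") auto

lemma x2_nonneg: "0 \<le> x2 X"
  using fa_pos[of X] fa_pos[of "F X"] fd_pos[of X] fbp_nonneg by (simp add: x2_def)

text \<open>Up to 95/100 the image lies on the plateau of the shear, where the center slope has
  modulus 1; between 95/100 and 1 the shear at the point itself is strong and \<open>fa\<close> is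
  at most 102/10; from 1 to 19 the quotient is exactly 1. A slope bounded away from 0 allows passage
  to its inverse.\<close>

lemma x2_lower: assumes "1/2 \<le> wa X" "wa X \<le> 19" shows "5/7 \<le> x2 X"
proof -
  consider "wa X \<le> 95/100" | "95/100 \<le> wa X" "wa X \<le> 1" | "1 \<le> wa X" by linarith
  then show ?thesis
  proof cases
    case 1
    then have w: "10 \<le> wa (F X)" "wa (F X) \<le> 19"
      using assms wa_F_iff(1)[of X] wa_F_iff(6)[of X] by linarith+
    then have "fbp (F X) = mu" "fa (F X) = mu" by (simp_all add: fbp_mid fa_hi)
    moreover have "fd X = 20" using 1 assms by (simp add: fd_20)
    ultimately have "x2 X = (20 + fbp X) / fa X" using mu_bounds by (simp add: x2_def)
    also have "\<dots> \<ge> 20 / 18"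
      using fbp_nonneg[of X] fa_bounds[of X] by (intro frac_le) auto
    finally show ?thesis by simp
  next
    case 2
    have "94/10 * (2 * wa X - 1) \<le> fbp X" using 2 by (intro fbp_start) auto
    then have "846/100 \<le> fbp X" using 2 by simp
    moreover have "0 \<le> fd X * (fbp (F X) / fa (F X))"
      using fa_pos[of "F X"] fd_pos[of X] fbp_nonneg[of "F X"] by simp
    ultimately have n: "846/100 \<le> fd X * (fbp (F X) / fa (F X)) + fbp X" by linarith
    have "846/100 / (102/10) \<le> x2 X"
      unfolding x2_def using fa_near[OF 2(1)] fa_pos[of X] n by (intro frac_le n) linarith+
    then show ?thesis by simp
  next
    case 3
    then have "fbp (F X) = 0" using wa_F_iff(3)[of X] by (intro fbp_hi) linarith
    then show ?thesis using 3 assms mu_bounds by (simp add: x2_def fbp_mid fa_hi)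
  qed
qed

lemma x2_upper: assumes "1/2 \<le> wa X" "wa X \<le> 1" shows "x2 X \<le> 93"
proof -
  have w: "10 \<le> wa (F X)" using assms wa_F_iff(1)[of X] by linarith
  then have "fbp (F X) / fa (F X) \<le> 1" using fbp_F_le[OF w] mu_bounds by (simp add: fa_hi)
  then have "fd X * (fbp (F X) / fa (F X)) + fbp X \<le> 31" using fd_20(1)[OF assms] fbp_le[of X] by simp
  then have "x2 X \<le> 31 / (1/3)"
    unfolding x2_def using fa_bounds(1)[of X] by (intro frac_le) auto
  then show ?thesis by simp
qed

lemma xi2_abs: assumes "1/2 \<le> wa X" "wa X \<le> 19" shows "5/7 \<le> \<bar>xi2 X\<bar>" "xi2 X \<noteq> 0"
proof -
  have "\<bar>sgn (wb X)\<bar> = 1" using assms by (simp add: wa_def abs_sgn_eq split: if_splits)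
  then show "5/7 \<le> \<bar>xi2 X\<bar>" using x2_lower[OF assms] xi2_eq[of X] x2_nonneg[of X] assms
    by (simp add: abs_mult)
  then show "xi2 X \<noteq> 0" by auto
qed

text \<open>The inverse slope: below height 1/2 the center is described as a graph over the
  horizontal direction. The bound 7/5 is the inverse of the 5/7 in \<open>x2_lower\<close>.\<close>

definition th :: "real ^ 3 \<Rightarrow> real" where
  "th = (SOME \<theta>. continuous_on {X. wa X \<le> 10} \<theta> \<and> (\<forall>X. 1/2 \<le> wa X \<and> wa X \<le> 10 \<longrightarrow> \<theta> X = 1 / xi2 X) \<and>
     (\<forall>X. wa X \<le> 1/2 \<longrightarrow> fa X * \<theta> (F X) = fc X + fd X * \<theta> X) \<and> (\<forall>X. wa X \<le> 10 \<longrightarrow> \<bar>\<theta> X\<bar> \<le> 7/5))"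

text \<open>A graph transform over the heights up to 1/2 with data prescribed on the fundamental
  domain from 1/2 to 10. The bound reproduces itself because \<open>9/10 * (7/5) + 1/10\<close> is
  below 7/5.\<close>

lemma th: "continuous_on {X. wa X \<le> 10} th" "1/2 \<le> wa X \<Longrightarrow> wa X \<le> 10 \<Longrightarrow> th X = 1 / xi2 X"
  "wa X \<le> 1/2 \<Longrightarrow> fa X * th (F X) = fc X + fd X * th X" "wa X \<le> 10 \<Longrightarrow> \<bar>th X\<bar> \<le> 7/5"
proof -
  define K where "K = {X. wa X \<le> 1/2}"
  define L where "L = {X. 1/2 \<le> wa X \<and> wa X \<le> 10}"
  have KL: "K \<union> L = {X. wa X \<le> 10}" by (auto simp: K_def L_def)
  have nz: "fd X \<noteq> 0" for X using fd_pos[of X] by simp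
  have "\<exists>\<theta>. continuous_on {X. wa X \<le> 10} \<theta> \<and> (\<forall>X. 1/2 \<le> wa X \<and> wa X \<le> 10 \<longrightarrow> \<theta> X = 1 / xi2 X) \<and>
     (\<forall>X. wa X \<le> 1/2 \<longrightarrow> fa X * \<theta> (F X) = fc X + fd X * \<theta> X) \<and> (\<forall>X. wa X \<le> 10 \<longrightarrow> \<bar>\<theta> X\<bar> \<le> 7/5)"
  proof (rule invariant_section[of K L F "\<lambda>X. 1 / xi2 X" "7/5" "9/10" "\<lambda>X v. (fa X * v - fc X) / fd X"])
    show "closed K" "closed L" unfolding K_def L_def by (rule closed_wa)+
    show "continuous_on K F" by (rule continuous_F)
    show "F ` K \<subseteq> K \<union> L" unfolding KL using wa_F_iff(2) by (auto simp: K_def)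
    show "F ` (K \<inter> L) \<subseteq> L"
    proof
      fix Y assume "Y \<in> F ` (K \<inter> L)"
      then obtain X where X: "Y = F X" "wa X = 1/2" by (auto simp: K_def L_def)
      then show "Y \<in> L" using wa_F_iff(1,2)[of X] by (auto simp: L_def)
    qed
    show "continuous_on L (\<lambda>X. 1 / xi2 X)"
      by (intro continuous_intros continuous_xi) (use xi2_abs in \<open>auto simp: L_def\<close>)
    show "norm (1 / xi2 X) \<le> 7/5" if "X \<in> L" for X
    proof -
      have "5/7 \<le> \<bar>xi2 X\<bar>" using that by (intro xi2_abs) (auto simp: L_def)
      then have "1 / \<bar>xi2 X\<bar> \<le> 1 / (5/7)" by (intro frac_le) auto
      then show ?thesis by simp
    qed
    have e: "(fa X * v - fc X) / fd X = (fa X / fd X) * v - fc X / fd X" for X v by (simp add: diff_divide_distrib)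
    have r: "0 \<le> fa X / fd X" "fa X / fd X \<le> 9/10" if "X \<in> K" for X
      using that ratio_lens fa_pos[of X] fd_pos[of X] by (auto simp: K_def)
    show "norm ((fa X * v - fc X) / fd X - (fa X * w - fc X) / fd X) \<le> 9/10 * norm (v - w)" if "X \<in> K" for X v w
    proof -
      define k where "k = fa X / fd X"
      have "(fa X * v - fc X) / fd X - (fa X * w - fc X) / fd X = k * (v - w)"
        unfolding e k_def[symmetric] by (simp add: algebra_simps)
      then have "norm ((fa X * v - fc X) / fd X - (fa X * w - fc X) / fd X) = k * norm (v - w)"
        using r[OF that] by (simp add: abs_mult flip: k_def)
      then show ?thesis using mult_right_mono[OF r(2)[OF that] norm_ge_zero[of "v - w"]] by (simp add: k_def)
    qed
    show "continuous_on K (\<lambda>X. (fa X * g X - fc X) / fd X)" if "continuous_on K g" for g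
      using that nz by (intro continuous_intros continuous_coeffs) auto
    show "norm ((fa X * v - fc X) / fd X) \<le> 7/5" if "X \<in> K" "norm v \<le> 7/5" for X v
    proof -
      have "\<bar>fa X / fd X * v\<bar> \<le> 9/10 * (7/5)"
        unfolding abs_mult using r[OF that(1)] that(2) by (intro mult_mono) auto
      moreover have "9/10 \<le> fd X" using that by (intro fd_lens) (auto simp: K_def)
      then have "\<bar>fc X\<bar> / fd X \<le> (9/100) / (9/10)" using fc_bound[of X] by (intro frac_le) auto
      then have "\<bar>fc X / fd X\<bar> \<le> 1/10" using fd_pos[of X] by simp
      ultimately show ?thesis unfolding e real_norm_def by linarith
    qed
    \<comment> \<open>At height exactly 1/2 both \<open>fb\<close> and \<open>fc\<close> vanish, and
      the recursion is the defining formula of \<open>xi2\<close> read for inverse slopes.\<close>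
    show "(fa X * (1 / xi2 (F X)) - fc X) / fd X = 1 / xi2 X" if "X \<in> K" "X \<in> L" for X
    proof -
      have X: "wa X = 1/2" using that by (auto simp: K_def L_def)
      then have "wa (F X) = 10" using wa_F_iff(1,2)[of X] by auto
      then have "xi2 (F X) = xi1 (F X)" "xi2 (F X) \<noteq> 0" using xi2_hi[of "F X"] xi2_abs(2)[of "F X"] by simp_all
      moreover have "fb X = 0" "fc X = 0" using X by (simp_all add: fb_eq fbp_lo fc_zero)
      ultimately show ?thesis by (simp add: xi2_def[of X] mult.commute)
    qed
    fix \<theta> assume A: "continuous_on (K \<union> L) \<theta>" "\<And>X. X \<in> L \<Longrightarrow> \<theta> X = 1 / xi2 X"
      "\<And>X. X \<in> K \<Longrightarrow> \<theta> X = (fa X * \<theta> (F X) - fc X) / fd X" "\<And>X. X \<in> K \<union> L \<Longrightarrow> norm (\<theta> X) \<le> 7/5"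
    have "fa X * \<theta> (F X) = fc X + fd X * \<theta> X" if "wa X \<le> 1/2" for X
    proof -
      have "fd X * \<theta> X = fd X * ((fa X * \<theta> (F X) - fc X) / fd X)" using A(3)[of X] that by (simp add: K_def)
      then show ?thesis using nz[of X] by simp
    qed
    moreover have "\<theta> X = 1 / xi2 X" if "1/2 \<le> wa X \<and> wa X \<le> 10" for X using A(2)[of X] that by (simp add: L_def)
    moreover have "\<bar>\<theta> X\<bar> \<le> 7/5" if "wa X \<le> 10" for X using A(4)[of X] that by (simp add: KL)
    ultimately show ?thesis using A(1)[unfolded KL] by blast
  qed (auto)
  from someI_ex[OF this] show "continuous_on {X. wa X \<le> 10} th" "1/2 \<le> wa X \<Longrightarrow> wa X \<le> 10 \<Longrightarrow> th X = 1 / xi2 X"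
    "wa X \<le> 1/2 \<Longrightarrow> fa X * th (F X) = fc X + fd X * th X" "wa X \<le> 10 \<Longrightarrow> \<bar>th X\<bar> \<le> 7/5"
    unfolding th_def by blast+
qed

lemma th_proj: assumes "torus_proj X = torus_proj Y" "wa X \<le> 10" shows "th X = th Y"
proof (rule periodic_unique[where N = "{X. wa X \<le> 10}" and f = F and B = "7/5" and q = "9/10" and \<theta> = th])
  fix X Y :: "real ^ 3" assume XY: "torus_proj X = torus_proj Y" "X \<in> {X. wa X \<le> 10}"
  note w = wa_proj(1)[OF XY(1)]
  show "Y \<in> {X. wa X \<le> 10}" using XY w by simp
  show "th X = th Y \<or> F X \<in> {X. wa X \<le> 10} \<and> norm (th X - th Y) \<le> 9/10 * norm (th (F X) - th (F Y))"
  proof (cases "wa X \<le> 1/2")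
    case False
    then show ?thesis using th(2)[of X] th(2)[of Y] XY w periodicD[OF periodic_xi(2) XY(1)] by simp
  next
    case True
    have e: "fa X * (th (F X) - th (F Y)) = fd X * (th X - th Y)"
      using th(3)[OF True] th(3)[of Y] True w coeffs_proj[OF XY(1)] by (simp add: algebra_simps)
    have "th X - th Y = fa X / fd X * (th (F X) - th (F Y))"
      using e fd_pos[of X] by (simp add: field_simps)
    then have "norm (th X - th Y) = fa X / fd X * norm (th (F X) - th (F Y))"
      using fa_pos[of X] fd_pos[of X] by (simp add: abs_mult)
    then have "norm (th X - th Y) \<le> 9/10 * norm (th (F X) - th (F Y))"
      using mult_right_mono[OF ratio_lens[OF True] norm_ge_zero[of "th (F X) - th (F Y)"]] by simp
    then show ?thesis using wa_F_iff(2)[of X] True by simp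
  qed
qed (use assms in \<open>auto dest: th(4) intro: pj_F\<close>)

subsection \<open>The unstable direction\<close>

text \<open>Slopes of the unstable direction. It is vertical up to height 10; \<open>eta1\<close> is
  its slope after the first step through the shear, where \<open>fd\<close> is 20, and
  \<open>eta2\<close> its slope after the next. \<open>h1\<close> and \<open>h2\<close> are the
  versions without sign.\<close>

definition eta1 :: "real ^ 3 \<Rightarrow> real" where "eta1 X = fb (Fi X) / 20"
definition eta2 :: "real ^ 3 \<Rightarrow> real" where "eta2 X = (fa (Fi X) * eta1 (Fi X) + fb (Fi X)) / fd (Fi X)"
definition h1 :: "real ^ 3 \<Rightarrow> real" where "h1 X = fbp (Fi X) / 20"
definition h2 :: "real ^ 3 \<Rightarrow> real" where "h2 X = (fa (Fi X) * h1 (Fi X) + fbp (Fi X)) / fd (Fi X)"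

lemma continuous_eta: "continuous_on S eta1" "continuous_on S eta2"
proof -
  have nz: "fd X \<noteq> 0" for X using fd_pos[of X] by simp
  show "continuous_on S eta1" for S unfolding eta1_def[abs_def]
    by (intro continuous_intros continuous_Fi) auto
  then have "continuous_on S (\<lambda>X. eta1 (Fi X))"
    by (rule continuous_on_compose2[OF _ continuous_Fi subset_UNIV])
  then show "continuous_on S eta2" unfolding eta2_def[abs_def]
    by (intro continuous_intros continuous_Fi) (use nz in auto)
qed

lemma periodic_eta: "periodic eta1" "periodic eta2"
proof -
  show 1: "periodic eta1" unfolding periodic_def
  proof (intro allI impI)
    fix X Y :: "real ^ 3" assume "torus_proj X = torus_proj Y"
    note c = coeffs_proj(2)[OF torus_proj_Fi[OF this]]
    show "eta1 X = eta1 Y" unfolding eta1_def c by (rule refl)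
  qed
  show "periodic eta2" unfolding periodic_def
  proof (intro allI impI)
    fix X Y :: "real ^ 3" assume h: "torus_proj X = torus_proj Y"
    note c = coeffs_proj[OF torus_proj_Fi[OF h]] periodicD[OF periodic_Fi[OF 1] h]
    show "eta2 X = eta2 Y" unfolding eta2_def c(1) c(2) c(5) c(7) by (rule refl)
  qed
qed

lemma sgn_wb_Fi: "wa X \<le> 157/4 \<Longrightarrow> sgn (wb (Fi X)) = sgn (wb X)"
  using sgn_wb_F[of "Fi X"] wa_Fi_iff(8)[of X] by simp

lemma eta2_eq: "eta2 X = sgn (wb X) * h2 X" if "wa X \<le> 157/4"
proof -
  have "wa (Fi X) \<le> 20" using that wa_Fi_iff(8) by blast
  then show ?thesis using sgn_wb_Fi[OF that] sgn_wb_Fi[of "Fi X"]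
    by (simp add: eta2_def h2_def eta1_def h1_def fb_eq algebra_simps)
qed

lemma eta_low: assumes "wa X \<le> 20" shows "eta2 X = eta1 X" "wa X \<le> 10 \<Longrightarrow> eta2 X = 0"
proof -
  have y: "wa (Fi X) \<le> 1" using assms wa_Fi_iff by blast
  then have "wa (Fi (Fi X)) \<le> 1/2" using wa_Fi_iff(2)[of "Fi X"] by simp
  then have z: "eta1 (Fi X) = 0" by (simp add: eta1_def fb_eq fbp_lo)
  show e: "eta2 X = eta1 X"
  proof (cases "wa (Fi X) \<le> 1/2")
    case True then show ?thesis by (simp add: eta2_def z) (simp add: eta1_def fb_eq fbp_lo)
  next
    case False then show ?thesis using fd_20(1)[of "Fi X"] y by (simp add: eta2_def z) (simp add: eta1_def)
  qed
  assume "wa X \<le> 10"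
  then have "wa (Fi X) \<le> 1/2" using wa_Fi_iff by blast
  then show "eta2 X = 0" unfolding e by (simp add: eta1_def fb_eq fbp_lo)
qed

lemma h1_lower: assumes "19 \<le> wa X" "wa X \<le> 20" shows "4/10 \<le> h1 X"
proof -
  have y: "95/100 \<le> wa (Fi X)" "wa (Fi X) \<le> 1" using assms wa_Fi_iff(5)[of X] wa_Fi_iff(4)[of X] by linarith+
  have "94/10 * (2 * wa (Fi X) - 1) \<le> fbp (Fi X)" using y by (intro fbp_start) auto
  then show ?thesis using y by (simp add: h1_def)
qed

lemma h_nonneg: "0 \<le> h1 X" "0 \<le> h2 X"
proof -
  show 1: "0 \<le> h1 X" for X using fbp_nonneg by (simp add: h1_def)
  show "0 \<le> h2 X" using 1[of "Fi X"] fa_pos[of "Fi X"] fd_pos[of "Fi X"] fbp_nonneg by (simp add: h2_def)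
qed

text \<open>Either the shear at the preimage still has its plateau value, or the preimage lies above
  19 and the slope acquired there, at least 4/10, is multiplied by \<open>2 * mu\<close>.\<close>

lemma h2_lower: assumes "20 \<le> wa X" "wa X \<le> 157/4" shows "4/10 \<le> h2 X"
proof -
  have y: "1 \<le> wa (Fi X)" "wa (Fi X) \<le> 20" using assms wa_Fi_iff(3)[of X] wa_Fi_iff(8)[of X] by linarith+
  have fa: "fa (Fi X) = mu" using y by (simp add: fa_hi)
  show ?thesis
  proof (cases "wa (Fi X) \<le> 19")
    case True
    have "fbp (Fi X) = mu" using True y by (simp add: fbp_mid)
    then have "mu / 20 \<le> h2 X"
      unfolding h2_def fa using fd_le[of "Fi X"] fd_pos[of "Fi X"] y h_nonneg(1)[of "Fi X"] mu_bounds
      by (intro frac_le) auto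
    then show ?thesis using mu_bounds by simp
  next
    case False
    have "4/10 \<le> h1 (Fi X)" using y False by (intro h1_lower) auto
    then have "mu * (4/10) \<le> mu * h1 (Fi X)" using mu_bounds by simp
    moreover have fd: "fd (Fi X) = 1/2" using False by (intro fd_half) auto
    have "h2 X = 2 * (mu * h1 (Fi X) + fbp (Fi X))" unfolding h2_def fa fd by simp
    ultimately have "2 * (mu * (4/10)) \<le> h2 X" using fbp_nonneg[of "Fi X"] by (simp add: distrib_left)
    then show ?thesis using mu_bounds by simp
  qed
qed

lemma eta2_lower: assumes "20 \<le> wa X" "wa X \<le> 157/4" shows "4/10 \<le> \<bar>eta2 X\<bar>" "eta2 X \<noteq> 0"
proof -
  have "\<bar>sgn (wb X)\<bar> = 1" using assms by (simp add: wa_def abs_sgn_eq split: if_splits)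
  then show "4/10 \<le> \<bar>eta2 X\<bar>" using h2_lower[OF assms] eta2_eq[of X] h_nonneg(2)[of X] assms
    by (simp add: abs_mult)
  then show "eta2 X \<noteq> 0" by auto
qed

definition ze :: "real ^ 3 \<Rightarrow> real" where
  "ze = (SOME \<theta>. continuous_on {X. 20 \<le> wa X} \<theta> \<and> (\<forall>X. 20 \<le> wa X \<and> wa X \<le> 157/4 \<longrightarrow> \<theta> X = 1 / eta2 X) \<and>
     (\<forall>X. 157/4 \<le> wa X \<longrightarrow> \<theta> X = \<theta> (Fi X) / (2 * mu)) \<and> (\<forall>X. 20 \<le> wa X \<longrightarrow> \<bar>\<theta> X\<bar> \<le> 10))"

text \<open>From height 20 on the plane block is diagonal with entries \<open>mu\<close> and 1/2, so
  each forward step divides the inverse slope by \<open>2 * mu\<close>. The graph transform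
  therefore runs along \<open>Fi\<close>, with data on the fundamental domain from 20 to
  157/4.\<close>

lemma ze: "continuous_on {X. 20 \<le> wa X} ze" "20 \<le> wa X \<Longrightarrow> wa X \<le> 157/4 \<Longrightarrow> ze X = 1 / eta2 X"
  "157/4 \<le> wa X \<Longrightarrow> ze X = ze (Fi X) / (2 * mu)" "20 \<le> wa X \<Longrightarrow> \<bar>ze X\<bar> \<le> 10"
proof -
  define K where "K = {X. 157/4 \<le> wa X}"
  define L where "L = {X. 20 \<le> wa X \<and> wa X \<le> 157/4}"
  have KL: "K \<union> L = {X. 20 \<le> wa X}" by (auto simp: K_def L_def)
  have "\<exists>\<theta>. continuous_on {X. 20 \<le> wa X} \<theta> \<and> (\<forall>X. 20 \<le> wa X \<and> wa X \<le> 157/4 \<longrightarrow> \<theta> X = 1 / eta2 X) \<and>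
     (\<forall>X. 157/4 \<le> wa X \<longrightarrow> \<theta> X = \<theta> (Fi X) / (2 * mu)) \<and> (\<forall>X. 20 \<le> wa X \<longrightarrow> \<bar>\<theta> X\<bar> \<le> 10)"
  proof (rule invariant_section[of K L Fi "\<lambda>X. 1 / eta2 X" 10 "1/10" "\<lambda>X v. v / (2 * mu)"])
    show "closed K" "closed L" unfolding K_def L_def by (rule closed_wa)+
    show "continuous_on K Fi" by (rule continuous_Fi)
    show "Fi ` K \<subseteq> K \<union> L" unfolding KL using wa_Fi_iff(7) by (auto simp: K_def not_less[symmetric])
    show "Fi ` (K \<inter> L) \<subseteq> L"
    proof
      fix Y assume "Y \<in> Fi ` (K \<inter> L)"
      then obtain X where X: "Y = Fi X" "wa X = 157/4" by (auto simp: K_def L_def)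
      then show "Y \<in> L" using wa_Fi_iff(7,8)[of X] by (auto simp: L_def)
    qed
    show "continuous_on L (\<lambda>X. 1 / eta2 X)"
      by (intro continuous_intros continuous_eta) (use eta2_lower in \<open>auto simp: L_def\<close>)
    show "norm (1 / eta2 X) \<le> 10" if "X \<in> L" for X
    proof -
      have "4/10 \<le> \<bar>eta2 X\<bar>" using that by (intro eta2_lower) (auto simp: L_def)
      then have "1 / \<bar>eta2 X\<bar> \<le> 1 / (4/10)" by (intro frac_le) auto
      then show ?thesis by simp
    qed
    have m: "1 / (2 * mu) \<le> 1/10" using mu_bounds by (simp add: field_simps)
    show "norm (v / (2 * mu) - w / (2 * mu)) \<le> 1/10 * norm (v - w)" for v w :: real
    proof -
      have "norm (v / (2 * mu) - w / (2 * mu)) = 1 / (2 * mu) * norm (v - w)"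
        using mu_bounds by (simp add: abs_mult flip: diff_divide_distrib)
      then show ?thesis using mult_right_mono[OF m, of "norm (v - w)"] by simp
    qed
    show "continuous_on K (\<lambda>X. g X / (2 * mu))" if "continuous_on K g" for g
      using that mu_bounds by (intro continuous_intros) auto
    show "norm (v / (2 * mu)) \<le> 10" if "norm v \<le> 10" for v :: real
    proof -
      have "norm (v / (2 * mu)) = 1 / (2 * mu) * norm v" using mu_bounds by (simp add: abs_mult)
      also have "\<dots> \<le> 1/10 * 10" using m that mu_bounds by (intro mult_mono) auto
      finally show ?thesis by simp
    qed
    show "1 / eta2 (Fi X) / (2 * mu) = 1 / eta2 X" if "X \<in> K" "X \<in> L" for X
    proof -
      have "wa X = 157/4" using that by (auto simp: K_def L_def)
      then have y: "wa (Fi X) = 20" using wa_Fi_iff(7,8)[of X] by auto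
      then have "eta2 X = 2 * mu * eta1 (Fi X)"
        by (simp add: eta2_def fa_hi fd_half fb_eq fbp_hi)
      moreover have "eta1 (Fi X) = eta2 (Fi X)" using y eta_low(1) by simp
      ultimately show ?thesis by simp
    qed
    fix \<theta> assume A: "continuous_on (K \<union> L) \<theta>" "\<And>X. X \<in> L \<Longrightarrow> \<theta> X = 1 / eta2 X"
      "\<And>X. X \<in> K \<Longrightarrow> \<theta> X = \<theta> (Fi X) / (2 * mu)" "\<And>X. X \<in> K \<union> L \<Longrightarrow> norm (\<theta> X) \<le> 10"
    have "\<theta> X = 1 / eta2 X" if "20 \<le> wa X \<and> wa X \<le> 157/4" for X using A(2)[of X] that by (simp add: L_def)
    moreover have "\<theta> X = \<theta> (Fi X) / (2 * mu)" if "157/4 \<le> wa X" for X using A(3)[of X] that by (simp add: K_def)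
    moreover have "\<bar>\<theta> X\<bar> \<le> 10" if "20 \<le> wa X" for X using A(4)[of X] that by (simp add: KL)
    ultimately show ?thesis using A(1)[unfolded KL] by blast
  qed auto
  from someI_ex[OF this] show "continuous_on {X. 20 \<le> wa X} ze" "20 \<le> wa X \<Longrightarrow> wa X \<le> 157/4 \<Longrightarrow> ze X = 1 / eta2 X"
    "157/4 \<le> wa X \<Longrightarrow> ze X = ze (Fi X) / (2 * mu)" "20 \<le> wa X \<Longrightarrow> \<bar>ze X\<bar> \<le> 10"
    unfolding ze_def by blast+
qed

lemma ze_proj: assumes "torus_proj X = torus_proj Y" "20 \<le> wa X" shows "ze X = ze Y"
proof (rule periodic_unique[where N = "{X. 20 \<le> wa X}" and f = Fi and B = "10" and q = "1/10" and \<theta> = ze])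
  fix X Y :: "real ^ 3" assume XY: "torus_proj X = torus_proj Y" "X \<in> {X. 20 \<le> wa X}"
  note w = wa_proj(1)[OF XY(1)]
  show "Y \<in> {X. 20 \<le> wa X}" using XY w by simp
  show "ze X = ze Y \<or> Fi X \<in> {X. 20 \<le> wa X} \<and> norm (ze X - ze Y) \<le> 1/10 * norm (ze (Fi X) - ze (Fi Y))"
  proof (cases "wa X \<le> 157/4")
    case True
    then show ?thesis using ze(2)[of X] ze(2)[of Y] XY w periodicD[OF periodic_eta(2) XY(1)] by simp
  next
    case False
    have e: "ze X = ze (Fi X) / (2 * mu)" "ze Y = ze (Fi Y) / (2 * mu)"
      using ze(3) False w by simp_all
    have "norm (ze X - ze Y) = 1 / (2 * mu) * norm (ze (Fi X) - ze (Fi Y))"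
      unfolding e using mu_bounds by (simp add: abs_mult flip: diff_divide_distrib)
    moreover have "1 / (2 * mu) \<le> 1/10" using mu_bounds by (simp add: field_simps)
    ultimately show ?thesis
      using False wa_Fi_iff(7)[of X] mult_right_mono[of "1 / (2 * mu)" "1/10" "norm (ze (Fi X) - ze (Fi Y))"] by auto
  qed
qed (use assms in \<open>auto dest: ze(4) intro: torus_proj_Fi\<close>)

subsection \<open>The stable direction\<close>

text \<open>The inverse of the plane block applied to \<open>lam * v - (fp, fq)\<close>. A fixed
  section consists of the two slopes of an invariant direction that is multiplied by
  \<open>lam\<close>.\<close>

definition SS :: "real ^ 3 \<Rightarrow> real \<times> real \<Rightarrow> real \<times> real" where
  "SS X v = ((lam * fst v - fp X) / fa X - (fb X / (fa X * fd X)) * (lam * snd v - fq X),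
             (lam * snd v - fq X) / fd X - (fc X / (fa X * fd X)) * (lam * fst v - fp X))"

lemma fb_ratio: "\<bar>fb X / (fa X * fd X)\<bar> \<le> 2"
proof -
  have fb: "\<bar>fb X\<bar> \<le> fbp X" using fbp_nonneg[of X] by (simp add: fb_eq abs_mult sgn_real_def)
  have "fbp X \<le> 2 * (fa X * fd X)"
  proof -
    consider "wa X \<le> 1/2" | "1/2 \<le> wa X" "wa X \<le> 1" | "1 \<le> wa X" by linarith
    then show ?thesis
    proof cases
      case 1 then show ?thesis using fa_pos[of X] fd_pos[of X] by (simp add: fbp_lo)
    next
      case 2
      then show ?thesis using fbp_le[of X] fd_20(1)[OF 2] fa_bounds[of X] by simp
    next
      case 3
      have "fbp X \<le> mu"
        using 3 fbp_F_le[of X] by (cases "wa X \<le> 19") (auto simp: fbp_mid)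
      moreover have "mu * (1/2) \<le> mu * fd X" using fd_ge[of X] mu_bounds by (intro mult_left_mono) auto
      ultimately show ?thesis using 3 by (simp add: fa_hi)
    qed
  qed
  then show ?thesis using fb fa_pos[of X] fd_pos[of X] by (simp add: abs_mult abs_divide field_simps)
qed

lemma fc_ratio: "\<bar>fc X / (fa X * fd X)\<bar> \<le> 3/10"
proof (cases "1/2 \<le> wa X")
  case False
  have "1/3 * (9/10) \<le> fa X * fd X" using False fa_bounds[of X] fd_lens(1)[of X] by (intro mult_mono) auto
  then have "\<bar>fc X\<bar> / (fa X * fd X) \<le> (9/100) / (1/3 * (9/10))"
    using fc_bound[of X] by (intro frac_le) auto
  then show ?thesis using fa_pos[of X] fd_pos[of X] by (simp add: abs_mult)
qed (simp add: fc_zero)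

text \<open>The factor \<open>lam\<close> outweighs the inverse of the plane block: the squared
  Frobenius norm of their product stays below 1/4.\<close>

lemma SS_contract: "norm (SS X v - SS X w) \<le> 1/2 * norm (v - w)"
proof -
  define x y where "x = fst v - fst w" and "y = snd v - snd w"
  define a b c d where "a = lam / fa X" and "b = - lam * (fb X / (fa X * fd X))"
    and "c = - lam * (fc X / (fa X * fd X))" and "d = lam / fd X"
  have e: "SS X v - SS X w = (a * x + b * y, c * x + d * y)"
  proof -
    define B C where "B = fb X / (fa X * fd X)" and "C = fc X / (fa X * fd X)"
    show ?thesis unfolding SS_def a_def b_def c_def d_def x_def y_def B_def[symmetric] C_def[symmetric]
      by (simp add: diff_divide_distrib right_diff_distrib)
  qed
  have l: "0 \<le> lam" "lam \<le> 11/100" using lam_bounds by auto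
  have a: "\<bar>a\<bar> \<le> 33/100"
    using l fa_bounds[of X] frac_le[of "11/100" lam "1/3" "fa X"] by (simp add: a_def)
  have d: "\<bar>d\<bar> \<le> 22/100"
    using l fd_ge[of X] frac_le[of "11/100" lam "1/2" "fd X"] by (simp add: d_def)
  have "\<bar>b\<bar> \<le> 11/100 * 2" unfolding b_def abs_mult abs_minus_cancel using l fb_ratio[of X] by (intro mult_mono) auto
  then have b: "\<bar>b\<bar> \<le> 22/100" by simp
  have "\<bar>c\<bar> \<le> 11/100 * (3/10)" unfolding c_def abs_mult abs_minus_cancel using l fc_ratio[of X] by (intro mult_mono) auto
  then have c: "\<bar>c\<bar> \<le> 33/1000" by simp
  have sq: "a\<^sup>2 \<le> (33/100)\<^sup>2" "b\<^sup>2 \<le> (22/100)\<^sup>2" "c\<^sup>2 \<le> (33/1000)\<^sup>2" "d\<^sup>2 \<le> (22/100)\<^sup>2"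
    using power_mono[OF a, of 2] power_mono[OF b, of 2] power_mono[OF c, of 2] power_mono[OF d, of 2] by auto
  have cs: "(p * x + q * y)\<^sup>2 \<le> (p\<^sup>2 + q\<^sup>2) * (x\<^sup>2 + y\<^sup>2)" for p q :: real
  proof -
    have "0 \<le> (p * y - q * x)\<^sup>2" by simp
    then show ?thesis by (simp add: power2_eq_square algebra_simps)
  qed
  have "(norm (SS X v - SS X w))\<^sup>2 = (a * x + b * y)\<^sup>2 + (c * x + d * y)\<^sup>2"
    unfolding e norm_Pair by simp
  also have "\<dots> \<le> (a\<^sup>2 + b\<^sup>2) * (x\<^sup>2 + y\<^sup>2) + (c\<^sup>2 + d\<^sup>2) * (x\<^sup>2 + y\<^sup>2)" by (intro add_mono cs)
  also have "\<dots> = (a\<^sup>2 + b\<^sup>2 + c\<^sup>2 + d\<^sup>2) * (x\<^sup>2 + y\<^sup>2)" by (simp add: algebra_simps)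
  also have "\<dots> \<le> (1/4) * (x\<^sup>2 + y\<^sup>2)"
    using sq by (intro mult_right_mono) (auto simp: power2_eq_square)
  also have "x\<^sup>2 + y\<^sup>2 = (norm (v - w))\<^sup>2" by (simp add: norm_prod_def x_def y_def)
  also have "1/4 * (norm (v - w))\<^sup>2 = (1/2 * norm (v - w))\<^sup>2" by (simp add: power_mult_distrib power_divide)
  finally show ?thesis by (rule power2_le_imp_le) simp
qed

text \<open>Compactness suffices: \<open>fq\<close> influences the size of the stable slopes only,
  which the weight in the metric will absorb.\<close>

lemma fq_bounded: "\<exists>Q>0. \<forall>X. \<bar>fq X\<bar> \<le> Q"
proof -
  have "\<exists>C>0. \<forall>X. \<bar>Dhp (rd X) es\<bar> \<le> C" by (rule bounded_rd[OF continuous_Dhp])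
  then show ?thesis by (simp add: Dhp_def Dhr_def fq_def rr_def wb_def)
qed

lemma SS_bounded: "\<exists>C>0. \<forall>X. norm (SS X 0) \<le> C"
proof -
  obtain Q where Q: "0 < Q" "\<And>X. \<bar>fq X\<bar> \<le> Q" using fq_bounded by blast
  have "norm (SS X 0) \<le> (21 + 2 * Q) + (2 * Q + 3/10 * 7)" for X
  proof -
    define p q r s where "p = fp X / fa X" and "q = fq X / fd X"
      and "r = fb X / (fa X * fd X) * fq X" and "s = fc X / (fa X * fd X) * fp X"
    have "\<bar>r\<bar> \<le> 2 * Q" unfolding r_def abs_mult[of _ "fq X"]
      using fb_ratio[of X] Q by (intro mult_mono) auto
    moreover have "\<bar>s\<bar> \<le> 3/10 * 7" unfolding s_def abs_mult[of _ "fp X"]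
      using fc_ratio[of X] fp_bound[of X] by (intro mult_mono) auto
    moreover have "\<bar>p\<bar> \<le> 7 / (1/3)" unfolding p_def abs_divide using fp_bound[of X] fa_bounds[of X] by (intro frac_le) auto
    moreover have "\<bar>q\<bar> \<le> Q / (1/2)" unfolding q_def abs_divide using Q fd_ge[of X] by (intro frac_le) auto
    ultimately have "\<bar>- p + r\<bar> \<le> 21 + 2 * Q" "\<bar>- q + s\<bar> \<le> 2 * Q + 3/10 * 7"
      by (simp_all add: abs_if split: if_splits)
    moreover have e: "SS X 0 = (- p + r, - q + s)" by (simp add: SS_def p_def q_def r_def s_def)
    ultimately show ?thesis unfolding e
      by (intro order_trans[OF norm_Pair_le] add_mono) (simp_all only: real_norm_def)
  qed
  then show ?thesis using Q by (intro exI[of _ "(21 + 2 * Q) + (2 * Q + 3/10 * 7)"]) auto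
qed

definition si :: "real ^ 3 \<Rightarrow> real \<times> real" where
  "si = (SOME \<theta>. continuous_on UNIV \<theta> \<and> (\<forall>X. \<theta> X = SS X (\<theta> (F X))) \<and> (\<exists>C>0. \<forall>X. norm (\<theta> X) \<le> C))"

lemma si: "continuous_on UNIV si" "si X = SS X (si (F X))" "\<exists>C>0. \<forall>X. norm (si X) \<le> C"
proof -
  obtain C where C: "0 < C" "\<And>X. norm (SS X 0) \<le> C" using SS_bounded by blast
  have nz: "fa X \<noteq> 0" "fd X \<noteq> 0" for X using fa_pos[of X] fd_pos[of X] by simp_all
  have "\<exists>\<theta>. continuous_on UNIV \<theta> \<and> (\<forall>X. \<theta> X = SS X (\<theta> (F X))) \<and> (\<exists>C>0. \<forall>X. norm (\<theta> X) \<le> C)"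
  proof (rule invariant_section[of UNIV "{}" F undefined "2 * C" "1/2" SS])
    fix \<theta> assume "continuous_on (UNIV \<union> {}) \<theta>" "\<And>X. X \<in> UNIV \<Longrightarrow> \<theta> X = SS X (\<theta> (F X))"
      "\<And>X. X \<in> UNIV \<union> {} \<Longrightarrow> norm (\<theta> X) \<le> 2 * C"
    moreover have "0 < 2 * C" using C by simp
    ultimately show ?thesis unfolding Un_empty_right by blast
  next
    show "norm (SS X v) \<le> 2 * C" if "norm v \<le> 2 * C" for X v
    proof -
      have "norm (SS X v) \<le> norm (SS X v - SS X 0) + norm (SS X 0)" using norm_triangle_sub by (metis add.commute)
      also have "norm (SS X v - SS X 0) \<le> 1/2 * norm (v - 0)" by (rule SS_contract)
      finally show ?thesis using C(2)[of X] that by simp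
    qed
    show "continuous_on UNIV (\<lambda>X. SS X (g X))" if "continuous_on UNIV g" for g
      unfolding SS_def using that nz by (intro continuous_intros continuous_coeffs) auto
  qed (use C continuous_F SS_contract in \<open>simp_all\<close>)
  from someI_ex[OF this] show "continuous_on UNIV si" "si X = SS X (si (F X))" "\<exists>C>0. \<forall>X. norm (si X) \<le> C"
    unfolding si_def by blast+
qed

lemma si_proj: assumes "torus_proj X = torus_proj Y" shows "si X = si Y"
proof -
  obtain C where C: "\<And>X. norm (si X) \<le> C" using si(3) by blast
  show ?thesis
  proof (rule periodic_unique[where N = UNIV and f = F and B = C and q = "1/2" and \<theta> = si])
    fix X Y :: "real ^ 3" assume XY: "torus_proj X = torus_proj Y"
    have "SS X = SS Y" using coeffs_proj[OF XY] by (simp add: SS_def fun_eq_iff)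
    then have "norm (si X - si Y) \<le> 1/2 * norm (si (F X) - si (F Y))"
      using SS_contract[of X "si (F X)" "si (F Y)"] by (subst (1 2) si(2)) simp
    then show "si X = si Y \<or> F X \<in> UNIV \<and> norm (si X - si Y) \<le> 1/2 * norm (si (F X) - si (F Y))" by simp
  qed (use assms in \<open>auto intro: C pj_F\<close>)
qed

lemma si_invariant:
  "fa X * fst (si X) + fp X + fb X * snd (si X) = lam * fst (si (F X))"
  "fc X * fst (si X) + fq X + fd X * snd (si X) = lam * snd (si (F X))"
proof -
  have nz: "fa X \<noteq> 0" "fd X \<noteq> 0" "fb X * fc X = 0" using fa_pos[of X] fd_pos[of X] fd_fa_fb_fc[of X] by simp_all
  define p q where "p = lam * fst (si (F X)) - fp X" and "q = lam * snd (si (F X)) - fq X"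
  have s: "fst (si X) = p / fa X - fb X / (fa X * fd X) * q" "snd (si X) = q / fd X - fc X / (fa X * fd X) * p"
    using arg_cong[OF si(2)[of X], of fst] arg_cong[OF si(2)[of X], of snd] by (simp_all add: SS_def p_def q_def)
  have "fa X * (p / fa X - fb X / (fa X * fd X) * q) = p - fb X * q / fd X"
    "fb X * (q / fd X - fc X / (fa X * fd X) * p) = fb X * q / fd X - (fb X * fc X) / (fa X * fd X) * p"
    "fc X * (p / fa X - fb X / (fa X * fd X) * q) = fc X * p / fa X - (fb X * fc X) / (fa X * fd X) * q"
    "fd X * (q / fd X - fc X / (fa X * fd X) * p) = q - fc X * p / fa X"
    using nz(1,2) by (simp_all add: right_diff_distrib)
  note e = this[unfolded nz(3)]
  have "fa X * fst (si X) + fb X * snd (si X) = p" unfolding s e by simp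
  then show "fa X * fst (si X) + fp X + fb X * snd (si X) = lam * fst (si (F X))" by (simp add: p_def)
  have "fc X * fst (si X) + fd X * snd (si X) = q" unfolding s e by simp
  then show "fc X * fst (si X) + fq X + fd X * snd (si X) = lam * snd (si (F X))" by (simp add: q_def)
qed

subsection \<open>The three line fields\<close>

definition ws :: "real ^ 3 \<Rightarrow> real ^ 3" where
  "ws X = es + fst (si X) *\<^sub>R eu + snd (si X) *\<^sub>R ew"

text \<open>The normalisation changes at height 1/2, as does that of \<open>wu\<close> at height 20,
  but the spanned line does not jump: \<open>wc_mid\<close> and \<open>wu_mid\<close> show the two
  normalisations to be proportional on an overlap.\<close>

definition wc :: "real ^ 3 \<Rightarrow> real ^ 3" where
  "wc X = (if wa X \<le> 1/2 then eu + th X *\<^sub>R ew else xi2 X *\<^sub>R eu + ew)"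

definition wu :: "real ^ 3 \<Rightarrow> real ^ 3" where
  "wu X = (if wa X \<le> 20 then eta2 X *\<^sub>R eu + ew else eu + ze X *\<^sub>R ew)"

lemma coords_ws [simp]: "uu (ws X) = fst (si X)" "ss (ws X) = 1" "ww (ws X) = snd (si X)"
  by (simp_all add: ws_def)

lemma ss_wc [simp]: "ss (wc X) = 0" and ss_wu [simp]: "ss (wu X) = 0"
  by (simp_all add: wc_def wu_def)

lemma wc_lens: "wa X \<le> 1/2 \<Longrightarrow> wc X = eu + th X *\<^sub>R ew"
  and wc_far: "1/2 < wa X \<Longrightarrow> wc X = xi2 X *\<^sub>R eu + ew"
  and wu_low: "wa X \<le> 20 \<Longrightarrow> wu X = eta2 X *\<^sub>R eu + ew"
  and wu_high: "20 < wa X \<Longrightarrow> wu X = eu + ze X *\<^sub>R ew"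
  by (simp_all add: wc_def wu_def)

lemma wc_mid: assumes "1/2 < wa X" "wa X \<le> 10" shows "eu + th X *\<^sub>R ew = th X *\<^sub>R wc X" "th X \<noteq> 0"
  using th(2)[of X] xi2_abs(2)[of X] assms by (auto intro!: coords_eqI simp: wc_far)

lemma wu_mid: assumes "20 < wa X" "wa X \<le> 157/4" shows "eta2 X *\<^sub>R eu + ew = eta2 X *\<^sub>R wu X" "eta2 X \<noteq> 0"
  using ze(2)[of X] eta2_lower(2)[of X] assms by (auto intro!: coords_eqI simp: wu_high)

lemma DF_wc_lens: assumes "wa X \<le> 1/2" shows "DF X (wc X) = fa X *\<^sub>R (eu + th (F X) *\<^sub>R ew)"
  by (rule coords_eqI) (use assms th(3)[OF assms] in \<open>simp_all add: wc_lens fb_eq fbp_lo\<close>)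

lemma DF_wc_far: assumes "1/2 < wa X" shows "DF X (wc X) = fd X *\<^sub>R (xi1 (F X) *\<^sub>R eu + ew)"
  by (rule coords_eqI) (use assms fa_pos[of X] in \<open>simp_all add: wc_far fc_zero xi2_def\<close>)

lemma DF_wu_low: assumes "wa X \<le> 20" shows "DF X (wu X) = fd X *\<^sub>R (eta2 (F X) *\<^sub>R eu + ew)"
proof (rule coords_eqI)
  have e: "eta2 X = eta1 X" using eta_low(1) assms by blast
  have c: "fc X * eta2 X = 0" using eta_low(2)[of X] fc_zero(1)[of X] assms by (cases "wa X \<le> 10") auto
  show "uu (DF X (wu X)) = uu (fd X *\<^sub>R (eta2 (F X) *\<^sub>R eu + ew))"
    using assms fd_pos[of X] e by (simp add: wu_low eta2_def)
  show "ww (DF X (wu X)) = ww (fd X *\<^sub>R (eta2 (F X) *\<^sub>R eu + ew))"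
    using assms c by (simp add: wu_low)
qed (use assms in \<open>simp add: wu_low\<close>)

lemma DF_wu_high: assumes "20 < wa X" shows "DF X (wu X) = mu *\<^sub>R (eu + ze (F X) *\<^sub>R ew)"
proof -
  have "157/4 \<le> wa (F X)" using assms wa_F_iff(7)[of X] by (simp add: not_less[symmetric])
  then have "ze (F X) = ze X / (2 * mu)" using ze(3)[of "F X"] by simp
  then show ?thesis using assms mu_bounds
    by (intro coords_eqI) (simp_all add: wu_high fc_zero fa_hi fd_half fb_eq fbp_hi)
qed

lemma DF_ws: "DF X (ws X) = lam *\<^sub>R ws (F X)"
  by (rule coords_eqI) (use si_invariant[of X] in simp_all)

lemma DF_wc: "\<exists>c. c \<noteq> 0 \<and> DF X (wc X) = c *\<^sub>R wc (F X)"
proof (cases "wa X \<le> 1/2")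
  case True
  then have w: "wa (F X) \<le> 10" using wa_F_iff(2)[of X] by simp
  show ?thesis
  proof (cases "wa (F X) \<le> 1/2")
    case True
    then show ?thesis using DF_wc_lens[OF \<open>wa X \<le> 1/2\<close>] fa_pos[of X] by (auto simp: wc_lens intro!: exI[of _ "fa X"])
  next
    case False
    then show ?thesis using DF_wc_lens[OF \<open>wa X \<le> 1/2\<close>] wc_mid[of "F X"] w fa_pos[of X]
      by (intro exI[of _ "fa X * th (F X)"]) auto
  qed
next
  case False
  then have w: "10 \<le> wa (F X)" using wa_F_iff(2)[of X] by linarith
  then show ?thesis using DF_wc_far[of X] False wc_far[of "F X"] xi2_hi[of "F X"] fd_pos[of X]
    by (intro exI[of _ "fd X"]) auto
qed

lemma DF_wu: "\<exists>c. c \<noteq> 0 \<and> DF X (wu X) = c *\<^sub>R wu (F X)"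
proof (cases "wa X \<le> 20")
  case True
  then have w: "wa (F X) \<le> 157/4" using wa_F_iff(8)[of X] by simp
  show ?thesis
  proof (cases "wa (F X) \<le> 20")
    case True
    then show ?thesis using DF_wu_low[OF \<open>wa X \<le> 20\<close>] fd_pos[of X] by (auto simp: wu_low intro!: exI[of _ "fd X"])
  next
    case False
    then show ?thesis using DF_wu_low[OF \<open>wa X \<le> 20\<close>] wu_mid[of "F X"] w fd_pos[of X]
      by (intro exI[of _ "fd X * eta2 (F X)"]) auto
  qed
next
  case False
  then have "157/4 \<le> wa (F X)" using wa_F_iff(8)[of X] by linarith
  then show ?thesis using DF_wu_high[of X] False wu_high[of "F X"] mu_bounds
    by (intro exI[of _ mu]) auto
qed

lemma periodic_frames: "periodic ws" "periodic wc" "periodic wu"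
proof -
  show "periodic ws"
  proof (rule periodicI)
    fix X Y :: "real ^ 3" assume h: "torus_proj X = torus_proj Y"
    show "ws X = ws Y" unfolding ws_def si_proj[OF h] by (rule refl)
  qed
  show "periodic wc"
  proof (rule periodicI)
    fix X Y :: "real ^ 3" assume h: "torus_proj X = torus_proj Y"
    note w = wa_proj(1)[OF h]
    show "wc X = wc Y"
      using w th_proj[OF h] periodicD[OF periodic_xi(2) h] by (cases "wa X \<le> 1/2") (auto simp: wc_def)
  qed
  show "periodic wu"
  proof (rule periodicI)
    fix X Y :: "real ^ 3" assume h: "torus_proj X = torus_proj Y"
    note w = wa_proj(1)[OF h]
    show "wu X = wu Y"
      using w ze_proj[OF h] periodicD[OF periodic_eta(2) h] by (cases "wa X \<le> 20") (auto simp: wu_def)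
  qed
qed

definition line_field :: "(real ^ 3 \<Rightarrow> real ^ 3) \<Rightarrow> 3 torus \<Rightarrow> (real ^ 3) set" where
  "line_field w p = span {w (torus_rep p)}"

lemma line_field_proj: "periodic w \<Longrightarrow> line_field w (torus_proj X) = span {w X}"
  unfolding line_field_def using periodicD[of w "torus_rep (torus_proj X)" X] by simp

lemma span_singleton_scaleR: "c \<noteq> 0 \<Longrightarrow> span {c *\<^sub>R v} = span {v :: real ^ 'n}"
proof -
  assume c: "c \<noteq> 0"
  have "v = inverse c *\<^sub>R (c *\<^sub>R v)" using c by simp
  then have "v \<in> span {c *\<^sub>R v}" by (metis span_base span_scale singletonI)
  then show ?thesis by (intro span_eq[THEN iffD2]) (auto intro: span_base span_scale)
qed

text \<open>Continuity is required of \<open>s\<close> and not of \<open>w\<close>; the nonzero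
  factor absorbs changes of normalisation. Since \<open>V\<close> is saturated, \<open>s\<close>
  descends to an open set of the torus.\<close>

definition local_frame :: "(real ^ 3 \<Rightarrow> real ^ 3) \<Rightarrow> (real ^ 3) set \<Rightarrow> (real ^ 3 \<Rightarrow> real ^ 3) \<Rightarrow> bool" where
  "local_frame w V s \<longleftrightarrow> open V \<and> continuous_on V s \<and>
     (\<forall>Y Z. torus_proj Y = torus_proj Z \<longrightarrow> Y \<in> V \<longrightarrow> Z \<in> V \<and> s Y = s Z) \<and>
     (\<forall>Y\<in>V. \<exists>c. c \<noteq> 0 \<and> s Y = c *\<^sub>R w Y)"

lemma continuous_line_field:
  assumes w: "periodic w" "\<And>X. w X \<noteq> 0"
    and loc: "\<And>X. \<exists>V s. local_frame w V s \<and> X \<in> V"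
  shows "continuous_subbundle (line_field w)"
  unfolding continuous_subbundle_def
proof (intro conjI allI)
  show "subspace (line_field w p)" for p by (simp add: line_field_def)
  fix p :: "3 torus"
  obtain X where X: "torus_proj X = p" using torus_proj_surj by blast
  obtain V s where fr: "local_frame w V s" and XV: "X \<in> V" using loc by blast
  have V: "open V" "continuous_on V s" using fr unfolding local_frame_def by blast+
  have sat: "Z \<in> V \<and> s Y = s Z" if "torus_proj Y = torus_proj Z" "Y \<in> V" for Y Z
    using fr that unfolding local_frame_def by (elim conjE) (rule mp, rule mp, elim allE, assumption+)
  have c: "\<exists>c. c \<noteq> 0 \<and> s Y = c *\<^sub>R w Y" if "Y \<in> V" for Y
    using fr that unfolding local_frame_def by (elim conjE) (rule bspec)
  have sv: "torus_proj -` (torus_proj ` V) = V"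
  proof (intro equalityI subsetI)
    fix Z assume "Z \<in> torus_proj -` (torus_proj ` V)"
    then obtain Y where "Y \<in> V" "torus_proj Z = torus_proj Y" by (metis imageE vimageE)
    then show "Z \<in> V" using sat[of Y Z] by simp
  qed simp
  have o: "open (torus_proj ` V)" using V(1) sv by (simp add: open_torus_def)
  have cont: "continuous_on (torus_proj ` V) (\<lambda>q. s (torus_rep q))"
  proof (rule continuous_on_torusI[OF o])
    have "s (torus_rep (torus_proj Y)) = s Y" if "Y \<in> V" for Y
      using sat[of Y "torus_rep (torus_proj Y)"] that by simp
    then show "continuous_on (torus_proj -` torus_proj ` V) (\<lambda>X. s (torus_rep (torus_proj X)))"
      unfolding sv using V(2) by (simp cong: continuous_on_cong)
  qed
  have L: "line_field w q = span {s (torus_rep q)} \<and> dim (line_field w q) = 1" if q: "q \<in> torus_proj ` V" for q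
  proof -
    obtain Y where "Y \<in> V" "q = torus_proj Y" using q by (rule imageE)
    then have "torus_rep q \<in> V" using sat[of Y "torus_rep q"] by simp
    then obtain c where "c \<noteq> 0" "s (torus_rep q) = c *\<^sub>R w (torus_rep q)" using c by blast
    moreover have "dim {w (torus_rep q)} = 1" using w(2)[of "torus_rep q"] by simp
    ultimately show ?thesis by (simp add: line_field_def span_singleton_scaleR dim_span)
  qed
  have I: "(\<lambda>i::nat. s (torus_rep q)) ` {..<1} = {s (torus_rep q)}" for q by auto
  have E: "\<forall>q\<in>torus_proj ` V. line_field w q = span ((\<lambda>i::nat. s (torus_rep q)) ` {..<1}) \<and> dim (line_field w q) = 1"
    unfolding I by (intro ballI) (rule L)
  have "p \<in> torus_proj ` V" using XV X by blast
  then show "\<exists>U k \<sigma>. open U \<and> p \<in> U \<and> (\<forall>i<k. continuous_on U (\<sigma> i)) \<and>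
      (\<forall>q\<in>U. line_field w q = span ((\<lambda>i::nat. \<sigma> i q) ` {..<k}) \<and> dim (line_field w q) = k)"
    using o cont E
    by (intro exI[of _ "torus_proj ` V"] exI[of _ 1] exI[of _ "\<lambda>_ q. s (torus_rep q)"] conjI) (assumption | intro allI impI)+
qed

lemma frames_nonzero: "ws X \<noteq> 0" "wc X \<noteq> 0" "wu X \<noteq> 0"
proof -
  show "ws X \<noteq> 0" using coords_ws(2)[of X] by (metis coords_0(2) zero_neq_one)
  have "uu (wc X) = 1 \<or> ww (wc X) = 1" by (simp add: wc_def)
  then show "wc X \<noteq> 0" by auto
  have "uu (wu X) = 1 \<or> ww (wu X) = 1" by (simp add: wu_def)
  then show "wu X \<noteq> 0" by auto
qed

lemma continuous_subbundle_ws: "continuous_subbundle (line_field ws)"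
proof (rule continuous_line_field[OF periodic_frames(1) frames_nonzero(1)])
  fix X :: "real ^ 3"
  have "local_frame ws UNIV ws" unfolding local_frame_def
  proof (intro conjI allI impI ballI)
    show "continuous_on UNIV ws" unfolding ws_def[abs_def] by (intro continuous_intros si(1))
    show "ws Y = ws Z" if "torus_proj Y = torus_proj Z" for Y Z by (rule periodicD[OF periodic_frames(1) that])
    show "\<exists>c. c \<noteq> 0 \<and> ws Y = c *\<^sub>R ws Y" for Y by (intro exI[of _ 1]) simp
  qed simp_all
  then show "\<exists>V s. local_frame ws V s \<and> X \<in> V" by blast
qed

lemma continuous_subbundle_wc: "continuous_subbundle (line_field wc)"
proof (rule continuous_line_field[OF periodic_frames(2) frames_nonzero(2)])
  fix X :: "real ^ 3"
  have "local_frame wc {X. wa X < 10} (\<lambda>X. eu + th X *\<^sub>R ew)" unfolding local_frame_def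
  proof (intro conjI allI impI ballI)
    have "continuous_on {X. wa X < 10} th" by (rule continuous_on_subset[OF th(1)]) auto
    then show "continuous_on {X. wa X < 10} (\<lambda>X. eu + th X *\<^sub>R ew)" by (intro continuous_intros)
    show "\<exists>c. c \<noteq> 0 \<and> eu + th Y *\<^sub>R ew = c *\<^sub>R wc Y" if "Y \<in> {X. wa X < 10}" for Y
    proof (cases "wa Y \<le> 1/2")
      case True then show ?thesis by (intro exI[of _ 1]) (simp add: wc_lens)
    next
      case False then show ?thesis using wc_mid[of Y] that by (intro exI[of _ "th Y"]) simp
    qed
    fix Y Z :: "real ^ 3" assume h: "torus_proj Y = torus_proj Z" "Y \<in> {X. wa X < 10}"
    show "Z \<in> {X. wa X < 10}" using h(2) wa_proj(1)[OF h(1)] by simp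
    show "eu + th Y *\<^sub>R ew = eu + th Z *\<^sub>R ew" using h(2) th_proj[OF h(1)] by simp
  qed (rule open_wa)
  moreover have "local_frame wc {X. 1/2 < wa X} wc" unfolding local_frame_def
  proof (intro conjI allI impI ballI)
    have "continuous_on {X. 1/2 < wa X} (\<lambda>X. xi2 X *\<^sub>R eu + ew)" by (intro continuous_intros continuous_xi)
    then show "continuous_on {X. 1/2 < wa X} wc" by (rule continuous_on_eq) (simp add: wc_far)
    show "\<exists>c. c \<noteq> 0 \<and> wc Y = c *\<^sub>R wc Y" for Y by (intro exI[of _ 1]) simp
    fix Y Z :: "real ^ 3" assume h: "torus_proj Y = torus_proj Z" "Y \<in> {X. 1/2 < wa X}"
    show "Z \<in> {X. 1/2 < wa X}" using h(2) wa_proj(1)[OF h(1)] by simp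
    show "wc Y = wc Z" by (rule periodicD[OF periodic_frames(2) h(1)])
  qed (rule open_wa)
  moreover have "X \<in> {X. wa X < 10} \<or> X \<in> {X. 1/2 < wa X}" by auto
  ultimately show "\<exists>V s. local_frame wc V s \<and> X \<in> V" by blast
qed

lemma continuous_subbundle_wu: "continuous_subbundle (line_field wu)"
proof (rule continuous_line_field[OF periodic_frames(3) frames_nonzero(3)])
  fix X :: "real ^ 3"
  have "local_frame wu {X. wa X < 157/4} (\<lambda>X. eta2 X *\<^sub>R eu + ew)" unfolding local_frame_def
  proof (intro conjI allI impI ballI)
    show "continuous_on {X. wa X < 157/4} (\<lambda>X. eta2 X *\<^sub>R eu + ew)" by (intro continuous_intros continuous_eta)
    show "\<exists>c. c \<noteq> 0 \<and> eta2 Y *\<^sub>R eu + ew = c *\<^sub>R wu Y" if "Y \<in> {X. wa X < 157/4}" for Y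
    proof (cases "wa Y \<le> 20")
      case True then show ?thesis by (intro exI[of _ 1]) (simp add: wu_low)
    next
      case False then show ?thesis using wu_mid[of Y] that by (intro exI[of _ "eta2 Y"]) simp
    qed
    fix Y Z :: "real ^ 3" assume h: "torus_proj Y = torus_proj Z" "Y \<in> {X. wa X < 157/4}"
    show "Z \<in> {X. wa X < 157/4}" using h(2) wa_proj(1)[OF h(1)] by simp
    show "eta2 Y *\<^sub>R eu + ew = eta2 Z *\<^sub>R eu + ew" using periodicD[OF periodic_eta(2) h(1)] by simp
  qed (rule open_wa)
  moreover have "local_frame wu {X. 20 < wa X} wu" unfolding local_frame_def
  proof (intro conjI allI impI ballI)
    have "continuous_on {X. 20 < wa X} ze" by (rule continuous_on_subset[OF ze(1)]) auto
    then have "continuous_on {X. 20 < wa X} (\<lambda>X. eu + ze X *\<^sub>R ew)" by (intro continuous_intros)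
    then show "continuous_on {X. 20 < wa X} wu" by (rule continuous_on_eq) (simp add: wu_high)
    show "\<exists>c. c \<noteq> 0 \<and> wu Y = c *\<^sub>R wu Y" for Y by (intro exI[of _ 1]) simp
    fix Y Z :: "real ^ 3" assume h: "torus_proj Y = torus_proj Z" "Y \<in> {X. 20 < wa X}"
    show "Z \<in> {X. 20 < wa X}" using h(2) wa_proj(1)[OF h(1)] by simp
    show "wu Y = wu Z" by (rule periodicD[OF periodic_frames(3) h(1)])
  qed (rule open_wa)
  moreover have "X \<in> {X. wa X < 157/4} \<or> X \<in> {X. 20 < wa X}" by auto
  ultimately show "\<exists>V s. local_frame wu V s \<and> X \<in> V" by blast
qed

lemma line_field_nonzero: "(\<And>X. w X \<noteq> 0) \<Longrightarrow> nonzero_bundle (line_field w)"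
proof -
  assume w: "\<And>X. w X \<noteq> 0"
  have "w (torus_rep p) \<in> line_field w p" for p by (simp add: line_field_def span_base)
  then show ?thesis using w unfolding nonzero_bundle_def by blast
qed

lemma linear_DF: "linear (DF X)"
  using has_derivative_F has_derivative_linear by blast

lemma torus_deriv_F: "torus_deriv (torus_map F) (torus_proj X) = DF X"
  by (rule torus_deriv_torus_map[OF lattice_map_F has_derivative_F])

lemma invariant_line_field:
  assumes "periodic w" "\<And>X. \<exists>c. c \<noteq> 0 \<and> DF X (w X) = c *\<^sub>R w (F X)"
  shows "invariant_bundle (torus_map F) (line_field w)"
  unfolding invariant_bundle_def
proof
  fix p :: "3 torus"
  obtain X where X: "p = torus_proj X" using torus_proj_surj by metis
  obtain c where c: "c \<noteq> 0" "DF X (w X) = c *\<^sub>R w (F X)" using assms(2) by blast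
  have "DF X ` span {w X} = span {w (F X)}"
    using linear_span_image[OF linear_DF, of X "{w X}"] c by (simp add: span_singleton_scaleR)
  then show "torus_deriv (torus_map F) p ` line_field w p = line_field w (torus_map F p)"
    unfolding X torus_deriv_F torus_map_proj[OF lattice_map_F] line_field_proj[OF assms(1)] .
qed

subsection \<open>Domination\<close>

text \<open>Squared norm with a weight on the stable coordinate. A large weight makes the slopes of
  the stable direction negligible, while center and unstable vectors have no stable coordinate and
  are unaffected.\<close>

definition nq :: "real \<Rightarrow> real ^ 3 \<Rightarrow> real" where
  "nq \<rho> v = (uu v)\<^sup>2 + \<rho>\<^sup>2 * (ss v)\<^sup>2 + (ww v)\<^sup>2"

lemma nq_scale: "nq \<rho> (c *\<^sub>R v) = c\<^sup>2 * nq \<rho> v"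
  by (simp add: nq_def power_mult_distrib algebra_simps)

lemma nq_pos: assumes "\<rho> \<noteq> 0" "v \<noteq> 0" shows "0 < nq \<rho> v"
proof -
  have "uu v \<noteq> 0 \<or> ss v \<noteq> 0 \<or> ww v \<noteq> 0"
    using coords_eqI[of v 0] assms(2) by auto
  then have "0 < (uu v)\<^sup>2 \<or> 0 < \<rho>\<^sup>2 * (ss v)\<^sup>2 \<or> 0 < (ww v)\<^sup>2"
    using assms(1) by auto
  moreover have "0 \<le> (uu v)\<^sup>2" "0 \<le> \<rho>\<^sup>2 * (ss v)\<^sup>2" "0 \<le> (ww v)\<^sup>2" by simp_all
  ultimately show ?thesis unfolding nq_def by linarith
qed

lemma nq_plane: "nq \<rho> (a *\<^sub>R eu + b *\<^sub>R ew) = a\<^sup>2 + b\<^sup>2"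
  by (simp add: nq_def)

lemma nq_frame: "nq \<rho> (a *\<^sub>R eu + ew) = a\<^sup>2 + 1" "nq \<rho> (eu + b *\<^sub>R ew) = 1 + b\<^sup>2"
  by (simp_all add: nq_def)

lemma sgn_wb_nonzero: "0 < wa X \<Longrightarrow> sgn (wb X) \<noteq> 0"
  by (simp add: wa_def sgn_eq_0_iff)

lemma fb_sq: assumes "1/2 < wa X" "wa X < 20" shows "0 < (fb X)\<^sup>2"
proof -
  have "sgn (wb X) \<noteq> 0" using assms by (intro sgn_wb_nonzero) simp
  then show ?thesis using fbp_pos[OF assms] by (simp add: fb_eq)
qed

text \<open>The unstable slope and the shear carry the same sign, so the cross term is
  nonnegative.\<close>

lemma sq_eta_fb: assumes "wa X \<le> 20"
  shows "mu\<^sup>2 * (eta2 X)\<^sup>2 + (fb X)\<^sup>2 \<le> (mu * eta2 X + fb X)\<^sup>2"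
proof -
  have "sgn (wb X) * sgn (wb X) \<ge> 0" by simp
  moreover have "0 \<le> h2 X * fbp X" by (intro mult_nonneg_nonneg h_nonneg fbp_nonneg)
  ultimately have "0 \<le> (sgn (wb X) * sgn (wb X)) * (h2 X * fbp X)" by (rule mult_nonneg_nonneg)
  also have "\<dots> = eta2 X * fb X" using assms by (simp add: eta2_eq fb_eq)
  finally have "0 \<le> mu * (eta2 X * fb X)" using mu_bounds by simp
  then show ?thesis by (simp add: power2_sum power_mult_distrib mult_ac)
qed

lemma th_sq: "wa X \<le> 10 \<Longrightarrow> (th X)\<^sup>2 \<le> 49/25"
  using abs_le_square_iff[of "th X" "7/5"] th(4)[of X] by (simp add: power_divide)

lemma mu_sq: "96 < mu\<^sup>2" "mu\<^sup>2 < 99"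
proof -
  have "(98/10)\<^sup>2 < mu\<^sup>2" using mu_bounds by (intro power_strict_mono) auto
  then show "96 < mu\<^sup>2" by (simp add: power_divide)
  have "mu\<^sup>2 < (99/10)\<^sup>2" using mu_bounds by (intro power_strict_mono) auto
  then show "mu\<^sup>2 < 99" by (simp add: power_divide)
qed

lemma DF_wu_low_coords:
  assumes "wa X \<le> 20"
  shows "DF X (wu X) = (fa X * eta2 X + fb X) *\<^sub>R eu + fd X *\<^sub>R ew"
proof -
  have c: "fc X * eta2 X = 0" using eta_low(2)[of X] fc_zero(1)[of X] assms by (cases "wa X \<le> 10") auto
  show ?thesis by (rule coords_eqI) (use assms c in \<open>simp_all add: wu_low\<close>)
qed

lemma DF_wu_high_coords:
  assumes "20 < wa X"
  shows "DF X (wu X) = mu *\<^sub>R eu + (ze X / 2) *\<^sub>R ew"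
  by (rule coords_eqI) (use assms in \<open>simp_all add: wu_high fc_zero fa_hi fd_half fb_eq fbp_hi\<close>)

lemma DF_wc_near_coords:
  assumes "1 < wa X"
  shows "DF X (wc X) = 0 *\<^sub>R eu + fd X *\<^sub>R ew"
  by (rule coords_eqI) (use assms fa_pos[of X] in \<open>simp_all add: wc_far fc_zero xi2_hi xi1_def\<close>)

text \<open>The constant 3/100 exceeds the squared stable rate, which is at most
  \<open>5/4 * lam\<^sup>2\<close>. Up to 1/2 it follows from \<open>fa \<ge> 1/3\<close> and the
  bound on \<open>th\<close>; on the ramp slopes reach at most 93, but the vertical factor is 20;
  higher up slopes are at most 1 and \<open>fd \<ge> 1/2\<close>.\<close>

lemma domination_cs: "3/100 * nq \<rho> (wc X) \<le> nq \<rho> (DF X (wc X))"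
proof -
  consider "wa X \<le> 1/2" | "1/2 < wa X" "wa X \<le> 1" | "1 < wa X" by linarith
  then show ?thesis
  proof cases
    case 1
    have "(1/3)\<^sup>2 \<le> (fa X)\<^sup>2" using fa_bounds[of X] by (intro power_mono) auto
    then have "(1/9) * 1 \<le> (fa X)\<^sup>2 * (1 + (th (F X))\<^sup>2)"
      by (intro mult_mono) (auto simp: power_divide)
    then show ?thesis
      using th_sq[of X] 1 unfolding DF_wc_lens[OF 1] unfolding wc_lens[OF 1] nq_scale nq_frame by simp
  next
    case 2
    have "sgn (wb X) \<noteq> 0" using 2 by (intro sgn_wb_nonzero) simp
    then have "(sgn (wb X))\<^sup>2 = 1" by (simp add: sgn_real_def split: if_splits)
    then have "(xi2 X)\<^sup>2 = (x2 X)\<^sup>2" using 2 by (simp add: xi2_eq power_mult_distrib)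
    also have "\<dots> \<le> 93\<^sup>2" using 2 x2_upper[of X] x2_nonneg[of X] by (intro power_mono) auto
    finally have x: "(xi2 X)\<^sup>2 \<le> 8649" by simp
    have "fd X = 20" using 2 fd_20(1)[of X] by simp
    then have "nq \<rho> (DF X (wc X)) = 400 * ((xi1 (F X))\<^sup>2 + 1)"
      using 2 unfolding DF_wc_far[OF 2(1)] nq_scale nq_frame by simp
    moreover have "nq \<rho> (wc X) = (xi2 X)\<^sup>2 + 1" using 2 by (simp add: wc_far nq_frame)
    ultimately show ?thesis using x zero_le_power2[of "xi1 (F X)"] by argo
  next
    case 3
    have "fbp X \<le> mu" using 3 fbp_F_le[of X] by (cases "wa X \<le> 19") (auto simp: fbp_mid)
    then have "\<bar>fb X\<bar> \<le> mu" using fbp_nonneg[of X] mu_bounds by (simp add: fb_eq abs_mult sgn_real_def)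
    then have "\<bar>xi1 X\<bar> \<le> 1" using 3 mu_bounds by (simp add: xi1_def fa_hi)
    then have x: "(xi2 X)\<^sup>2 \<le> 1" using 3 by (simp add: xi2_hi abs_square_le_1)
    have "(1/2)\<^sup>2 \<le> (fd X)\<^sup>2" using fd_ge[of X] by (intro power_mono) auto
    then show ?thesis using x 3 unfolding DF_wc_near_coords[OF 3] nq_plane
      by (simp add: wc_far nq_frame power_divide)
  qed
qed

text \<open>Up to 1/2 the horizontal rate loses to the vertical one, with 18 against 20, or 1/2
  against 9/10 over the disc. On the ramp the center slope does not grow and the unstable vector
  gains \<open>fb\<close>. From 1 to 10 the center becomes vertical with factor \<open>fd\<close>,
  and the unstable vector has \<open>fb\<close> in addition. Beyond, \<open>fd\<close> is 1/2 and
  the horizontal rate \<open>mu\<close> wins.\<close>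

lemma domination_uc: "nq \<rho> (DF X (wc X)) * nq \<rho> (wu X) < nq \<rho> (DF X (wu X)) * nq \<rho> (wc X)"
proof -
  consider "wa X \<le> 1/2" | "1/2 < wa X" "wa X \<le> 1" | "1 < wa X" "wa X \<le> 10" | "10 < wa X" "wa X \<le> 20" | "20 < wa X" by linarith
  then show ?thesis
  proof cases
    case 1
    have wu: "nq \<rho> (wu X) = 1" "nq \<rho> (DF X (wu X)) = (fd X)\<^sup>2"
      using 1 eta_low(2)[of X] unfolding DF_wu_low_coords[OF order_trans[OF 1, of 20, simplified]] nq_plane
      by (simp_all add: wu_low nq_def fb_eq fbp_lo)
    have wc: "nq \<rho> (wc X) = 1 + (th X)\<^sup>2" "nq \<rho> (DF X (wc X)) = (fa X)\<^sup>2 * (1 + (th (F X))\<^sup>2)"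
      unfolding DF_wc_lens[OF 1] unfolding wc_lens[OF 1] nq_scale nq_frame by simp_all
    have "(fa X)\<^sup>2 * (1 + (th (F X))\<^sup>2) < (fd X)\<^sup>2 * (1 + (th X)\<^sup>2)"
    proof (cases "rr X = 0")
      case True
      have d: "fd X = 20" using fd_20(2)[OF True] 1 by simp
      \<comment> \<open>Off the disc the vertical component is multiplied by exactly 20, the
        horizontal one by at most 18.\<close>
      have t: "fa X * th (F X) = 20 * th X" using th(3)[OF 1] fc_zero(2)[OF True] d by simp
      have "(fa X)\<^sup>2 \<le> 18\<^sup>2" using fa_bounds[of X] by (intro power_mono) auto
      moreover have "(fa X)\<^sup>2 * (1 + (th (F X))\<^sup>2) = (fa X)\<^sup>2 + (20 * th X)\<^sup>2"
        unfolding t[symmetric] by (simp add: power_mult_distrib algebra_simps)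
      ultimately show ?thesis by (simp add: d power_mult_distrib)
    next
      case False
      then have r: "0 < rr X" using rr_bounds[of X] by simp
      have "(fa X)\<^sup>2 \<le> (1/2)\<^sup>2" using fa_lens[OF r 1] fa_bounds[of X] by (intro power_mono) auto
      moreover have "wa (F X) \<le> 10" using wa_F_iff(2)[of X] 1 by simp
      ultimately have "(fa X)\<^sup>2 * (1 + (th (F X))\<^sup>2) \<le> (1/2)\<^sup>2 * (1 + 49/25)"
        using th_sq[of "F X"] by (intro mult_mono) auto
      also have "\<dots> < (9/10)\<^sup>2 * 1" by (simp add: power_divide)
      also have "\<dots> \<le> (fd X)\<^sup>2 * (1 + (th X)\<^sup>2)"
        using fd_lens(1)[of X] 1 by (intro mult_mono power_mono) auto
      finally show ?thesis .
    qed
    then show ?thesis unfolding wu wc by simp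
  next
    case 2
    have d: "fd X = 20" using 2 fd_20(1)[of X] by simp
    have w: "wa X \<le> 20" "wa X < 117/2" "wa X \<le> 10" using 2 by simp_all
    have wu: "nq \<rho> (wu X) = 1" "nq \<rho> (DF X (wu X)) = (fb X)\<^sup>2 + 400"
      using eta_low(2)[OF w(1) w(3)] unfolding DF_wu_low_coords[OF w(1)] nq_plane d
      by (simp_all add: wu_low w nq_def)
    have wc: "nq \<rho> (wc X) = (xi2 X)\<^sup>2 + 1" "nq \<rho> (DF X (wc X)) = 400 * ((xi1 (F X))\<^sup>2 + 1)"
      unfolding DF_wc_far[OF 2(1)] unfolding wc_far[OF 2(1)] nq_scale nq_frame d by simp_all
    have "sgn (wb X) \<noteq> 0" using 2 by (intro sgn_wb_nonzero) simp
    then have s: "(sgn (wb X))\<^sup>2 = 1" by (simp add: sgn_real_def split: if_splits)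
    define y where "y = fbp (F X) / fa (F X)"
    have y: "0 \<le> y" using fbp_nonneg fa_pos[of "F X"] by (simp add: y_def)
    have "xi1 (F X) = - sgn (wb X) * y" using sgn_wb_F[OF w(2)] by (simp add: xi1_def fb_eq y_def)
    then have xi1: "(xi1 (F X))\<^sup>2 = y\<^sup>2" using s by (simp add: power_mult_distrib)
    have xi2: "(xi2 X)\<^sup>2 = (x2 X)\<^sup>2" using s w by (simp add: xi2_eq power_mult_distrib)
    \<comment> \<open>\<open>y\<close> is the modulus of the center slope at the image; it is at
      most \<open>x2 X\<close> because \<open>fa\<close> is below \<open>fd = 20\<close>.\<close>
    have "fa X * y \<le> 20 * y + fbp X" using fa_bounds[of X] y fbp_nonneg[of X] mult_right_mono[of "fa X" 18 y] by simp
    then have "y \<le> x2 X" using fa_pos[of X] d by (simp add: x2_def y_def[symmetric] pos_le_divide_eq mult.commute)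
    then have "y\<^sup>2 \<le> (x2 X)\<^sup>2" using y by (intro power_mono) auto
    then have "400 * (y\<^sup>2 + 1) \<le> 400 * ((x2 X)\<^sup>2 + 1)" by simp
    also have "\<dots> < ((fb X)\<^sup>2 + 400) * ((x2 X)\<^sup>2 + 1)"
      using fb_sq[of X] 2 by (intro mult_strict_right_mono) (auto simp: add_nonneg_pos)
    finally show ?thesis unfolding wu wc xi1 xi2 by simp
  next
    case 3
    have w: "wa X \<le> 20" using 3 by simp
    have wu: "nq \<rho> (wu X) = 1" "nq \<rho> (DF X (wu X)) = (fb X)\<^sup>2 + (fd X)\<^sup>2"
      using eta_low(2)[OF w 3(2)] unfolding DF_wu_low_coords[OF w] nq_plane
      by (simp_all add: wu_low w nq_def)
    have wc: "nq \<rho> (wc X) = (xi2 X)\<^sup>2 + 1" "nq \<rho> (DF X (wc X)) = (fd X)\<^sup>2"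
      using 3 unfolding DF_wc_near_coords[OF 3(1)] nq_plane by (simp_all add: wc_far nq_frame)
    have "(fd X)\<^sup>2 < ((fb X)\<^sup>2 + (fd X)\<^sup>2) * 1" using fb_sq[of X] 3 by simp
    also have "\<dots> \<le> ((fb X)\<^sup>2 + (fd X)\<^sup>2) * ((xi2 X)\<^sup>2 + 1)" by (intro mult_left_mono) auto
    finally show ?thesis unfolding wu wc by simp
  next
    case 4
    have w: "1 < wa X" using 4 by simp
    have d: "fd X = 1/2" using 4 by (intro fd_half) auto
    have a: "fa X = mu" using 4 by (simp add: fa_hi)
    have wu: "nq \<rho> (wu X) = (eta2 X)\<^sup>2 + 1" "nq \<rho> (DF X (wu X)) = (mu * eta2 X + fb X)\<^sup>2 + 1/4"
      unfolding DF_wu_low_coords[OF 4(2)] nq_plane d a by (simp_all add: wu_low 4 nq_frame power_divide)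
    have wc: "nq \<rho> (wc X) = (xi2 X)\<^sup>2 + 1" "nq \<rho> (DF X (wc X)) = 1/4"
      using w unfolding DF_wc_near_coords[OF w] nq_plane d by (simp_all add: wc_far nq_frame power_divide)
    have "0 < (eta2 X)\<^sup>2 \<or> 0 < (fb X)\<^sup>2"
      using fb_sq[of X] eta2_lower(2)[of X] 4 by (cases "wa X < 20") auto
    moreover have "1/4 * (eta2 X)\<^sup>2 \<le> 95 * (eta2 X)\<^sup>2" "96 * (eta2 X)\<^sup>2 \<le> mu\<^sup>2 * (eta2 X)\<^sup>2"
      using mu_sq by (simp_all add: mult_right_mono)
    ultimately have "1/4 * ((eta2 X)\<^sup>2 + 1) < ((mu * eta2 X + fb X)\<^sup>2 + 1/4) * 1"
      using sq_eta_fb[OF 4(2)] zero_le_power2[of "eta2 X"] zero_le_power2[of "fb X"] by (elim disjE) argo+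
    also have "\<dots> \<le> ((mu * eta2 X + fb X)\<^sup>2 + 1/4) * ((xi2 X)\<^sup>2 + 1)" by (intro mult_left_mono) auto
    finally show ?thesis unfolding wu wc .
  next
    case 5
    have w: "1 < wa X" using 5 by simp
    have d: "fd X = 1/2" using 5 by (intro fd_half) auto
    have wu: "nq \<rho> (wu X) = 1 + (ze X)\<^sup>2" "nq \<rho> (DF X (wu X)) = mu\<^sup>2 + (ze X)\<^sup>2/4"
      unfolding DF_wu_high_coords[OF 5] nq_plane by (simp_all add: wu_high 5 nq_frame power_divide)
    have wc: "nq \<rho> (wc X) = 1" "nq \<rho> (DF X (wc X)) = 1/4"
      using 5 unfolding DF_wc_near_coords[OF w] nq_plane d by (simp_all add: wc_far nq_def power_divide xi2_hi xi1_zero)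
    show ?thesis unfolding wu wc using mu_sq by simp
  qed
qed

text \<open>Over the disc the hypothesis places the point on or outside the lens boundary, where the
  vertical rate is at least 20. Higher up the expansion comes from the shear plateau, then from the
  tilt already acquired, and finally from the horizontal rate \<open>mu\<close>.\<close>

lemma expansion_u: assumes "tau X \<le> wa X" shows "nq \<rho> (wu X) < nq \<rho> (DF X (wu X))"
proof -
  consider "wa X \<le> 1/2" | "1/2 < wa X" "wa X \<le> 1" | "1 < wa X" "wa X \<le> 19" | "19 < wa X" "wa X \<le> 20" | "20 < wa X" by linarith
  then show ?thesis
  proof cases
    case 1
    have w: "wa X \<le> 20" "wa X \<le> 10" using 1 by simp_all
    have wu: "nq \<rho> (wu X) = 1" "nq \<rho> (DF X (wu X)) = (fd X)\<^sup>2"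
      using 1 eta_low(2)[OF w] unfolding DF_wu_low_coords[OF w(1)] nq_plane
      by (simp_all add: wu_low w nq_def fb_eq fbp_lo)
    have "20 \<le> fd X"
    proof (cases "rr X = 0")
      case True then show ?thesis using fd_20(2)[of X] 1 by simp
    next
      case False
      then have "0 < rr X" using rr_bounds[of X] by simp
      then have "rr X + Rc \<le> 20 * wa X" using tau_lens[of X] assms by simp
      then show ?thesis using fd_lens(2)[of X] 1 by simp
    qed
    then have "20\<^sup>2 \<le> (fd X)\<^sup>2" by (intro power_mono) auto
    then show ?thesis unfolding wu by simp
  next
    case 2
    have d: "fd X = 20" using 2 fd_20(1)[of X] by simp
    have w: "wa X \<le> 20" "wa X \<le> 10" using 2 by simp_all
    show ?thesis using eta_low(2)[OF w] zero_le_power2[of "fb X"] unfolding DF_wu_low_coords[OF w(1)] nq_plane d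
      by (simp add: wu_low w nq_def add_pos_nonneg)
  next
    case 3
    have w: "wa X \<le> 20" using 3 by simp
    have a: "fa X = mu" using 3 by (simp add: fa_hi)
    have "sgn (wb X) \<noteq> 0" using 3 by (intro sgn_wb_nonzero) simp
    then have s: "(sgn (wb X))\<^sup>2 = 1" by (simp add: sgn_real_def split: if_splits)
    have "(fb X)\<^sup>2 = mu\<^sup>2" using 3 s by (simp add: fb_eq fbp_mid power_mult_distrib)
    moreover have "1 * (eta2 X)\<^sup>2 \<le> mu\<^sup>2 * (eta2 X)\<^sup>2" using mu_sq by (intro mult_right_mono) auto
    ultimately show ?thesis
      using sq_eta_fb[OF w] mu_sq zero_le_power2[of "fd X"]
      unfolding DF_wu_low_coords[OF w] unfolding wu_low[OF w] nq_plane nq_frame a by linarith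
  next
    case 4
    have a: "fa X = mu" using 4 by (simp add: fa_hi)
    \<comment> \<open>The shear fades here and the vertical rate is only 1/2, so the tilt from the
      previous step must do the work; \<open>95 * (16/100)\<close> exceeds 1.\<close>
    have "4/10 \<le> h1 X" using 4 by (intro h1_lower) auto
    moreover have "\<bar>eta2 X\<bar> = h1 X"
    proof -
      have "\<bar>sgn (wb (Fi X))\<bar> = 1" using 4 sgn_wb_Fi[of X] by (auto simp: wa_def sgn_real_def)
      moreover have "eta2 X = sgn (wb (Fi X)) * h1 X" using eta_low(1)[of X] 4 by (simp add: eta1_def h1_def fb_eq)
      ultimately show ?thesis using h_nonneg(1)[of X] by (metis abs_mult abs_of_nonneg mult_1)
    qed
    ultimately have "(4/10)\<^sup>2 \<le> \<bar>eta2 X\<bar>\<^sup>2" by (intro power_mono) auto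
    then have "16/100 \<le> (eta2 X)\<^sup>2" by (simp add: power_divide)
    moreover have "96 * (eta2 X)\<^sup>2 \<le> mu\<^sup>2 * (eta2 X)\<^sup>2" using mu_sq by (intro mult_right_mono) auto
    ultimately show ?thesis
      using sq_eta_fb[OF 4(2)] zero_le_power2[of "fd X"] zero_le_power2[of "fb X"]
      unfolding DF_wu_low_coords[OF 4(2)] unfolding wu_low[OF 4(2)] nq_plane nq_frame a by linarith
  next
    case 5
    have "\<bar>ze X\<bar>\<^sup>2 \<le> 10\<^sup>2" using 5 ze(4)[of X] by (intro power_mono) auto
    then show ?thesis using mu_sq unfolding DF_wu_high_coords[OF 5] nq_plane by (simp add: wu_high 5 nq_frame power_divide)
  qed
qed

text \<open>From 1/2 to 20 the determinant is \<open>eta2 X - xi2 X\<close>, a difference of slopes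
  of opposite sign; \<open>x2\<close> keeps it nonzero up to 19 and \<open>h1\<close> from there on.
  At other heights one of the two lines is vertical and the other a graph over the
  horizontal.\<close>

lemma frame_det: "uu (wu X) * ww (wc X) - ww (wu X) * uu (wc X) \<noteq> 0"
proof -
  consider "wa X \<le> 1/2" | "1/2 < wa X" "wa X \<le> 20" | "20 < wa X" by linarith
  then show ?thesis
  proof cases
    case 1
    then show ?thesis using eta_low(2)[of X] by (simp add: wu_low wc_lens)
  next
    case 2
    have s: "sgn (wb X) \<noteq> 0" using 2 by (intro sgn_wb_nonzero) simp
    have e: "eta2 X - xi2 X = sgn (wb X) * (h2 X + x2 X)" using 2 by (simp add: eta2_eq xi2_eq algebra_simps)
    have "0 < h2 X + x2 X"
    proof (cases "wa X \<le> 19")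
      case True
      then show ?thesis using x2_lower[of X] h_nonneg(2)[of X] 2 by simp
    next
      case False
      have "sgn (wb X) * h2 X = sgn (wb X) * h1 X"
        using eta_low(1)[of X] eta2_eq[of X] sgn_wb_Fi[of X] 2 by (simp add: eta1_def h1_def fb_eq)
      then have "h2 X = h1 X" using s by simp
      then show ?thesis using h1_lower[of X] False 2 x2_nonneg[of X] by simp
    qed
    then have "eta2 X - xi2 X \<noteq> 0" unfolding e using s by simp
    then show ?thesis using 2 by (simp add: wu_low wc_far)
  next
    case 3
    then show ?thesis by (simp add: wu_high wc_far xi2_hi xi1_zero)
  qed
qed

lemma unique_decomposition:
  fixes u c s :: "real ^ 3"
  assumes ss: "ss u = 0" "ss c = 0" "ss s = 1" and det: "uu u * ww c - ww u * uu c \<noteq> 0"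
  shows "\<exists>!(a, b, d). a \<in> span {u} \<and> b \<in> span {c} \<and> d \<in> span {s} \<and> v = a + b + d"
proof -
  define D where "D = uu u * ww c - ww u * uu c"
  define x y where "x = uu v - ss v * uu s" and "y = ww v - ss v * ww s"
  define k l where "k = (x * ww c - y * uu c) / D" and "l = (uu u * y - ww u * x) / D"
  have D: "D \<noteq> 0" using det by (simp add: D_def)
  have ex: "v = k *\<^sub>R u + l *\<^sub>R c + ss v *\<^sub>R s"
  proof (rule coords_eqI)
    have "k * D = x * ww c - y * uu c" "l * D = uu u * y - ww u * x" using D by (simp_all add: k_def l_def)
    moreover have "D * (k * p + l * q) = (k * D) * p + (l * D) * q" for p q by (simp add: algebra_simps)
    ultimately have "D * (k * uu u + l * uu c) = (x * ww c - y * uu c) * uu u + (uu u * y - ww u * x) * uu c"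
      "D * (k * ww u + l * ww c) = (x * ww c - y * uu c) * ww u + (uu u * y - ww u * x) * ww c" by simp_all
    moreover have "(x * ww c - y * uu c) * uu u + (uu u * y - ww u * x) * uu c = D * x"
      "(x * ww c - y * uu c) * ww u + (uu u * y - ww u * x) * ww c = D * y" by (simp_all add: D_def algebra_simps)
    ultimately have "D * (k * uu u + l * uu c) = D * x" "D * (k * ww u + l * ww c) = D * y" by simp_all
    then have "k * uu u + l * uu c = x" "k * ww u + l * ww c = y" using D by simp_all
    then show "uu v = uu (k *\<^sub>R u + l *\<^sub>R c + ss v *\<^sub>R s)" "ww v = ww (k *\<^sub>R u + l *\<^sub>R c + ss v *\<^sub>R s)"
      by (simp_all add: x_def y_def)
  qed (simp add: ss)
  have un: "k' = k \<and> l' = l \<and> m = ss v" if v: "v = k' *\<^sub>R u + l' *\<^sub>R c + m *\<^sub>R s" for k' l' m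
  proof -
    have m: "m = ss v" by (simp add: v ss)
    have "x = k' * uu u + l' * uu c" "y = k' * ww u + l' * ww c"
      unfolding x_def y_def by (simp_all add: v ss)
    then have "x * ww c - y * uu c = k' * D" "uu u * y - ww u * x = l' * D"
      by (simp_all add: D_def algebra_simps)
    then show ?thesis using D m by (simp add: k_def l_def)
  qed
  show ?thesis
  proof (rule ex1I[of _ "(k *\<^sub>R u, l *\<^sub>R c, ss v *\<^sub>R s)"])
    show "case (k *\<^sub>R u, l *\<^sub>R c, ss v *\<^sub>R s) of (a, b, d) \<Rightarrow>
        a \<in> span {u} \<and> b \<in> span {c} \<and> d \<in> span {s} \<and> v = a + b + d"
      using ex by (auto simp: span_singleton)
    fix q assume q: "case q of (a, b, d) \<Rightarrow> a \<in> span {u} \<and> b \<in> span {c} \<and> d \<in> span {s} \<and> v = a + b + d"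
    obtain a b d where abd: "q = (a, b, d)" by (cases q)
    then obtain k' l' m where "a = k' *\<^sub>R u" "b = l' *\<^sub>R c" "d = m *\<^sub>R s" "v = a + b + d"
      using q by (auto simp: span_singleton)
    then show "q = (k *\<^sub>R u, l *\<^sub>R c, ss v *\<^sub>R s)" using un[of k' l' m] abd by (simp add: ss)
  qed
qed

subsection \<open>The basin and its boundary\<close>

definition Bs :: "(real ^ 3) set" where "Bs = {X. wa X < tau X}"

lemma tau_periodic: "torus_proj X = torus_proj Y \<Longrightarrow> tau X = tau Y"
  by (rule tau_proj) (simp add: torus_proj_eq_iff)

lemma Bs_proj: "torus_proj X = torus_proj Y \<Longrightarrow> X \<in> Bs \<longleftrightarrow> Y \<in> Bs"
  using wa_proj(1)[of X Y] tau_periodic[of X Y] by (simp add: Bs_def)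

lemma tau_small: "tau X < 1/2"
  using tau_bounds(2)[of X] by (simp add: Rc_def)

lemma F_lens_coeffs: assumes "wa X \<le> 1/2" shows "rr (F X) = rr (G X)" "tau (F X) = tau (G X)"
  using F_G(1)[OF assms] by simp_all

text \<open>Invariance of the lens boundary: without bump both sides are \<open>20 * tau X\<close>,
  and over the disc \<open>H\<close> is evaluated at exactly 1.\<close>

lemma psih_tau: "psih (rr X) (tau X) = tau (G X)"
proof (cases "rr X = 0")
  case True
  then show ?thesis using tau_bounds[of X] tau_small[of X] by (simp add: psih_def psi0_lo tau_G)
next
  case False
  then have r: "0 < rr X" using rr_bounds(1)[of X] by simp
  have "20 * tau X / (rr X + Rc) = 1" using tau_lens[OF r] r Rc_pos by simp
  moreover have "psi0 (tau X) = 20 * tau X" using tau_bounds(1)[of X] tau_small[of X] by (intro psi0_lo) simp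
  ultimately show ?thesis unfolding psih_def by (simp add: H_1 tau_G)
qed

text \<open>The fibre maps are strictly monotone and carry boundary heights to boundary heights, so
  lying below the boundary is preserved in both directions.\<close>

lemma Bs_F: "F X \<in> Bs \<longleftrightarrow> X \<in> Bs"
proof (cases "wa X \<le> 1/2")
  case True
  note r = rr_bounds[of X]
  have "psih (rr X) (wa X) < psih (rr X) (tau X) \<longleftrightarrow> wa X < tau X"
    using psih_strict_mono[OF r, of "wa X" "tau X"] psih_mono[OF r, of "tau X" "wa X"] by linarith
  then show ?thesis by (simp add: Bs_def wa_F psih_tau F_lens_coeffs[OF True])
next
  case False
  then have "10 < wa (F X)" using wa_F_iff(2)[of X] by simp
  then show ?thesis using False tau_small[of X] tau_small[of "F X"] by (simp add: Bs_def)
qed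

lemma Bs_funpow: "(F ^^ n) X \<in> Bs \<longleftrightarrow> X \<in> Bs"
  by (induction n) (simp_all add: Bs_F)

lemma open_Bs: "open Bs"
  unfolding Bs_def by (intro open_Collect_less continuous_wa continuous_tau)

lemma Bs_lens: "Bs \<subseteq> {X. wa X \<le> 1/2}"
proof
  fix X assume "X \<in> Bs"
  then show "X \<in> {X. wa X \<le> 1/2}" using tau_small[of X] by (simp add: Bs_def)
qed

lemma rd_vertical [simp]: "uu (rd (X + c *\<^sub>R ew)) = uu (rd X)" "ss (rd (X + c *\<^sub>R ew)) = ss (rd X)"
  by (simp_all add: uu_def ss_def rd_def rn_def ew_def)

text \<open>The part of the lens over the plateau. There the fibre map is the single function
  \<open>psih (19 * Rc)\<close>, and convergence becomes a one-dimensional question.\<close>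

definition core :: "(real ^ 3) set" where "core = {X. rr X = 19 * Rc \<and> wa X < Rc}"

lemma core_Bs: "X \<in> core \<Longrightarrow> X \<in> Bs"
  using tau_core[of X] by (simp add: core_def Bs_def)

lemma Bs_core: assumes "X \<in> Bs" "0 < rr X" shows "F X \<in> core"
proof -
  have w: "wa X \<le> 1/2" using assms Bs_lens by blast
  have r: "rr (F X) = 19 * Rc" using F_lens_coeffs(1)[OF w] rr_G[OF assms(2)] by simp
  have "F X \<in> Bs" using assms(1) by (simp add: Bs_F)
  then show ?thesis using r tau_core[OF r] by (simp add: Bs_def core_def)
qed

lemma core_F:
  assumes "X \<in> core"
  shows "F X \<in> core" "\<bar>uu (rd (F X))\<bar> \<le> 1/2 * \<bar>uu (rd X)\<bar>" "\<bar>ss (rd (F X))\<bar> \<le> 1/2 * \<bar>ss (rd X)\<bar>"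
    "wa (F X) \<le> wa X" "wa (F X) = psih (19 * Rc) (wa X)"
proof -
  have r: "0 < rr X" using assms Rc_pos by (simp add: core_def)
  have w: "wa X \<le> 1/2" using core_Bs[OF assms] Bs_lens by blast
  show "F X \<in> core" by (rule Bs_core[OF core_Bs[OF assms] r])
  show "\<bar>uu (rd (F X))\<bar> \<le> 1/2 * \<bar>uu (rd X)\<bar>" "\<bar>ss (rd (F X))\<bar> \<le> 1/2 * \<bar>ss (rd X)\<bar>"
    using rr_G_box(1,2)[OF r] F_G(1)[OF w] by simp_all
  show e: "wa (F X) = psih (19 * Rc) (wa X)" using assms by (simp add: wa_F core_def)
  have y: "0 \<le> wa X / Rc" "wa X / Rc < 1" using assms wa_nonneg[of X] Rc_pos by (simp_all add: core_def)
  have "20 * wa X / (19 * Rc + Rc) = wa X / Rc" using Rc_pos by (simp add: field_simps)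
  moreover have "psi0 (wa X) = 20 * wa X" using w wa_nonneg[of X] by (intro psi0_lo) simp
  ultimately have p: "psih (19 * Rc) (wa X) = 20 * wa X - 19 * Rc * H (wa X / Rc)" by (simp add: psih_def)
  have "wa X / Rc \<le> H (wa X / Rc)" using H_gt[of "wa X / Rc"] y by (cases "wa X / Rc = 0") auto
  then have "wa X \<le> Rc * H (wa X / Rc)" using Rc_pos by (simp add: field_simps)
  then show "wa (F X) \<le> wa X" unfolding e p by simp
qed

lemma psih_fixed: assumes "0 \<le> w" "w < Rc" "psih (19 * Rc) w = w" shows "w = 0"
proof (rule ccontr)
  assume "w \<noteq> 0"
  then have y: "0 < w / Rc" "w / Rc < 1" using assms Rc_pos by simp_all
  have "20 * w / (19 * Rc + Rc) = w / Rc" using Rc_pos by (simp add: field_simps)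
  moreover have "psi0 w = 20 * w" using assms by (intro psi0_lo) (simp add: Rc_def)
  ultimately have "20 * w - 19 * Rc * H (w / Rc) = w" using assms(3) by (simp add: psih_def)
  then have "H (w / Rc) = w / Rc" using Rc_pos by (simp add: field_simps)
  then show False using H_gt[OF y] by simp
qed

lemma core_funpow: "X \<in> core \<Longrightarrow> (F ^^ n) X \<in> core"
  by (induction n) (simp_all add: core_F(1))

text \<open>The horizontal coordinates are halved at each step. The heights decrease to a fixed
  point of \<open>psih (19 * Rc)\<close> below \<open>Rc\<close>, and \<open>H_gt\<close> leaves
  only 0.\<close>

lemma core_limit: assumes "X \<in> core" shows "(\<lambda>n. rd ((F ^^ n) X)) \<longlonglongrightarrow> 0"
proof -
  note c = core_funpow[OF assms]
  have b: "\<bar>uu (rd ((F ^^ n) X))\<bar> \<le> (1/2) ^ n * \<bar>uu (rd X)\<bar> \<and> \<bar>ss (rd ((F ^^ n) X))\<bar> \<le> (1/2) ^ n * \<bar>ss (rd X)\<bar>" for n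
  proof (induction n)
    case (Suc n)
    then show ?case using core_F(2,3)[OF c[of n]] by simp
  qed simp
  have z: "(\<lambda>n. (1/2) ^ n * c) \<longlonglongrightarrow> 0" for c :: real
    using tendsto_mult_left_zero[OF LIMSEQ_power_zero[of "1/2::real"]] by simp
  have u: "(\<lambda>n. uu (rd ((F ^^ n) X))) \<longlonglongrightarrow> 0"
    by (rule Lim_null_comparison[OF _ z[of "\<bar>uu (rd X)\<bar>"]]) (use b in simp)
  have s: "(\<lambda>n. ss (rd ((F ^^ n) X))) \<longlonglongrightarrow> 0"
    by (rule Lim_null_comparison[OF _ z[of "\<bar>ss (rd X)\<bar>"]]) (use b in simp)
  define t where "t n = wa ((F ^^ n) X)" for n
  have dec: "decseq t" unfolding decseq_Suc_iff using core_F(4)[OF c] by (simp add: t_def)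
  obtain L where L: "t \<longlonglongrightarrow> L" "\<And>n. L \<le> t n"
    using decseq_convergent[OF dec, of 0] wa_nonneg by (auto simp: t_def)
  have L0: "0 \<le> L" by (rule LIMSEQ_le_const[OF L(1)]) (simp add: t_def wa_nonneg)
  have "L < Rc" using L(2)[of 0] assms by (simp add: t_def core_def)
  moreover have "psih (19 * Rc) L = L"
  proof (rule LIMSEQ_unique)
    have "isCont (psih (19 * Rc)) L" by (rule DERIV_isCont[OF DERIV_psih])
    then show "(\<lambda>n. psih (19 * Rc) (t n)) \<longlonglongrightarrow> psih (19 * Rc) L" using L(1) by (rule isCont_tendsto_compose)
    have "psih (19 * Rc) (t n) = t (Suc n)" for n using core_F(5)[OF c[of n]] by (simp add: t_def)
    then show "(\<lambda>n. psih (19 * Rc) (t n)) \<longlonglongrightarrow> L" using LIMSEQ_Suc[OF L(1)] by simp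
  qed
  ultimately have "L = 0" using psih_fixed L0 by blast
  then have "(\<lambda>n. wa ((F ^^ n) X)) \<longlonglongrightarrow> 0" using L(1) by (simp add: t_def[abs_def])
  then have w: "(\<lambda>n. ww (rd ((F ^^ n) X))) \<longlonglongrightarrow> 0"
    unfolding wa_def wb_def by (simp only: tendsto_rabs_zero_iff)
  have "(\<lambda>n. uu (rd ((F ^^ n) X)) *\<^sub>R eu + ss (rd ((F ^^ n) X)) *\<^sub>R es + ww (rd ((F ^^ n) X)) *\<^sub>R ew) \<longlonglongrightarrow>
      0 *\<^sub>R eu + 0 *\<^sub>R es + 0 *\<^sub>R ew"
    by (intro tendsto_intros u s w)
  then show ?thesis unfolding coords_expand[symmetric] by simp
qed

text \<open>An orbit that never met the support of the bump would have \<open>tau\<close> multiplied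
  by 20 at each step, against its bound.\<close>

lemma eventually_core: assumes "X \<in> Bs" shows "\<exists>n. (F ^^ n) X \<in> core"
proof -
  have B: "(F ^^ n) X \<in> Bs" for n using assms by (simp add: Bs_funpow)
  have w: "wa ((F ^^ n) X) \<le> 1/2" for n using B[of n] Bs_lens by blast
  have "\<exists>n. 0 < rr ((F ^^ n) X)"
  proof (rule ccontr)
    assume "\<not> ?thesis"
    then have r: "rr ((F ^^ n) X) = 0" for n using rr_bounds(1)[of "(F ^^ n) X"] by (simp add: not_less antisym)
    have t: "tau ((F ^^ n) X) = 20 ^ n * tau X" for n
    proof (induction n)
      case (Suc n)
      have "tau ((F ^^ Suc n) X) = 20 * tau ((F ^^ n) X)"
        using F_lens_coeffs(2)[OF w[of n]] tau_G[of "(F ^^ n) X"] r[of n] by simp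
      then show ?case using Suc by simp
    qed simp
    have pos: "0 < tau X" using assms wa_nonneg[of X] by (simp add: Bs_def)
    obtain n where "1 / tau X < 20 ^ n" using real_arch_pow[of "20::real" "1 / tau X"] by auto
    then have "1 < tau ((F ^^ n) X)" using pos by (simp add: t field_simps)
    then show False using tau_small[of "(F ^^ n) X"] by simp
  qed
  then obtain n where "0 < rr ((F ^^ n) X)" ..
  then have "(F ^^ Suc n) X \<in> core" using Bs_core[OF B[of n]] by simp
  then show ?thesis by blast
qed

lemma zero_core: "0 \<in> core"
  using rr_0 Rc_pos by (simp add: core_def wa_def wb_def)

lemma F_0: "torus_map F (torus_proj 0) = torus_proj 0"
proof -
  have "wa 0 \<le> 1/2" by (simp add: wa_def wb_def)
  then have "F 0 = pp 0 *\<^sub>R ew" using F_G(1) G_0 by (simp only: add_0)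
  moreover have "wa (F 0) = 0" using psih_values(1)[OF rr_bounds[of 0]] by (simp add: wa_F) (simp add: wa_def wb_def)
  moreover have "pp 0 = 0" by (simp add: pp_def hp_def psih_def psi0_lo)
  ultimately have "F 0 = 0" by simp
  then show ?thesis by (simp add: torus_map_proj[OF lattice_map_F])
qed

text \<open>Conversely, convergence to the origin forces the orbit into the open set
  \<open>Bs\<close> modulo the lattice, and \<open>Bs\<close> is invariant in both time
  directions.\<close>

lemma vimage_basin: "torus_proj -` basin (torus_map F) (torus_proj 0) = Bs"
proof (intro equalityI subsetI)
  fix X assume "X \<in> Bs"
  then obtain m where "(F ^^ m) X \<in> core" using eventually_core by blast
  then have "(\<lambda>n. rd ((F ^^ n) ((F ^^ m) X))) \<longlonglongrightarrow> 0" by (rule core_limit)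
  moreover have "isCont (torus_proj :: real ^ 3 \<Rightarrow> _) 0"
    using continuous_torus_proj[of "UNIV :: (real ^ 3) set"] by (simp add: continuous_on_eq_continuous_at)
  ultimately have "(\<lambda>n. torus_proj (rd ((F ^^ n) ((F ^^ m) X)))) \<longlonglongrightarrow> torus_proj 0"
    by (rule isCont_tendsto_compose[rotated])
  then have "(\<lambda>n. (torus_map F ^^ (n + m)) (torus_proj X)) \<longlonglongrightarrow> torus_proj 0"
    by (simp add: funpow_torus_map[OF lattice_map_F] funpow_add)
  then have "(\<lambda>n. (torus_map F ^^ n) (torus_proj X)) \<longlonglongrightarrow> torus_proj 0"
    by (rule LIMSEQ_offset)
  then show "X \<in> torus_proj -` basin (torus_map F) (torus_proj 0)" by (simp add: basin_def)
next
  fix X :: "real ^ 3" assume "X \<in> torus_proj -` basin (torus_map F) (torus_proj 0)"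
  then have lim: "(\<lambda>n. torus_proj ((F ^^ n) X)) \<longlonglongrightarrow> torus_proj 0"
    by (simp add: basin_def funpow_torus_map[OF lattice_map_F])
  have "open (torus_proj ` Bs)" by (rule open_torus_proj_image[OF open_Bs])
  moreover have "torus_proj 0 \<in> torus_proj ` Bs" using core_Bs[OF zero_core] by (rule imageI)
  ultimately have "\<forall>\<^sub>F n in sequentially. torus_proj ((F ^^ n) X) \<in> torus_proj ` Bs"
    using lim by (rule topological_tendstoD[rotated])
  then obtain n where "torus_proj ((F ^^ n) X) \<in> torus_proj ` Bs"
    using eventually_happens'[OF sequentially_bot] by blast
  then obtain Y where "torus_proj ((F ^^ n) X) = torus_proj Y" "Y \<in> Bs" by (rule imageE)
  then show "X \<in> Bs" using Bs_proj Bs_funpow by blast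
qed

lemma mem_basin: "torus_proj X \<in> basin (torus_map F) (torus_proj 0) \<longleftrightarrow> wa X < tau X"
  using vimage_basin by (auto simp: Bs_def)

lemma basin_eq: "basin (torus_map F) (torus_proj 0) = torus_proj ` Bs"
proof -
  have "surj (torus_proj :: real ^ 3 \<Rightarrow> _)" unfolding surj_def using torus_proj_surj by metis
  then show ?thesis unfolding vimage_basin[symmetric] by (rule surj_image_vimage_eq[symmetric])
qed

text \<open>In the core no eigencoordinate grows in modulus, so small boxes in these coordinates are
  forward invariant; this gives Lyapunov stability.\<close>

lemma sink_F: "sink (torus_map F) (torus_proj 0)"
  unfolding sink_def
proof (intro conjI allI impI)
  show "torus_map F (torus_proj 0) = torus_proj 0" by (rule F_0)
  have "open (basin (torus_map F) (torus_proj 0))"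
    unfolding basin_eq by (rule open_torus_proj_image[OF open_Bs])
  moreover have "torus_proj 0 \<in> basin (torus_map F) (torus_proj 0)"
    using core_Bs[OF zero_core] by (simp add: basin_eq)
  ultimately show "\<exists>W. open W \<and> torus_proj 0 \<in> W \<and> W \<subseteq> basin (torus_map F) (torus_proj 0)" by blast
  fix U :: "3 torus set" assume U: "open U \<and> torus_proj 0 \<in> U"
  then have "open (torus_proj -` U)" "0 \<in> torus_proj -` U" by (simp_all add: open_torus_def)
  then obtain r where r: "0 < r" "ball 0 r \<subseteq> torus_proj -` U" using open_contains_ball by blast
  define M where "M = norm eu + norm es + norm ew"
  \<comment> \<open>\<open>Rc / 10\<close> puts the box inside the core; \<open>r / (M + 1)\<close>
    puts it inside the ball, as norms in the box are at most \<open>e * M\<close>.\<close>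
  define e where "e = min (Rc / 10) (r / (M + 1))"
  have M: "0 \<le> M" by (simp add: M_def)
  have e: "0 < e" "e \<le> Rc / 10" "e \<le> r / (M + 1)" using r M Rc_pos by (simp_all only: e_def min.cobounded1 min.cobounded2) simp
  define B where "B = {Y. \<bar>uu Y\<bar> < e \<and> \<bar>ss Y\<bar> < e \<and> \<bar>ww Y\<bar> < e}"
  have oB: "open B" unfolding B_def
    by (intro open_Collect_conj open_Collect_less continuous_on_rabs continuous_coords continuous_on_id continuous_on_const)
  have BU: "torus_proj Y \<in> U" if "Y \<in> B" for Y
  proof -
    have "norm Y \<le> norm (uu Y *\<^sub>R eu) + norm (ss Y *\<^sub>R es) + norm (ww Y *\<^sub>R ew)"
      by (subst coords_expand[of Y]) (intro order_trans[OF norm_triangle_ineq] add_right_mono norm_triangle_ineq)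
    also have "\<dots> \<le> e * norm eu + e * norm es + e * norm ew"
      using that by (intro add_mono) (auto simp: B_def intro!: mult_right_mono)
    also have "\<dots> = e * M" by (simp add: M_def algebra_simps)
    also have "\<dots> < e * (M + 1)" using e by simp
    also have "\<dots> \<le> r" using e(3) M by (simp add: pos_le_divide_eq)
    finally show ?thesis using r(2) by (auto simp: subset_iff)
  qed
  have rd: "rd Y = Y \<and> Y \<in> core" if "Y \<in> B" for Y
  proof -
    have c: "\<bar>uu Y\<bar> < Rc / 10" "\<bar>ss Y\<bar> < Rc / 10" "\<bar>ww Y\<bar> < Rc / 10" using that e(2) by (auto simp: B_def)
    have "\<bar>mu * uu Y\<bar> \<le> 10 * \<bar>uu Y\<bar>" "\<bar>lam * ss Y\<bar> \<le> 1 * \<bar>ss Y\<bar>" unfolding abs_mult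
      using mu_bounds lam_bounds mult_right_mono[of mu 10 "\<bar>uu Y\<bar>"] mult_right_mono[of lam 1 "\<bar>ss Y\<bar>"] by simp_all
    then have "\<bar>mu * uu Y\<bar> < 1/4" "\<bar>lam * ss Y\<bar> < 1/4" "\<bar>uu Y\<bar> < 1/4" "\<bar>ss Y\<bar> < 1/4" "\<bar>ww Y\<bar> < 1"
      using c by (auto simp: Rc_def)
    then have "\<bar>Y $ 1\<bar> < 1/2 \<and> \<bar>Y $ 2\<bar> < 1/2 \<and> \<bar>Y $ 3\<bar> < 1/2" unfolding nth_of_coords by (auto simp: abs_if split: if_splits)
    then have Y: "rd Y = Y" by (intro rd_small) (metis exhaust_3)
    have "(uu Y)\<^sup>2 \<le> (Rc / 10)\<^sup>2" "(ss Y)\<^sup>2 \<le> (Rc / 10)\<^sup>2"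
      using c power_mono[of "\<bar>uu Y\<bar>" "Rc / 10" 2] power_mono[of "\<bar>ss Y\<bar>" "Rc / 10" 2] by auto
    moreover have "(Rc / 10)\<^sup>2 + (Rc / 10)\<^sup>2 \<le> nu\<^sup>2" by (simp add: Rc_def nu_def power2_eq_square)
    ultimately have "qq (uu Y) (ss Y) \<le> 1" by (simp add: qq_def nu_def)
    then have "rr Y = 19 * Rc" by (simp add: rr_def hr_def Y rf_core)
    then show ?thesis using c Y Rc_pos by (simp add: core_def wa_def wb_def)
  qed
  have step: "rd (F Y) \<in> B" if "Y \<in> B" for Y
  proof -
    have h: "a < e" if "a \<le> 1/2 * b" "0 \<le> a" "b < e" for a b using that by linarith
    show ?thesis
      using core_F(2-4)[of Y] rd[OF that] that h[OF core_F(2)[of Y] abs_ge_zero] h[OF core_F(3)[of Y] abs_ge_zero]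
      by (auto simp: B_def wa_def wb_def)
  qed
  have orbit: "torus_proj ((F ^^ n) Y) \<in> torus_proj ` B" if "Y \<in> B" for n Y
  proof (induction n)
    case 0 then show ?case using that by simp
  next
    case (Suc n)
    then obtain Z where Z: "torus_proj ((F ^^ n) Y) = torus_proj Z" "Z \<in> B" by (rule imageE)
    have "torus_proj ((F ^^ Suc n) Y) = torus_proj (rd (F Z))" using pj_F[OF Z(1)] by simp
    then show ?case using step[OF Z(2)] by blast
  qed
  show "\<exists>V. open V \<and> torus_proj 0 \<in> V \<and> (\<forall>x\<in>V. \<forall>n. (torus_map F ^^ n) x \<in> U)"
  proof (intro exI[of _ "torus_proj ` B"] conjI ballI allI)
    show "open (torus_proj ` B)" by (rule open_torus_proj_image[OF oB])
    show "torus_proj 0 \<in> torus_proj ` B" using e by (intro imageI) (simp add: B_def)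
    fix x n assume "x \<in> torus_proj ` B"
    then obtain Y where Y: "x = torus_proj Y" "Y \<in> B" by (rule imageE)
    obtain Z where "torus_proj ((F ^^ n) Y) = torus_proj Z" "Z \<in> B" using orbit[OF Y(2), of n] by (rule imageE)
    then show "(torus_map F ^^ n) x \<in> U" using BU[of Z] Y(1) by (simp add: funpow_torus_map[OF lattice_map_F])
  qed
qed

lemma image_Compl_basin: "torus_map F ` (- basin (torus_map F) (torus_proj 0)) = - basin (torus_map F) (torus_proj 0)"
proof -
  have b: "bij (torus_map F)" using torus_diffeo_F by (simp add: torus_diffeo_def)
  have v: "torus_map F p \<in> basin (torus_map F) (torus_proj 0) \<longleftrightarrow> p \<in> basin (torus_map F) (torus_proj 0)" for p
  proof -
    obtain X where X: "p = torus_proj X" using torus_proj_surj by metis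
    show ?thesis using Bs_F[of X] unfolding X torus_map_proj[OF lattice_map_F] mem_basin by (simp add: Bs_def)
  qed
  show ?thesis
  proof (intro equalityI subsetI)
    fix q assume q: "q \<in> - basin (torus_map F) (torus_proj 0)"
    obtain p where "q = torus_map F p" using b by (meson bij_pointE)
    then show "q \<in> torus_map F ` (- basin (torus_map F) (torus_proj 0))" using q v by blast
  qed (use v in blast)
qed

text \<open>Where \<open>tau\<close> is positive, sliding towards the zero level enters
  \<open>Bs\<close>. Where it vanishes, the point has height zero, and \<open>tau_pos_dense\<close>
  gives nearby points with positive \<open>tau\<close>, which a vertical translation brings to
  height zero.\<close>

lemma closure_Bs: "closure Bs = {X. wa X \<le> tau X}"
proof
  have "closed {X. wa X \<le> tau X}" by (intro closed_Collect_le continuous_wa continuous_tau)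
  then show "closure Bs \<subseteq> {X. wa X \<le> tau X}" by (rule closure_minimal[rotated]) (auto simp: Bs_def)
  show "{X. wa X \<le> tau X} \<subseteq> closure Bs"
  proof
    fix X assume X: "X \<in> {X. wa X \<le> tau X}"
    show "X \<in> closure Bs" unfolding closure_iff_nhds_not_empty
    proof (intro allI impI)
      fix A V assume V: "V \<subseteq> A" "open V" "X \<in> V"
      obtain n where n: "ww X = wb X + 117 * of_int n" by (rule ww_wb)
      show "Bs \<inter> A \<noteq> {}"
      proof (cases "tau X = 0")
        case False
        then have t: "0 < tau X" using tau_bounds(1)[of X] by simp
        define p where "p s = X + (- s * wb X) *\<^sub>R ew" for s
        have "continuous_on UNIV p" unfolding p_def by (intro continuous_intros)
        then have "open (p -` V)" using V(2) open_vimage by blast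
        moreover have "0 \<in> p -` V" using V(3) by (simp add: p_def)
        ultimately obtain r where r: "0 < r" "ball 0 r \<subseteq> p -` V" using open_contains_ball by blast
        define s where "s = min (r / 2) (1/2)"
        have s: "0 < s" "s < r" "s \<le> 1/2" using r by (simp_all add: s_def)
        have "ww (p s) = (1 - s) * wb X + 117 * of_int n" by (simp add: p_def n algebra_simps)
        moreover have "\<bar>(1 - s) * wb X\<bar> = (1 - s) * wa X" using s by (simp add: abs_mult wa_def)
        moreover have "(1 - s) * wa X \<le> 1 * wa X" using s wa_nonneg by (intro mult_right_mono) auto
        ultimately have w: "wa (p s) = (1 - s) * wa X" using wb_shift(1)[of "p s" "(1 - s) * wb X" n] wb_bound[of X] by simp
        have "(1 - s) * wa X \<le> (1 - s) * tau X" using X s by (intro mult_left_mono) auto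
        also have "\<dots> < tau X" using s t by simp
        finally have "p s \<in> Bs" unfolding Bs_def using w tau_vertical[of X "- s * wb X", folded p_def] by simp
        moreover have "p s \<in> V" using r(2) s by (auto simp: subset_iff)
        ultimately show ?thesis using V(1) by blast
      next
        case True
        then have w: "wb X = 0" using X wa_nonneg[of X] by (simp add: wa_def)
        define p where "p Y = Y + (ww X - ww Y) *\<^sub>R ew" for Y
        have "continuous_on UNIV p" unfolding p_def by (intro continuous_intros)
        then have "open (p -` V)" using V(2) open_vimage by blast
        moreover have "X \<in> p -` V" using V(3) by (simp add: p_def)
        ultimately obtain r where r: "0 < r" "ball X r \<subseteq> p -` V" using open_contains_ball by blast
        obtain Y where Y: "dist X Y < r" "0 < tau Y" using tau_pos_dense[OF r(1)] by blast
        have "ww (p Y) = 0 + 117 * of_int n" by (simp add: p_def n w)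
        then have "wa (p Y) = 0" using wb_shift(1)[of "p Y" 0 n] by simp
        then have "p Y \<in> Bs" unfolding Bs_def using Y by (simp add: p_def)
        moreover have "p Y \<in> V" using r(2) Y by (auto simp: subset_iff)
        ultimately show ?thesis using V(1) by blast
      qed
    qed
  qed
qed

lemma frontier_Bs: "frontier Bs = {X. wb X = tau X} \<union> {X. wb X = - tau X}"
proof -
  have "frontier Bs = {X. wa X = tau X}"
    unfolding frontier_def closure_Bs interior_open[OF open_Bs] by (auto simp: Bs_def)
  then show ?thesis using tau_bounds(1) by (auto simp: wa_def abs_if) (smt (verit))+
qed

subsection \<open>The boundary tori\<close>

definition Dt :: "real ^ 3 \<Rightarrow> real ^ 3 \<Rightarrow> real" where
  "Dt X v = fst (dtau X) * uu v + snd (dtau X) * ss v"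

lemma has_derivative_Dt: "(tau has_derivative Dt X) (at X)"
  using has_derivative_tau[of X] by (simp add: Dt_def[abs_def])

lemma Dt_linear [simp]: "Dt X (v + w) = Dt X v + Dt X w" "Dt X (v - w) = Dt X v - Dt X w"
  "Dt X (c *\<^sub>R v) = c * Dt X v" "Dt X ew = 0"
  by (simp_all add: Dt_def algebra_simps)

lemma Dt_vertical [simp]: "Dt (X + c *\<^sub>R ew) = Dt X"
proof -
  have "((\<lambda>Y. Y + c *\<^sub>R ew) has_derivative (\<lambda>v. v)) (at X)" by (auto intro!: derivative_eq_intros)
  then have "((\<lambda>Y. tau (Y + c *\<^sub>R ew)) has_derivative (\<lambda>v. Dt (X + c *\<^sub>R ew) v)) (at X)"
    by (rule has_derivative_compose[OF _ has_derivative_Dt])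
  then have "(tau has_derivative Dt (X + c *\<^sub>R ew)) (at X)" by simp
  then show ?thesis using has_derivative_Dt by (rule has_derivative_unique)
qed

lemma Dt_bound: "\<bar>Dt X v\<bar> \<le> \<bar>uu v\<bar> + \<bar>ss v\<bar>"
proof -
  have "\<bar>fst (dtau X)\<bar> \<le> 1" "\<bar>snd (dtau X)\<bar> \<le> 1"
    using dtau(3)[of X] norm_fst_le[of "fst (dtau X)" "snd (dtau X)"] norm_snd_le[of "snd (dtau X)" "fst (dtau X)"] by simp_all
  then have "\<bar>fst (dtau X)\<bar> * \<bar>uu v\<bar> \<le> 1 * \<bar>uu v\<bar>" "\<bar>snd (dtau X)\<bar> * \<bar>ss v\<bar> \<le> 1 * \<bar>ss v\<bar>"
    by (intro mult_right_mono; simp)+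
  then show ?thesis
    unfolding Dt_def abs_mult[symmetric]
    using abs_triangle_ineq[of "fst (dtau X) * uu v" "snd (dtau X) * ss v"] by linarith
qed

text \<open>Differentiate \<open>tau_G\<close>; up to height 1/2 the maps \<open>F\<close> and
  \<open>G\<close> differ only vertically, which \<open>Dt\<close> ignores.\<close>

lemma Dt_F: assumes "wa X \<le> 1/2" shows "Dt (F X) (DF X v) = 20 * Dt X v - (ru X * uu v + rs X * ss v)"
proof -
  define D where "D v = (ga X * uu v + gp X * ss v) *\<^sub>R eu + (lam * ss v) *\<^sub>R es + ww v *\<^sub>R ew" for v
  have "(G has_derivative D) (at X)" using has_derivative_G[of X] by (simp add: D_def[abs_def])
  then have "((\<lambda>Y. tau (G Y)) has_derivative (\<lambda>v. Dt (G X) (D v))) (at X)"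
    by (rule has_derivative_compose[OF _ has_derivative_Dt])
  then have 1: "((\<lambda>Y. 20 * tau Y - rr Y) has_derivative (\<lambda>v. Dt (G X) (D v))) (at X)" by (simp add: tau_G)
  have "((\<lambda>Y. 20 * tau Y - rr Y) has_derivative (\<lambda>v. 20 * Dt X v - (ru X * uu v + rs X * ss v))) (at X)"
    by (intro has_derivative_diff has_derivative_mult_right has_derivative_Dt has_derivative_rr)
  then have "(\<lambda>v. Dt (G X) (D v)) = (\<lambda>v. 20 * Dt X v - (ru X * uu v + rs X * ss v))"
    by (rule has_derivative_unique[OF 1])
  then have "Dt (G X) (D v) = 20 * Dt X v - (ru X * uu v + rs X * ss v)" by (rule fun_cong)
  moreover have "Dt (F X) (DF X v) = Dt (G X) (D v)"
  proof -
    have "Dt (F X) = Dt (G X)" using F_G(1)[OF assms] by simp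
    then show ?thesis using assms by (simp add: Dt_def[of "G X"] D_def F_G(2,3)[OF assms] fb_eq fbp_lo)
  qed
  ultimately show ?thesis by simp
qed

definition sheet :: "real \<Rightarrow> (real ^ 3) set" where "sheet \<epsilon> = {X. wb X = \<epsilon> * tau X}"

text \<open>Conormal form of the sheet: its kernel at a point of the graph is the tangent
  plane.\<close>

definition om :: "real \<Rightarrow> real ^ 3 \<Rightarrow> real ^ 3 \<Rightarrow> real" where "om \<epsilon> X v = ww v - \<epsilon> * Dt X v"

lemma sheet_wa: assumes "X \<in> sheet \<epsilon>" "\<bar>\<epsilon>\<bar> = 1" shows "wa X = tau X" "wa X \<le> 1/2"
proof -
  show "wa X = tau X" using assms tau_bounds(1)[of X] by (simp add: sheet_def wa_def abs_mult)
  then show "wa X \<le> 1/2" using tau_small[of X] by simp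
qed

lemma psih_sign: "\<bar>\<epsilon>\<bar> = 1 \<Longrightarrow> psih r (\<epsilon> * w) = \<epsilon> * psih r w"
  using psih_minus[of r w] by (cases "\<epsilon> = 1") (auto simp: abs_if split: if_splits)

lemma sheet_F: assumes "X \<in> sheet \<epsilon>" "\<bar>\<epsilon>\<bar> = 1" shows "F X \<in> sheet \<epsilon>"
proof -
  note w = sheet_wa[OF assms]
  have "wb (F X) = psih (rr X) (wb X)" using w by (intro wb_F) simp
  also have "\<dots> = \<epsilon> * psih (rr X) (tau X)" using assms by (simp add: sheet_def psih_sign)
  finally show ?thesis by (simp add: sheet_def psih_tau F_lens_coeffs[OF w(2)])
qed

text \<open>Here the properties of \<open>H\<close> at 1 are used: zero slope leaves the vertical
  rate 20 unchanged, and the value \<epsilon> makes the derivative in the bump equal to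
  \<open>- \<epsilon>\<close>. Where the bump vanishes so do its derivatives.\<close>

lemma sheet_coeffs:
  assumes "X \<in> sheet \<epsilon>" "\<bar>\<epsilon>\<bar> = 1"
  shows "fd X = 20" "fc X = - \<epsilon> * ru X" "fq X = - \<epsilon> * rs X"
proof -
  note w = sheet_wa[OF assms]
  have "fd X = 20 \<and> fc X = - \<epsilon> * ru X \<and> fq X = - \<epsilon> * rs X"
  proof (cases "rr X = 0")
    case True
    then have "rf (uu (rd X)) (ss (rd X)) = 0" by (simp add: rr_def hr_def)
    note z = rf_deriv_zero[OF this]
    show ?thesis using fd_20(2)[OF True] w by (simp add: fc_def fq_def ru_def rs_def z)
  next
    case False
    then have r: "0 < rr X" using rr_bounds(1)[of X] by simp
    have "20 * wb X / (rr X + Rc) = \<epsilon>"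
      using assms(1) tau_lens[OF r] r Rc_pos by (simp add: sheet_def nonzero_divide_eq_eq)
    moreover have "H \<epsilon> = \<epsilon>" "dH \<epsilon> = 0"
      using assms(2) H_1 dH_1 H_minus[of 1] dH_minus[of 1] by (auto simp: abs_if split: if_splits)
    moreover have "dpsi0 (wb X) = 20" using w by (intro dpsi0_lo) (simp add: wa_def)
    ultimately show ?thesis by (simp add: fd_def fc_def fq_def dpsih_def cpsih_def ru_def rs_def)
  qed
  then show "fd X = 20" "fc X = - \<epsilon> * ru X" "fq X = - \<epsilon> * rs X" by auto
qed

text \<open>The bump derivatives in \<open>fc\<close> and \<open>fq\<close> cancel those in
  \<open>Dt_F\<close>, and the pure factor 20 remains.\<close>

lemma om_F:
  assumes "X \<in> sheet \<epsilon>" "\<bar>\<epsilon>\<bar> = 1"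
  shows "om \<epsilon> (F X) (DF X v) = 20 * om \<epsilon> X v"
  unfolding om_def Dt_F[OF sheet_wa(2)[OF assms]] by (simp add: sheet_coeffs[OF assms] algebra_simps)

lemma om_scale: "om \<epsilon> X (c *\<^sub>R v) = c * om \<epsilon> X v"
  by (simp add: om_def algebra_simps)

text \<open>
  The normal direction of a sheet is expanded by 20, faster than both \<open>wc\<close> and \<open>ws\<close>; so their
  normal components, being bounded, vanish.
\<close>
lemma om_wc: assumes "X \<in> sheet \<epsilon>" "\<bar>\<epsilon>\<bar> = 1" shows "om \<epsilon> X (wc X) = 0"
proof -
  have "\<bar>om \<epsilon> X (wc X)\<bar> = 0"
  \<comment> \<open>The rate is 18/20; the bound 3 covers \<open>7/5\<close> from \<open>th\<close>
    plus 1 from \<open>Dt\<close>.\<close>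
  proof (rule vanishing_of_contraction[where N = "sheet \<epsilon>" and F = F and q = "9/10" and C = 3
        and \<delta> = "\<lambda>X. \<bar>om \<epsilon> X (wc X)\<bar>" and x = X])
    fix X assume X: "X \<in> sheet \<epsilon>"
    note w = sheet_wa(2)[OF X assms(2)] and FX = sheet_F[OF X assms(2)]
    have "\<bar>\<epsilon> * Dt X (wc X)\<bar> \<le> 1" using Dt_bound[of X "wc X"] assms(2) w by (simp add: abs_mult wc_lens)
    moreover have "\<bar>ww (wc X)\<bar> \<le> 7/5" using th(4)[of X] w by (simp add: wc_lens)
    ultimately show "0 \<le> \<bar>om \<epsilon> X (wc X)\<bar> \<and> \<bar>om \<epsilon> X (wc X)\<bar> \<le> 3" unfolding om_def by linarith
    have "DF X (wc X) = fa X *\<^sub>R wc (F X)"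
      using DF_wc_lens[OF w] sheet_wa(2)[OF FX assms(2)] by (simp add: wc_lens)
    then have "20 * om \<epsilon> X (wc X) = fa X * om \<epsilon> (F X) (wc (F X))"
      using om_F[OF X assms(2), of "wc X"] by (simp add: om_scale)
    then have "20 * \<bar>om \<epsilon> X (wc X)\<bar> = \<bar>fa X\<bar> * \<bar>om \<epsilon> (F X) (wc (F X))\<bar>"
      by (metis abs_mult abs_numeral)
    also have "\<dots> \<le> 18 * \<bar>om \<epsilon> (F X) (wc (F X))\<bar>" using fa_bounds[of X] by (intro mult_right_mono) auto
    finally show "\<bar>om \<epsilon> X (wc X)\<bar> = 0 \<or> F X \<in> sheet \<epsilon> \<and>
        \<bar>om \<epsilon> X (wc X)\<bar> \<le> 9/10 * \<bar>om \<epsilon> (F X) (wc (F X))\<bar>" using FX by simp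
  qed (use assms in auto)
  then show ?thesis by simp
qed

lemma om_ws: assumes "X \<in> sheet \<epsilon>" "\<bar>\<epsilon>\<bar> = 1" shows "om \<epsilon> X (ws X) = 0"
proof -
  obtain C where C: "\<And>X. norm (si X) \<le> C" using si(3) by blast
  have "\<bar>om \<epsilon> X (ws X)\<bar> = 0"
  proof (rule vanishing_of_contraction[where N = "sheet \<epsilon>" and F = F and q = "1/2" and C = "C + (C + 1)"
        and \<delta> = "\<lambda>X. \<bar>om \<epsilon> X (ws X)\<bar>" and x = X])
    fix X assume X: "X \<in> sheet \<epsilon>"
    note FX = sheet_F[OF X assms(2)]
    have s: "\<bar>fst (si X)\<bar> \<le> C" "\<bar>snd (si X)\<bar> \<le> C"
      using C[of X] norm_fst_le[of "fst (si X)" "snd (si X)"] norm_snd_le[of "snd (si X)" "fst (si X)"] by simp_all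
    have "\<bar>\<epsilon> * Dt X (ws X)\<bar> \<le> C + 1" using Dt_bound[of X "ws X"] assms(2) s by (simp add: abs_mult)
    moreover have "\<bar>ww (ws X)\<bar> \<le> C" using s by simp
    ultimately show "0 \<le> \<bar>om \<epsilon> X (ws X)\<bar> \<and> \<bar>om \<epsilon> X (ws X)\<bar> \<le> C + (C + 1)" unfolding om_def by linarith
    have "20 * om \<epsilon> X (ws X) = lam * om \<epsilon> (F X) (ws (F X))"
      using om_F[OF X assms(2), of "ws X"] by (simp add: om_scale DF_ws)
    then have "20 * \<bar>om \<epsilon> X (ws X)\<bar> = \<bar>lam\<bar> * \<bar>om \<epsilon> (F X) (ws (F X))\<bar>"
      by (metis abs_mult abs_numeral)
    also have "\<dots> \<le> 1 * \<bar>om \<epsilon> (F X) (ws (F X))\<bar>" using lam_bounds by (intro mult_right_mono) auto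
    finally show "\<bar>om \<epsilon> X (ws X)\<bar> = 0 \<or> F X \<in> sheet \<epsilon> \<and>
        \<bar>om \<epsilon> X (ws X)\<bar> \<le> 1/2 * \<bar>om \<epsilon> (F X) (ws (F X))\<bar>" using FX by linarith
  qed (use assms in auto)
  then show ?thesis by simp
qed

text \<open>Both lines lie in the kernel by \<open>om_wc\<close> and \<open>om_ws\<close>.
  Conversely, subtracting the combination with matching \<open>uu\<close> and \<open>ss\<close>
  leaves a vertical vector, and \<open>om\<close> is injective on these.\<close>

lemma bundle_sum_sheet:
  assumes "X \<in> sheet \<epsilon>" "\<bar>\<epsilon>\<bar> = 1"
  shows "bundle_sum (line_field wc) (line_field ws) (torus_proj X) = {v. om \<epsilon> X v = 0}"
proof -
  note w = sheet_wa(2)[OF assms]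
  have "bundle_sum (line_field wc) (line_field ws) (torus_proj X) = {a *\<^sub>R wc X + b *\<^sub>R ws X |a b. True}"
    unfolding bundle_sum_def line_field_proj[OF periodic_frames(1)] line_field_proj[OF periodic_frames(2)] span_singleton
    by auto
  also have "\<dots> = {v. om \<epsilon> X v = 0}"
  proof (intro equalityI subsetI)
    fix v assume "v \<in> {a *\<^sub>R wc X + b *\<^sub>R ws X |a b. True}"
    then obtain a b where "v = a *\<^sub>R wc X + b *\<^sub>R ws X" by blast
    then have "om \<epsilon> X v = a * om \<epsilon> X (wc X) + b * om \<epsilon> X (ws X)" by (simp add: om_def algebra_simps)
    then show "v \<in> {v. om \<epsilon> X v = 0}" using om_wc[OF assms] om_ws[OF assms] by simp
  next
    fix v assume v: "v \<in> {v. om \<epsilon> X v = 0}"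
    define a b where "a = uu v - ss v * fst (si X)" and "b = ss v"
    define d where "d = v - (a *\<^sub>R wc X + b *\<^sub>R ws X)"
    have c: "uu d = 0" "ss d = 0" using w by (simp_all add: d_def a_def b_def wc_lens)
    have "om \<epsilon> X d = om \<epsilon> X v - (a * om \<epsilon> X (wc X) + b * om \<epsilon> X (ws X))"
      by (simp add: om_def d_def algebra_simps)
    then have "om \<epsilon> X d = 0" using v om_wc[OF assms] om_ws[OF assms] by simp
    then have "ww d = 0" using c by (simp add: om_def Dt_def)
    then have "d = 0" using c by (intro coords_eqI) simp_all
    then have "v = a *\<^sub>R wc X + b *\<^sub>R ws X" by (simp add: d_def)
    then show "v \<in> {a *\<^sub>R wc X + b *\<^sub>R ws X |a b. True}" by blast
  qed
  finally show ?thesis .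
qed

text \<open>\<open>shadow\<close> forgets the height; it inverts every graph embedding
  \<open>emb \<epsilon>\<close> and yields the inverse homeomorphism on the torus.\<close>

definition inc :: "real ^ 2 \<Rightarrow> real ^ 3" where "inc x = vector [x $ 1, x $ 2, 0]"
definition shadow :: "real ^ 3 \<Rightarrow> real ^ 2" where "shadow X = vector [X $ 1, X $ 2]"
definition emb :: "real \<Rightarrow> real ^ 2 \<Rightarrow> real ^ 3" where "emb \<epsilon> x = inc x + (\<epsilon> * tau (inc x)) *\<^sub>R ew"

lemma nth_inc [simp]: "inc x $ 1 = x $ 1" "inc x $ 2 = x $ 2" "inc x $ 3 = 0"
  and nth_shadow [simp]: "shadow X $ 1 = X $ 1" "shadow X $ 2 = X $ 2"
  and nth_ew [simp]: "ew $ 1 = 0" "ew $ 2 = 0" "ew $ 3 = 1/117"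
  by (simp_all add: inc_def shadow_def ew_def)

lemma shadow_emb: "shadow (inc x + c *\<^sub>R ew) = x"
  by (simp add: vec_eq_iff forall_2)

lemma inc_shadow: "X = inc (shadow X) + ww X *\<^sub>R ew"
  by (simp add: vec_eq_iff forall_3 ww_def)

lemma linear_inc: "linear inc" and linear_shadow: "linear shadow"
  by (auto intro!: linearI simp: vec_eq_iff forall_3 forall_2)

lemma ww_inc [simp]: "ww (inc x) = 0" by (simp add: ww_def)

definition Demb :: "real \<Rightarrow> real ^ 2 \<Rightarrow> real ^ 2 \<Rightarrow> real ^ 3" where
  "Demb \<epsilon> x v = inc v + (\<epsilon> * Dt (inc x) (inc v)) *\<^sub>R ew"

lemma has_derivative_inc: "(inc has_derivative inc) (at x)"
  by (rule bounded_linear_imp_has_derivative[OF linear_conv_bounded_linear[THEN iffD1, OF linear_inc]])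

lemma has_derivative_emb: "(emb \<epsilon> has_derivative Demb \<epsilon> x) (at x)"
proof -
  have "((\<lambda>x. tau (inc x)) has_derivative (\<lambda>v. Dt (inc x) (inc v))) (at x)"
    by (rule has_derivative_compose[OF has_derivative_inc has_derivative_Dt])
  then show ?thesis unfolding emb_def[abs_def] Demb_def[abs_def]
    by (intro has_derivative_add has_derivative_inc has_derivative_scaleR_left has_derivative_mult_right)
qed

lemma continuous_inc: "continuous_on S inc"
  by (rule linear_continuous_on[OF linear_conv_bounded_linear[THEN iffD1, OF linear_inc]])

lemma lattice_map_emb: "lattice_map (emb \<epsilon>)"
  unfolding lattice_map_def
proof (intro allI impI)
  fix x y :: "real ^ 2" and i :: 3
  assume xy: "\<forall>i. x $ i - y $ i \<in> \<int>"
  then have "\<forall>i. inc x $ i - inc y $ i \<in> \<int>" by (simp add: forall_3)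
  then have "tau (inc x) = tau (inc y)" by (intro tau_proj) blast
  then have "\<forall>i. emb \<epsilon> x $ i - emb \<epsilon> y $ i \<in> \<int>" using xy by (simp add: forall_3 emb_def)
  then show "emb \<epsilon> x $ i - emb \<epsilon> y $ i \<in> \<int>" ..
qed

lemma lattice_map_shadow: "lattice_map shadow"
  unfolding lattice_map_def by (simp add: forall_2)

lemma C1_emb: "C1_torus_map (torus_map (emb \<epsilon>))"
proof (rule C1_torus_map_torus_map[OF lattice_map_emb has_derivative_emb])
  fix v
  have "continuous_on UNIV (\<lambda>x. dtau (inc x))"
    by (rule continuous_on_compose2[OF dtau(1) continuous_inc]) simp
  then show "continuous_on UNIV (\<lambda>x. Demb \<epsilon> x v)" unfolding Demb_def Dt_def by (intro continuous_intros)
qed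

lemma continuous_torus_map:
  assumes "lattice_map h" "continuous_on UNIV h"
  shows "continuous_on UNIV (torus_map h)"
proof (rule continuous_on_torusI)
  have "continuous_on UNIV (\<lambda>X. torus_proj (h X))"
    by (rule continuous_on_compose2[OF continuous_torus_proj assms(2) subset_UNIV])
  then show "continuous_on (torus_proj -` UNIV) (\<lambda>X. torus_map h (torus_proj X))"
    by (simp add: torus_map_proj[OF assms(1)])
qed simp

lemma shadow_emb_torus: "torus_map shadow (torus_map (emb \<epsilon>) p) = p"
proof -
  obtain x where "p = torus_proj x" using torus_proj_surj by metis
  then show ?thesis
    by (simp add: torus_map_proj[OF lattice_map_emb] torus_map_proj[OF lattice_map_shadow] emb_def shadow_emb)
qed

lemma C1_embedding_emb: "C1_torus_embedding (torus_map (emb \<epsilon>))"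
  unfolding C1_torus_embedding_def
proof (intro conjI allI exI)
  show "C1_torus_map (torus_map (emb \<epsilon>))" by (rule C1_emb)
  show "inj (torus_deriv (torus_map (emb \<epsilon>)) p)" for p
  proof -
    obtain x where p: "p = torus_proj x" using torus_proj_surj by metis
    show ?thesis unfolding p torus_deriv_torus_map[OF lattice_map_emb has_derivative_emb]
      by (rule inj_on_inverseI[of _ shadow]) (simp add: Demb_def shadow_emb)
  qed
  show "homeomorphism UNIV (range (torus_map (emb \<epsilon>))) (torus_map (emb \<epsilon>)) (torus_map shadow)"
  proof (rule homeomorphismI)
    show "continuous_on UNIV (torus_map (emb \<epsilon>))"
      by (rule continuous_torus_map[OF lattice_map_emb continuous_on_of_derivative[OF has_derivative_emb]])
    have "continuous_on UNIV (torus_map shadow)"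
      by (rule continuous_torus_map[OF lattice_map_shadow linear_continuous_on[OF linear_conv_bounded_linear[THEN iffD1, OF linear_shadow]]])
    then show "continuous_on (range (torus_map (emb \<epsilon>))) (torus_map shadow)"
      by (rule continuous_on_subset) simp
  qed (auto simp: shadow_emb_torus)
qed

lemma emb_sheet: assumes "\<bar>\<epsilon>\<bar> = 1" shows "emb \<epsilon> x \<in> sheet \<epsilon>"
proof -
  have "\<bar>\<epsilon> * tau (inc x)\<bar> < 117/2" using assms tau_bounds(1)[of "inc x"] tau_small[of "inc x"] by (simp add: abs_mult)
  then have "wb (emb \<epsilon> x) = \<epsilon> * tau (inc x)" by (intro wb_shift(2)[where n = 0]) (simp_all add: emb_def)
  then show ?thesis by (simp add: sheet_def emb_def)
qed

lemma range_emb: assumes "\<bar>\<epsilon>\<bar> = 1" shows "range (torus_map (emb \<epsilon>)) = torus_proj ` sheet \<epsilon>"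
proof (intro equalityI subsetI)
  fix q assume "q \<in> range (torus_map (emb \<epsilon>))"
  then obtain p where q: "q = torus_map (emb \<epsilon>) p" by blast
  obtain x where "p = torus_proj x" using torus_proj_surj by metis
  then show "q \<in> torus_proj ` sheet \<epsilon>"
    using emb_sheet[OF assms, of x] by (simp add: q torus_map_proj[OF lattice_map_emb])
next
  fix q assume "q \<in> torus_proj ` sheet \<epsilon>"
  then obtain X where X: "q = torus_proj X" "X \<in> sheet \<epsilon>" by blast
  obtain n where n: "ww X = wb X + 117 * of_int n" by (rule ww_wb)
  have t: "tau (inc (shadow X)) = tau X" by (subst (2) inc_shadow) simp
  have "X $ 3 = \<epsilon> * tau X / 117 + of_int n" using n X(2) by (simp add: ww_def sheet_def)
  then have "\<forall>i. emb \<epsilon> (shadow X) $ i - X $ i \<in> \<int>" by (simp add: forall_3 emb_def t)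
  then have "torus_proj (emb \<epsilon> (shadow X)) = q" by (simp add: X torus_proj_eq_iff)
  then have "q = torus_map (emb \<epsilon>) (torus_proj (shadow X))" by (simp add: torus_map_proj[OF lattice_map_emb])
  then show "q \<in> range (torus_map (emb \<epsilon>))" by blast
qed

lemma tangent_emb: assumes "\<bar>\<epsilon>\<bar> = 1"
  shows "embedded_2torus_tangent_to (torus_proj ` sheet \<epsilon>) (bundle_sum (line_field wc) (line_field ws))"
  unfolding embedded_2torus_tangent_to_def
proof (intro exI[of _ "torus_map (emb \<epsilon>)"] conjI allI)
  show "C1_torus_embedding (torus_map (emb \<epsilon>))" by (rule C1_embedding_emb)
  show "range (torus_map (emb \<epsilon>)) = torus_proj ` sheet \<epsilon>" by (rule range_emb[OF assms])
  fix p :: "2 torus"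
  obtain x where p: "p = torus_proj x" using torus_proj_surj by metis
  have D: "Dt (emb \<epsilon> x) = Dt (inc x)" by (simp add: emb_def)
  have "range (Demb \<epsilon> x) = {v. om \<epsilon> (emb \<epsilon> x) v = 0}"
  proof (intro equalityI subsetI)
    fix v assume "v \<in> range (Demb \<epsilon> x)"
    then show "v \<in> {v. om \<epsilon> (emb \<epsilon> x) v = 0}" by (auto simp: Demb_def om_def D)
  next
    fix v assume "v \<in> {v. om \<epsilon> (emb \<epsilon> x) v = 0}"
    then have v: "ww v = \<epsilon> * Dt (inc x) v" by (simp add: om_def D)
    have "Dt (inc x) v = Dt (inc x) (inc (shadow v))" by (subst inc_shadow) simp
    then have "Demb \<epsilon> x (shadow v) = v" using inc_shadow[of v] v by (simp add: Demb_def)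
    then show "v \<in> range (Demb \<epsilon> x)" by (metis rangeI)
  qed
  then show "range (torus_deriv (torus_map (emb \<epsilon>)) p) = bundle_sum (line_field wc) (line_field ws) (torus_map (emb \<epsilon>) p)"
    unfolding p torus_deriv_torus_map[OF lattice_map_emb has_derivative_emb] torus_map_proj[OF lattice_map_emb]
      bundle_sum_sheet[OF emb_sheet[OF assms] assms] .
qed

lemma frontier_basin:
  "frontier (basin (torus_map F) (torus_proj 0)) = torus_proj ` sheet 1 \<union> torus_proj ` sheet (- 1)"
proof -
  have s: "surj (torus_proj :: real ^ 3 \<Rightarrow> _)" unfolding surj_def using torus_proj_surj by metis
  have "torus_proj -` frontier (basin (torus_map F) (torus_proj 0)) = sheet 1 \<union> sheet (- 1)"
    unfolding vimage_frontier_torus vimage_basin frontier_Bs by (simp add: sheet_def)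
  then have "torus_proj ` (torus_proj -` frontier (basin (torus_map F) (torus_proj 0))) = torus_proj ` (sheet 1 \<union> sheet (- 1))"
    by (rule arg_cong)
  then show ?thesis unfolding surj_image_vimage_eq[OF s] image_Un .
qed

text \<open>Over the origin the lens has height \<open>Rc > 0\<close>, so the point at that height
  lies on the upper sheet only.\<close>

lemma sheets_distinct: "torus_proj ` sheet 1 \<noteq> torus_proj ` sheet (- 1)"
proof
  assume A: "torus_proj ` sheet 1 = torus_proj ` sheet (- 1)"
  define X where "X = Rc *\<^sub>R ew"
  have t: "tau X = Rc" using tau_vertical[of 0 Rc] tau_core[OF rr_0] by (simp add: X_def)
  have w: "wb X = Rc" by (rule wb_shift(2)[where n = 0]) (simp_all add: X_def Rc_def)
  have "X \<in> sheet 1" using t w by (simp add: sheet_def)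
  then have "torus_proj X \<in> torus_proj ` sheet (- 1)" using A by blast
  then obtain Y where Y: "torus_proj X = torus_proj Y" "Y \<in> sheet (- 1)" by blast
  have "wa X < 117/2" using w by (simp add: wa_def Rc_def)
  then have "wb Y = Rc" using wa_proj(2)[OF Y(1)] w by simp
  moreover have "tau Y = Rc" using tau_periodic[OF Y(1)] t by simp
  ultimately show False using Y(2) Rc_pos by (simp add: sheet_def)
qed

text \<open>The point (1/2, 1/2) is fixed modulo the lattice by the matrix, whose row sums 1 and 9
  are odd. It lies outside the support of the perturbation, so it is fixed by \<open>G\<close>
  modulo the lattice as well and never meets the disc.\<close>

lemma tau_vanishes: "\<exists>X. tau X = 0 \<and> wb X = 0"
proof -
  define P :: "real ^ 3" where "P = vector [1/2, 1/2, 0]"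
  define N where "N = {X. \<forall>i. X $ i - P $ i \<in> \<int>}"
  have P: "P $ 1 = 1/2" "P $ 2 = 1/2" "P $ 3 = 0" by (simp_all add: P_def)
  have out: "rr X = 0 \<and> aa X = 0" if "X \<in> N" for X
  proof -
    have "X $ 1 - 1/2 \<in> \<int>" using that unfolding N_def P(1)[symmetric] by blast
    then have "(X $ 1 - 1/2) - (X $ 1 - rd X $ 1) \<in> \<int>" by (rule Ints_diff[OF _ rd_Ints])
    then obtain n :: int where n: "rd X $ 1 - 1/2 = of_int n" by (auto elim: Ints_cases)
    have "n \<le> -1 \<or> 0 \<le> n" by linarith
    then have "real_of_int n \<le> -1 \<or> 0 \<le> real_of_int n" by linarith
    then have "1/4 < \<bar>rd X $ 1\<bar>" using n by linarith
    then show ?thesis using box_support[of "rd X"] by (simp add: rr_def aa_def)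
  qed
  have GN: "G X \<in> N" if "X \<in> N" for X
  proof -
    have "\<forall>i. X $ i - P $ i \<in> \<int>" using that by (simp add: N_def)
    then have "Alin X $ i - Alin P $ i \<in> \<int>" for i by (intro Alin_Ints) blast
    moreover have "\<forall>i. Alin P $ i - P $ i \<in> \<int>" by (simp add: forall_3 Alin_def P)
    ultimately have "(Alin X $ i - Alin P $ i) + (Alin P $ i - P $ i) \<in> \<int>" for i by (intro Ints_add) auto
    moreover have "G X = Alin X" using out[OF that] by (simp add: G_def)
    ultimately show ?thesis by (simp add: N_def)
  qed
  have "tau P = 0"
  proof (rule vanishing_of_contraction[where N = N and F = G and q = "1/20" and C = Rc and \<delta> = tau and x = P])
    fix X assume X: "X \<in> N"
    show "0 \<le> tau X \<and> tau X \<le> Rc" using tau_bounds by blast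
    show "tau X = 0 \<or> G X \<in> N \<and> tau X \<le> 1/20 * tau (G X)" using GN[OF X] out[OF X] by (simp add: tau_G)
  qed (simp_all add: N_def)
  moreover have "wb P = 0" by (rule wb_shift(2)[where n = 0]) (simp_all add: ww_def P)
  ultimately show ?thesis by blast
qed

lemma sheets_intersect: "torus_proj ` sheet 1 \<inter> torus_proj ` sheet (- 1) \<noteq> {}"
proof -
  obtain X where "tau X = 0" "wb X = 0" using tau_vanishes by blast
  then have "X \<in> sheet 1" "X \<in> sheet (- 1)" by (simp_all add: sheet_def)
  then show ?thesis by blast
qed

subsection \<open>The metric\<close>

definition gm :: "real \<Rightarrow> 3 torus \<Rightarrow> real ^ 3 \<Rightarrow> real ^ 3 \<Rightarrow> real" where
  "gm \<rho> p v w = uu v * uu w + \<rho>\<^sup>2 * (ss v * ss w) + ww v * ww w"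

lemma metric_norm_gm: "metric_norm (gm \<rho>) p v = sqrt (nq \<rho> v)"
  by (simp add: metric_norm_def gm_def nq_def power2_eq_square)

lemma Ck_const: "Ck k (\<lambda>x :: real ^ 'n::finite. c)"
proof (induction k arbitrary: c)
  case (Suc k)
  have "frechet_derivative (\<lambda>x. c) (at x) = (\<lambda>v. 0)" for x :: "real ^ 'n"
    by (rule frechet_derivative_at[symmetric]) simp
  then show ?case using Suc by simp
qed simp

lemma riemannian_gm: assumes "\<rho> \<noteq> 0" shows "riemannian_metric (gm \<rho>)"
  unfolding riemannian_metric_def
proof (intro conjI allI impI)
  show "bilinear (gm \<rho> p)" for p unfolding bilinear_def by (auto intro!: linearI simp: gm_def algebra_simps)
  show "gm \<rho> p u v = gm \<rho> p v u" for p u v by (simp add: gm_def mult.commute)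
  show "gm \<rho> p v v > 0" if "v \<noteq> 0" for p v
    using nq_pos[OF assms that] by (simp add: gm_def nq_def power2_eq_square)
  show "Ck k (\<lambda>x. gm \<rho> (torus_proj x) u v)" for u v k
    unfolding gm_def by (rule Ck_const)
qed

text \<open>On a line field the stretching of unit vectors is that of any spanning vector, so the
  normalisation of \<open>w\<close> is immaterial.\<close>

lemma line_rate:
  assumes "\<rho> \<noteq> 0" "w X \<noteq> 0" "v \<in> span {w X}" "sqrt (nq \<rho> v) = 1"
  shows "nq \<rho> (DF X v) = nq \<rho> (DF X (w X)) / nq \<rho> (w X)"
proof -
  obtain k where v: "v = k *\<^sub>R w X" using assms(3) by (auto simp: span_singleton)
  have "nq \<rho> v = 1" using assms(4) by simp
  then have "k\<^sup>2 * nq \<rho> (w X) = 1" by (simp add: v nq_scale)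
  then have "k\<^sup>2 = 1 / nq \<rho> (w X)" using nq_pos[OF assms(1,2)] by (simp add: field_simps)
  then show ?thesis by (simp add: v linear_scale[OF linear_DF] nq_scale)
qed

theorem theorem2p8:
  shows "\<exists>(f :: 3 torus \<Rightarrow> 3 torus) z g Eu Ec Es T1 T2.
    torus_diffeo f \<and> sink f z \<and>
    riemannian_metric g \<and> dominated_splitting f g Eu Ec Es \<and>
    frontier (basin f z) = T1 \<union> T2 \<and> T1 \<noteq> T2 \<and> T1 \<inter> T2 \<noteq> {} \<and>
    embedded_2torus_tangent_to T1 (bundle_sum Ec Es) \<and>
    embedded_2torus_tangent_to T2 (bundle_sum Ec Es) \<and>
    partially_hyperbolic_on (- basin f z) f g Eu Ec Es"
proof -
  let ?f = "torus_map F" and ?z = "torus_proj 0 :: 3 torus"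
  let ?Eu = "line_field wu" and ?Ec = "line_field wc" and ?Es = "line_field ws"
  obtain C where C: "0 < C" "\<And>X. norm (si X) \<le> C" using si(3) by blast
  \<comment> \<open>With this weight the plane part of \<open>ws\<close> contributes at most
    \<open>C\<^sup>2\<close>, a quarter of \<open>\<rho>\<^sup>2\<close>; hence the factor 5/4, and
    \<open>(11/100)\<^sup>2 * (5/4)\<close> is below 3/100.\<close>
  define \<rho> where "\<rho> = 2 * C"
  have \<rho>: "\<rho> \<noteq> 0" using C(1) by (simp add: \<rho>_def)
  have nws: "\<rho>\<^sup>2 \<le> nq \<rho> (ws X)" "nq \<rho> (ws X) \<le> 5/4 * \<rho>\<^sup>2" for X
  proof -
    have "(fst (si X))\<^sup>2 + (snd (si X))\<^sup>2 = (norm (si X))\<^sup>2" by (simp add: norm_prod_def)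
    moreover have "(norm (si X))\<^sup>2 \<le> C\<^sup>2" using C by (intro power_mono) auto
    ultimately show "\<rho>\<^sup>2 \<le> nq \<rho> (ws X)" "nq \<rho> (ws X) \<le> 5/4 * \<rho>\<^sup>2"
      by (simp_all add: nq_def \<rho>_def power_mult_distrib)
  qed
  have rs: "nq \<rho> (DF X (ws X)) / nq \<rho> (ws X) < 3/100" for X
  proof -
    have l: "lam\<^sup>2 \<le> (11/100)\<^sup>2" using lam_bounds by (intro power_mono) auto
    have "nq \<rho> (DF X (ws X)) \<le> (11/100)\<^sup>2 * (5/4 * \<rho>\<^sup>2)"
      unfolding DF_ws nq_scale using l nws(2)[of "F X"] by (intro mult_mono) (auto simp: nq_def)
    also have "\<dots> < 3/100 * \<rho>\<^sup>2" using \<rho> by (simp add: power_divide)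
    also have "\<dots> \<le> 3/100 * nq \<rho> (ws X)" using nws(1) by simp
    finally show ?thesis using nq_pos[OF \<rho> frames_nonzero(1)] by (simp add: divide_less_eq)
  qed
  have rc: "3/100 \<le> nq \<rho> (DF X (wc X)) / nq \<rho> (wc X)" for X
    using domination_cs[of \<rho> X] nq_pos[OF \<rho> frames_nonzero(2)[of X]] by (simp add: le_divide_eq)
  have rcu: "nq \<rho> (DF X (wc X)) / nq \<rho> (wc X) < nq \<rho> (DF X (wu X)) / nq \<rho> (wu X)" for X
    using domination_uc[of \<rho> X] nq_pos[OF \<rho> frames_nonzero(2)[of X]] nq_pos[OF \<rho> frames_nonzero(3)[of X]]
    by (simp add: divide_less_eq less_divide_eq)
  note inv = invariant_line_field[OF periodic_frames(2) DF_wc] invariant_line_field[OF periodic_frames(3) DF_wu]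
  have "\<exists>c. c \<noteq> 0 \<and> DF X (ws X) = c *\<^sub>R ws (F X)" for X
    using DF_ws lam_bounds by (intro exI[of _ lam]) auto
  note invs = invariant_line_field[OF periodic_frames(1) this]
  have dom: "dominated_splitting ?f (gm \<rho>) ?Eu ?Ec ?Es"
    unfolding dominated_splitting_def
  proof (intro conjI)
    show "\<forall>E\<in>{?Eu, ?Ec, ?Es}. continuous_subbundle E \<and> nonzero_bundle E \<and> invariant_bundle ?f E"
      using inv invs continuous_subbundle_ws continuous_subbundle_wc continuous_subbundle_wu
        line_field_nonzero[OF frames_nonzero(1)] line_field_nonzero[OF frames_nonzero(2)]
        line_field_nonzero[OF frames_nonzero(3)] by simp
    show "\<forall>p v. \<exists>!(a, b, c). a \<in> ?Eu p \<and> b \<in> ?Ec p \<and> c \<in> ?Es p \<and> v = a + b + c"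
    proof (intro allI)
      fix p :: "3 torus" and v
      obtain X where p: "p = torus_proj X" using torus_proj_surj by metis
      show "\<exists>!(a, b, c). a \<in> ?Eu p \<and> b \<in> ?Ec p \<and> c \<in> ?Es p \<and> v = a + b + c"
        unfolding p periodic_frames[THEN line_field_proj]
        by (rule unique_decomposition[OF ss_wu ss_wc coords_ws(2) frame_det])
    qed
    show "\<forall>p. \<forall>vs\<in>?Es p. \<forall>vc\<in>?Ec p. \<forall>vu\<in>?Eu p.
        metric_norm (gm \<rho>) p vs = 1 \<longrightarrow> metric_norm (gm \<rho>) p vc = 1 \<longrightarrow> metric_norm (gm \<rho>) p vu = 1 \<longrightarrow>
        metric_norm (gm \<rho>) (?f p) (torus_deriv ?f p vs) < metric_norm (gm \<rho>) (?f p) (torus_deriv ?f p vc) \<and>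
        metric_norm (gm \<rho>) (?f p) (torus_deriv ?f p vc) < metric_norm (gm \<rho>) (?f p) (torus_deriv ?f p vu)"
    proof (intro allI ballI impI)
      fix p :: "3 torus" and vs vc vu
      obtain X where p: "p = torus_proj X" using torus_proj_surj by metis
      assume "vs \<in> ?Es p" "vc \<in> ?Ec p" "vu \<in> ?Eu p"
        "metric_norm (gm \<rho>) p vs = 1" "metric_norm (gm \<rho>) p vc = 1" "metric_norm (gm \<rho>) p vu = 1"
      note v = this[unfolded p metric_norm_gm periodic_frames[THEN line_field_proj]]
      note r = line_rate[where w = ws, OF \<rho> frames_nonzero(1) v(1,4)] line_rate[where w = wc, OF \<rho> frames_nonzero(2) v(2,5)]
        line_rate[where w = wu, OF \<rho> frames_nonzero(3) v(3,6)]
      show "metric_norm (gm \<rho>) (?f p) (torus_deriv ?f p vs) < metric_norm (gm \<rho>) (?f p) (torus_deriv ?f p vc) \<and>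
        metric_norm (gm \<rho>) (?f p) (torus_deriv ?f p vc) < metric_norm (gm \<rho>) (?f p) (torus_deriv ?f p vu)"
        unfolding p metric_norm_gm torus_deriv_F real_sqrt_less_iff r
        using order.strict_trans2[OF rs rc] rcu by blast
    qed
  qed
  have ph: "partially_hyperbolic_on (- basin ?f ?z) ?f (gm \<rho>) ?Eu ?Ec ?Es"
    unfolding partially_hyperbolic_on_def
  proof (intro conjI ballI impI image_Compl_basin dom)
    fix p vs vu
    assume "p \<in> - basin ?f ?z" and A: "vs \<in> ?Es p" "vu \<in> ?Eu p"
      "metric_norm (gm \<rho>) p vs = 1" "metric_norm (gm \<rho>) p vu = 1"
    obtain X where p: "p = torus_proj X" using torus_proj_surj by metis
    have w: "tau X \<le> wa X" using \<open>p \<in> - basin ?f ?z\<close> by (simp add: p mem_basin not_less)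
    note v = A[unfolded p metric_norm_gm periodic_frames[THEN line_field_proj]]
    note r = line_rate[where w = ws, OF \<rho> frames_nonzero(1) v(1,3)] line_rate[where w = wu, OF \<rho> frames_nonzero(3) v(2,4)]
    show "metric_norm (gm \<rho>) (?f p) (torus_deriv ?f p vs) < 1"
      unfolding p metric_norm_gm torus_deriv_F real_sqrt_lt_1_iff r using rs[of X] by linarith
    show "1 < metric_norm (gm \<rho>) (?f p) (torus_deriv ?f p vu)"
      unfolding p metric_norm_gm torus_deriv_F real_sqrt_gt_1_iff r
      using expansion_u[OF w, of \<rho>] nq_pos[OF \<rho> frames_nonzero(3)[of X]] by (simp add: less_divide_eq)
  qed
  show ?thesis
    by (intro exI conjI)
      (rule torus_diffeo_F sink_F riemannian_gm[OF \<rho>] dom frontier_basin sheets_distinct sheets_intersect ph tangent_emb; simp)+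
qed

end
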